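(* Let $Y$ be the periodic $q$-cubical lattice with side lengths $\vec n=(n_1,\dots,n_q)$ (all $n_i\ge 2$), and $|\vec n|=\prod_{i=1}^q n_i$. Then \[ \zeta_{Y}(u)^{-1}=(1-u^2)^{(q-1)|\vec n|}\prod_{k_1=1}^{n_1}\cdots\prod_{k_q=1}^{n_q}\Big\{1-2u\sum_{i=1}^q\cos\frac{2\pi k_i}{n_i}+(2q-1)u^2\Big\}, \] and (when $q\ge 2$) for the $(q-1)$-skeleton, \[ \zeta_{Y^{(q-1)}}(u)^{-1}=(1-u)^{\kappa|\vec n|}(1+3u)^{\gamma|\vec n|}\prod_{k_1=1}^{n_1}\cdots\prod_{k_q=1}^{n_q}F_1^{\mathrm{up}}(u,\vec k), \] where $\vec k=(k_1,\dots,k_q)$, $\kappa=q(3q-5)/2$, $\gamma=q(q-3)/2$, \[ F_1^{\mathrm{up}}(u,\vec k)=\sum_{\ell=0}^q(2-\ell)2^{\ell-1}e_\ell(\mathbf w)\Big\{1-2u\sum_{i=1}^q\cos\frac{2\pi k_i}{n_i}+3(2q-3)u^2\Big\}^{q-\ell}u^\ell, \] $\mathbf w=(w_1,\dots,w_q)$ with $w_i=2+2\cos\frac{2\pi k_i}{n_i}$, and $e_\ell$ is the $\ell$-th elementary symmetric polynomial in $q$ variables.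
   Context: Fix integers $q\ge1$ and $\vec n=(n_1,\dots,n_q)$ with $n_i\ge2$. Let $K$ be the complete simplicial complex on $\{1,\dots,q\}$, i.e. all subsets of $\{1,\dots,q\}$ including $\emptyset$; $K_k$ denotes the set of subsets of cardinality $k+1$. For each $i$ let $\mathcal I_i=\{[0,1],[1,2],\dots,[n_i-1,0]\}$ be the unit intervals in the circle $\mathbb R/n_i\mathbb Z$ and $\mathcal P_i=\{[0,0],[1,1],\dots,[n_i-1,n_i-1]\}$ the degenerate intervals. For $\sigma\in K$ let $Y_\sigma=\{I_1\times\cdots\times I_q: I_i\in\mathcal I_i \text{ if } i\in\sigma,\ I_i\in\mathcal P_i \text{ otherwise}\}$, and let $Y_k=\bigsqcup_{\sigma\in K_{k-1}}Y_\sigma$ be the set of $k$-cubes ($0\le k\le q$). The $d$-skeleton is $Y^{(d)}=\bigsqcup_{k=0}^dY_k$ and $Y=Y^{(q)}$ is the periodic $q$-cubical lattice (realized in the $q$-torus). For $1\le d\le q$, a closed path in $Y^{(d)}$ is a cyclic sequence $(\tau_0,\sigma_0,\tau_1,\sigma_1,\dots,\tau_{m-1},\sigma_{m-1})$ of $(d-1)$-cubes $\tau_i$ and $d$-cubes $\sigma_i$ with $\tau_i\ne\tau_{i+1}$ and $\tau_{i+1}\subset\sigma_i\cap\sigma_{i+1}$ for all $i\in\mathbb Z/m\mathbb Z$; its length is $m$. It is a closed geodesic if moreover $\sigma_i\neq\sigma_{i+1}$ for all $i$. A closed geodesic is prime if it is not the $r$-fold repetition of a closed geodesic for any $r\ge2$.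 A prime cycle is an equivalence class of prime closed geodesics under cyclic shifts; its length $|\mathfrak p|$ is the length of a representative. The zeta function is $\zeta_{Y^{(d)}}(u)=\prod_{\mathfrak p}(1-u^{|\mathfrak p|})^{-1}$, the product over all prime cycles of $Y^{(d)}$, for $|u|$ sufficiently small; $\zeta_Y:=\zeta_{Y^{(q)}}$. The elementary symmetric polynomials are defined by $\prod_{k=1}^q(\lambda+t_k)=\sum_{\ell=0}^q e_\ell(t_1,\dots,t_q)\lambda^{q-\ell}$ (so $e_0=1$). *)

theory Defs
  imports "HOL-Analysis.Analysis" "HOL-Computational_Algebra.Polynomial"
begin

section \<open>The periodic cubical lattice\<close>

text \<open>A point of the circle R/nZ is a coset \<open>x + nZ\<close>.\<close>

definition circle_point :: "nat \<Rightarrow> real \<Rightarrow> real set" where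
  "circle_point n x = {y. \<exists>m::int. y = x + of_int m * real n}"

definition unit_intervals :: "nat \<Rightarrow> real set set set" where
  "unit_intervals n = {circle_point n ` {real a..real a + 1} | a. a < n}"

definition point_intervals :: "nat \<Rightarrow> real set set set" where
  "point_intervals n = {circle_point n ` {real a..real a} | a. a < n}"

text \<open>
  Cubes are actual subsets of the torus, the product of the circles \<open>R/n\<^sub>iZ\<close> for \<open>i \<in> {1..q}\<close>;
  a point of the torus is an extensional function on \<open>{1..q}\<close>. Containment of cubes is
  containment of these point sets. The side lengths are the values of \<open>n\<close> on \<open>{1..q}\<close>.
\<close>

type_synonym cube = "(nat \<Rightarrow> real set) set"

definition cubes_of_type :: "nat \<Rightarrow> (nat \<Rightarrow> nat) \<Rightarrow> nat set \<Rightarrow> cube set" where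
  "cubes_of_type q n \<sigma> =
     {PiE {1..q} I | I. \<forall>i\<in>{1..q}.
        I i \<in> (if i \<in> \<sigma> then unit_intervals (n i) else point_intervals (n i))}"

definition cubes :: "nat \<Rightarrow> (nat \<Rightarrow> nat) \<Rightarrow> nat \<Rightarrow> cube set" where
  "cubes q n k = (\<Union>\<sigma>\<in>{\<sigma>. \<sigma> \<subseteq> {1..q} \<and> card \<sigma> = k}. cubes_of_type q n \<sigma>)"


section \<open>Closed geodesics and the zeta function of a skeleton\<close>

text \<open>
  The cyclic sequence \<open>(\<tau>\<^sub>0, \<sigma>\<^sub>0, \<dots>, \<tau>\<^sub>m\<^sub>-\<^sub>1, \<sigma>\<^sub>m\<^sub>-\<^sub>1)\<close> is the list of the pairs \<open>(\<tau>\<^sub>i, \<sigma>\<^sub>i)\<close>,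
  so its length \<open>m\<close> is the length of the list, and \<open>i + 1\<close> is taken modulo \<open>m\<close>.
  The functions below concern the \<open>d\<close>-skeleton and are meant for \<open>1 \<le> d \<le> q\<close>.
\<close>

definition closed_path :: "nat \<Rightarrow> (nat \<Rightarrow> nat) \<Rightarrow> nat \<Rightarrow> (cube \<times> cube) list \<Rightarrow> bool" where
  "closed_path q n d c \<longleftrightarrow>
     c \<noteq> [] \<and> set c \<subseteq> cubes q n (d - 1) \<times> cubes q n d \<and>
     (\<forall>i<length c. let j = Suc i mod length c in
        fst (c ! i) \<noteq> fst (c ! j) \<and> fst (c ! j) \<subseteq> snd (c ! i) \<inter> snd (c ! j))"

definition closed_geodesic :: "nat \<Rightarrow> (nat \<Rightarrow> nat) \<Rightarrow> nat \<Rightarrow> (cube \<times> cube) list \<Rightarrow> bool" where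
  "closed_geodesic q n d c \<longleftrightarrow>
     closed_path q n d c \<and>
     (\<forall>i<length c. snd (c ! i) \<noteq> snd (c ! (Suc i mod length c)))"

definition prime_geodesic :: "nat \<Rightarrow> (nat \<Rightarrow> nat) \<Rightarrow> nat \<Rightarrow> (cube \<times> cube) list \<Rightarrow> bool" where
  "prime_geodesic q n d c \<longleftrightarrow>
     closed_geodesic q n d c \<and>
     \<not> (\<exists>b r. closed_geodesic q n d b \<and> r \<ge> 2 \<and> c = concat (replicate r b))"

definition prime_cycles :: "nat \<Rightarrow> (nat \<Rightarrow> nat) \<Rightarrow> nat \<Rightarrow> (cube \<times> cube) list set set" where
  "prime_cycles q n d =
     {c. prime_geodesic q n d c} //
     {(b, c). prime_geodesic q n d b \<and> prime_geodesic q n d c \<and> (\<exists>k. c = rotate k b)}"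

definition cycle_length :: "(cube \<times> cube) list set \<Rightarrow> nat" where
  "cycle_length p = length (SOME c. c \<in> p)"

text \<open>
  The product over all prime cycles is unordered: the limit of the finite partial products
  along the directed set of finite sets of prime cycles, as for \<open>has_sum\<close>.
\<close>

definition partial_zeta :: "complex \<Rightarrow> (cube \<times> cube) list set set \<Rightarrow> complex" where
  "partial_zeta u P = (\<Prod>p\<in>P. inverse (1 - u ^ cycle_length p))"

definition zeta_convergent :: "nat \<Rightarrow> (nat \<Rightarrow> nat) \<Rightarrow> nat \<Rightarrow> complex \<Rightarrow> bool" where
  "zeta_convergent q n d u \<longleftrightarrow>
     (\<exists>z. z \<noteq> 0 \<and> (partial_zeta u \<longlongrightarrow> z) (finite_subsets_at_top (prime_cycles q n d)))"

definition zeta :: "nat \<Rightarrow> (nat \<Rightarrow> nat) \<Rightarrow> nat \<Rightarrow> complex \<Rightarrow> complex" where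
  "zeta q n d u = Lim (finite_subsets_at_top (prime_cycles q n d)) (partial_zeta u)"


section \<open>The closed formulas\<close>

definition elem_sym :: "nat \<Rightarrow> (nat \<Rightarrow> 'a::comm_ring_1) \<Rightarrow> nat \<Rightarrow> 'a" where
  "elem_sym q t l = poly.coeff (\<Prod>k=1..q. [:t k, 1:]) (q - l)"

definition cos_freq :: "(nat \<Rightarrow> nat) \<Rightarrow> (nat \<Rightarrow> nat) \<Rightarrow> nat \<Rightarrow> complex" where
  "cos_freq n k i = complex_of_real (cos (2 * pi * real (k i) / real (n i)))"

definition F_up :: "nat \<Rightarrow> (nat \<Rightarrow> nat) \<Rightarrow> complex \<Rightarrow> (nat \<Rightarrow> nat) \<Rightarrow> complex" where
  "F_up q n u k =
     (\<Sum>l=0..q. (2 - of_nat l) * 2 powi (int l - 1)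
        * elem_sym q (\<lambda>i. 2 + 2 * cos_freq n k i) l
        * (1 - 2 * u * (\<Sum>i=1..q. cos_freq n k i) + 3 * (2 * of_nat q - 3) * u\<^sup>2) ^ (q - l)
        * u ^ l)"

text \<open>
  Both numerators are even, so the divisions are exact. \<open>\<gamma>\<close> is negative for \<open>q = 2\<close>,
  hence the integer exponents.
\<close>

definition kappa :: "nat \<Rightarrow> int" where
  "kappa q = int q * (3 * int q - 5) div 2"

definition gamma :: "nat \<Rightarrow> int" where
  "gamma q = int q * (int q - 3) div 2"

end

theory Submission
  imports Defs "Jordan_Normal_Form.Schur_Decomposition"
begin

text \<open>
  A closed geodesic of the \<open>d\<close>-skeleton is a cyclic walk on the flags (pairs of a \<open>(d - 1)\<close>-cube inside a
  \<open>d\<close>-cube), and the product over prime cycles equals \<open>1 / det (1 - u T)\<close> for the 0-1 matrix \<open>T\<close> of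
  admissible steps: the logarithms of both sides count closed walks by length. The incidence of
  \<open>(d - 1)\<close>-cubes and \<open>d\<close>-cubes is biregular, with degrees \<open>a = 2 d\<close> and \<open>b = 2 (q - d + 1)\<close>, so \<open>T\<close>
  is built from the incidence matrix \<open>M\<close>, and \<open>det (1 - u T)\<close> reduces by \<open>det (1 - X Y) = det (1 - Y X)\<close>
  to powers of \<open>1 - u\<close> and \<open>\<beta> = 1 + (b - 1) u\<close> times \<open>det (\<alpha> \<beta> - u M M\<^sup>T)\<close> with \<open>\<alpha> = 1 + (a - 1) u\<close>.
  The characters of the torus make \<open>M M\<^sup>T\<close> block diagonal, with one block for each frequency. The block is
  a number for \<open>d = q\<close>, and a diagonal matrix plus a matrix of rank one for \<open>d = q - 1\<close>, which is
  where the elementary symmetric polynomials come from.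
\<close>

section \<open>Determinants indexed by finite sets\<close>

text \<open>A closed geodesic is a closed walk without backtracking in the incidence graph of lower
  and upper cells, and one step on flags covers two of its edges. So the object is an Ihara zeta
  function in a square root of \<open>u\<close>, and the reduction is Bass's determinant formula for
  a biregular graph. Forbidding repetition on both levels is what forces the step matrix onto flags:
  it is not a polynomial in an adjacency matrix of cubes.

  Sylvester's identity does four jobs: renaming indices, passing from flags to cubes, passing from
  positions to frequencies, and evaluating the rank one perturbation. In each case a matrix is
  written as one minus a product through another index set, so no change of basis is ever inverted.

  The formulas are claimed only near 0. There 1 - u, \<alpha>, \<beta> and the diagonal entries of
  the blocks are all nonzero, being 1 at u = 0, so division by them is harmless.

  A side of length 2 is the delicate case of the geometry: both unit intervals of that circle have
  the same end points, so a cell is not determined by its vertices.\<close>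

definition mat_on :: "'a set \<Rightarrow> 'b set \<Rightarrow> ('a \<Rightarrow> 'b \<Rightarrow> 'c) \<Rightarrow> 'c mat" where
  "mat_on S R f =
     Matrix.mat (card S) (card R) (\<lambda>(i, j). f (from_nat_into S i) (from_nat_into R j))"

text \<open>Rows and columns are listed by the same arbitrary enumeration of \<open>S\<close>, so
  the value does not depend on it. Flags, cubes and pairs with a frequency can then serve directly
  as indices.\<close>

definition det_on :: "'a set \<Rightarrow> ('a \<Rightarrow> 'a \<Rightarrow> 'c::comm_ring_1) \<Rightarrow> 'c" where
  "det_on S f = Determinant.det (mat_on S S f)"

lemma mat_on_carrier [simp]: "mat_on S R f \<in> carrier_mat (card S) (card R)"
  by (simp add: mat_on_def)

lemma from_nat_into_card: "finite S \<Longrightarrow> i < card S \<Longrightarrow> from_nat_into S i \<in> S"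
  by (rule from_nat_into) auto

lemma from_nat_into_eq_iff:
  "finite S \<Longrightarrow> i < card S \<Longrightarrow> j < card S \<Longrightarrow> from_nat_into S i = from_nat_into S j \<longleftrightarrow> i = j"
  using bij_betw_from_nat_into_finite[of S] by (auto simp: bij_betw_def inj_on_def)

lemma sum_from_nat_into:
  "finite S \<Longrightarrow> (\<Sum>i<card S. g (from_nat_into S i)) = sum g S"
  by (rule sum.reindex_bij_betw[OF bij_betw_from_nat_into_finite])

lemma prod_from_nat_into:
  "finite S \<Longrightarrow> (\<Prod>i<card S. g (from_nat_into S i)) = prod g S"
  by (rule prod.reindex_bij_betw[OF bij_betw_from_nat_into_finite])

lemma mat_on_cong:
  assumes "finite S" "finite R" "\<And>x y. x \<in> S \<Longrightarrow> y \<in> R \<Longrightarrow> f x y = g x y"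
  shows "mat_on S R f = mat_on S R g"
  unfolding mat_on_def using assms by (intro cong_mat) (auto intro: from_nat_into_card)

lemma det_on_cong:
  assumes "finite S" "\<And>x y. x \<in> S \<Longrightarrow> y \<in> S \<Longrightarrow> f x y = g x y"
  shows "det_on S f = det_on S g"
  unfolding det_on_def using mat_on_cong[of S S f g] assms by simp

lemma mat_on_mult:
  assumes "finite R"
  shows "mat_on S R f * mat_on R Q g = mat_on S Q (\<lambda>x z. \<Sum>y\<in>R. f x y * g y z)"
proof (rule eq_matI)
  fix i j assume "i < dim_row (mat_on S Q (\<lambda>x z. \<Sum>y\<in>R. f x y * g y z))"
    "j < dim_col (mat_on S Q (\<lambda>x z. \<Sum>y\<in>R. f x y * g y z))"
  then have ij: "i < card S" "j < card Q" by (simp_all add: mat_on_def)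
  then show "(mat_on S R f * mat_on R Q g) $$ (i, j) = mat_on S Q (\<lambda>x z. \<Sum>y\<in>R. f x y * g y z) $$ (i, j)"
    by (simp add: mat_on_def scalar_prod_def sum_from_nat_into[OF assms, symmetric] atLeast0LessThan)
qed (simp_all add: mat_on_def)

lemma mat_on_one:
  "finite S \<Longrightarrow> mat_on S S (\<lambda>x y. of_bool (x = y)) = 1\<^sub>m (card S)"
  unfolding mat_on_def by (rule eq_matI) (auto simp: from_nat_into_eq_iff)

lemma det_on_mult:
  assumes "finite S"
  shows "det_on S (\<lambda>x z. \<Sum>y\<in>S. f x y * g y z) = det_on S f * det_on S g"
  unfolding det_on_def mat_on_mult[OF assms, symmetric] by (rule det_mult[of _ "card S"]) simp_all

lemma det_on_diag:
  fixes d :: "'a \<Rightarrow> 'c::idom"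
  assumes "finite S"
  shows "det_on S (\<lambda>x y. of_bool (x = y) * d x) = prod d S"
proof -
  have "det_on S (\<lambda>x y. of_bool (x = y) * d x) =
      prod_list (diag_mat (mat_on S S (\<lambda>x y. of_bool (x = y) * d x)))"
    unfolding det_on_def
    by (rule det_upper_triangular[of _ "card S"])
      (auto simp: mat_on_def from_nat_into_eq_iff assms)
  also have "\<dots> = (\<Prod>i<card S. d (from_nat_into S i))"
    by (auto simp: prod_list_diag_prod mat_on_def atLeast0LessThan intro!: prod.cong)
  finally show ?thesis using prod_from_nat_into[OF assms] by metis
qed

text \<open>Sylvester's identity. The block matrix with unit diagonal blocks and off-diagonal blocks
  \<open>X\<close>, \<open>Y\<close> has two factorisations sharing the unipotent factor
  \<open>?L\<close>, one leaving \<open>1 - Y * X\<close> in the other factor and one leaving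
  \<open>1 - X * Y\<close>. No inverse occurs, so an integral domain suffices.\<close>

lemma det_one_minus_mult_commute:
  fixes X Y :: "'c::idom mat"
  assumes X: "X \<in> carrier_mat m n" and Y: "Y \<in> carrier_mat n m"
  shows "Determinant.det (1\<^sub>m m - X * Y) = Determinant.det (1\<^sub>m n - Y * X)"
proof -
  have XY: "X * Y \<in> carrier_mat m m" "Y * X \<in> carrier_mat n n" using X Y by auto
  let ?L = "four_block_mat (1\<^sub>m m) (0\<^sub>m m n) Y (1\<^sub>m n)"
  have minus_add: "Z + (1\<^sub>m k - Z) = 1\<^sub>m k" and minus_add': "1\<^sub>m k - Z + Z = 1\<^sub>m k"
    if "Z \<in> carrier_mat k k" for k and Z :: "'c mat"
    using that by (auto intro!: eq_matI)
  have YX: "Y * X + (1\<^sub>m n - Y * X) = 1\<^sub>m n" "1\<^sub>m m - X * Y + X * Y = 1\<^sub>m m"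
    using minus_add[OF XY(2)] minus_add'[OF XY(1)] by simp_all
  have "?L * four_block_mat (1\<^sub>m m) X (0\<^sub>m n m) (1\<^sub>m n - Y * X) =
      four_block_mat (1\<^sub>m m) X Y (1\<^sub>m n)"
    using X Y XY YX(1) by (subst mult_four_block_mat[of _ m m _ n _ n _ _ m _ n]) auto
  moreover have "four_block_mat (1\<^sub>m m - X * Y) X (0\<^sub>m n m) (1\<^sub>m n) * ?L =
      four_block_mat (1\<^sub>m m) X Y (1\<^sub>m n)"
    using X Y XY YX(2) by (subst mult_four_block_mat[of _ m m _ n _ n _ _ m _ n]) auto
  moreover have L: "Determinant.det ?L = 1"
    unfolding det_four_block_mat_upper_right_zero[OF one_carrier_mat refl Y one_carrier_mat] by simp
  moreover have "Determinant.det (four_block_mat (1\<^sub>m m) X (0\<^sub>m n m) (1\<^sub>m n - Y * X)) =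
      Determinant.det (1\<^sub>m n - Y * X)"
    unfolding det_four_block_mat_lower_left_zero[OF one_carrier_mat X refl minus_carrier_mat[OF XY(2)]]
    by simp
  moreover have "Determinant.det (four_block_mat (1\<^sub>m m - X * Y) X (0\<^sub>m n m) (1\<^sub>m n)) =
      Determinant.det (1\<^sub>m m - X * Y)"
    unfolding det_four_block_mat_lower_left_zero[OF minus_carrier_mat[OF XY(1)] X refl one_carrier_mat]
    by simp
  moreover have "?L \<in> carrier_mat (m + n) (m + n)"
    by (rule four_block_carrier_mat) simp_all
  moreover have "four_block_mat (1\<^sub>m m) X (0\<^sub>m n m) (1\<^sub>m n - Y * X) \<in> carrier_mat (m + n) (m + n)"
    by (rule four_block_carrier_mat) (use XY in \<open>simp_all add: minus_carrier_mat\<close>)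
  moreover have "four_block_mat (1\<^sub>m m - X * Y) X (0\<^sub>m n m) (1\<^sub>m n) \<in> carrier_mat (m + n) (m + n)"
    by (rule four_block_carrier_mat) (use XY in \<open>simp_all add: minus_carrier_mat\<close>)
  ultimately have "Determinant.det ?L * Determinant.det (1\<^sub>m n - Y * X) =
      Determinant.det (1\<^sub>m m - X * Y) * Determinant.det ?L"
    by (metis det_mult)
  then show ?thesis by (simp add: L)
qed

lemma det_on_one_minus_commute:
  fixes f :: "'a \<Rightarrow> 'b \<Rightarrow> 'c::idom"
  assumes "finite S" "finite R"
  shows "det_on S (\<lambda>x y. of_bool (x = y) - (\<Sum>r\<in>R. f x r * g r y)) =
         det_on R (\<lambda>r s. of_bool (r = s) - (\<Sum>x\<in>S. g r x * f x s))"
proof -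
  have *: "mat_on T T (\<lambda>x y. of_bool (x = y) - h x y) = 1\<^sub>m (card T) - mat_on T T h"
    if "finite T" for T :: "'d set" and h :: "'d \<Rightarrow> 'd \<Rightarrow> 'c"
    unfolding mat_on_one[OF that, symmetric] by (rule eq_matI) (auto simp: mat_on_def)
  show ?thesis
    unfolding det_on_def *[OF assms(1)] *[OF assms(2)]
      mat_on_mult[OF assms(1), symmetric] mat_on_mult[OF assms(2), symmetric]
    by (rule det_one_minus_mult_commute) simp_all
qed

lemma det_on_scale:
  fixes f :: "'a \<Rightarrow> 'a \<Rightarrow> 'c::comm_ring_1"
  shows "det_on S (\<lambda>x y. c * f x y) = c ^ card S * det_on S f"
proof -
  have "mat_on S S (\<lambda>x y. c * f x y) = c \<cdot>\<^sub>m mat_on S S f"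
    by (rule eq_matI) (auto simp: mat_on_def)
  then show ?thesis by (simp add: det_on_def det_smult mat_on_def)
qed

lemma sum_of_bool_delta [simp]:
  fixes g :: "'a \<Rightarrow> 'c::semiring_1"
  assumes "finite A" "x \<in> A"
  shows "(\<Sum>y\<in>A. of_bool (x = y) * g y) = g x" "(\<Sum>y\<in>A. of_bool (y = x) * g y) = g x"
    "(\<Sum>y\<in>A. g y * of_bool (x = y)) = g x" "(\<Sum>y\<in>A. g y * of_bool (y = x)) = g x"
  using assms by (simp_all add: of_bool_def if_distrib[of "\<lambda>c. c * _"] if_distrib[of "\<lambda>c. _ * c"]
      cong: if_cong)

text \<open>Reindexing is the commutation rule for \<open>1 - (1 - f)\<close>, factored through the graph of \<open>h\<close>.\<close>

lemma det_on_bij: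
  fixes f :: "'b \<Rightarrow> 'b \<Rightarrow> 'c::idom"
  assumes fin: "finite S" and h: "bij_betw h S T"
  shows "det_on S (\<lambda>x y. f (h x) (h y)) = det_on T f"
proof -
  have finT: "finite T" and hT: "\<And>x. x \<in> S \<Longrightarrow> h x \<in> T"
    using fin h bij_betw_finite bij_betwE by blast+
  have inj: "\<And>x y. x \<in> S \<Longrightarrow> y \<in> S \<Longrightarrow> h x = h y \<longleftrightarrow> x = y"
    using h by (auto simp: bij_betw_def inj_on_def)
  define g where "g = (\<lambda>x y. of_bool (x = y) - f x y)"
  have "det_on S (\<lambda>x y. f (h x) (h y)) =
      det_on S (\<lambda>x y. of_bool (x = y) - (\<Sum>r\<in>T. of_bool (h x = r) * g r (h y)))"
    using fin finT hT by (intro det_on_cong) (auto simp: g_def inj)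
  also have "\<dots> = det_on T (\<lambda>r s. of_bool (r = s) - (\<Sum>x\<in>S. g r (h x) * of_bool (h x = s)))"
    by (rule det_on_one_minus_commute[OF fin finT])
  also have "\<dots> = det_on T f"
  proof (rule det_on_cong[OF finT])
    fix r s assume s: "r \<in> T" "s \<in> T"
    have "(\<Sum>x\<in>S. g r (h x) * of_bool (h x = s)) = (\<Sum>t\<in>T. g r t * of_bool (t = s))"
      by (rule sum.reindex_bij_betw[OF h])
    then show "of_bool (r = s) - (\<Sum>x\<in>S. g r (h x) * of_bool (h x = s)) = f r s"
      using finT s by (simp add: g_def)
  qed
  finally show ?thesis .
qed

section \<open>Powers, traces and eigenvalues of matrices indexed by a finite set\<close>

fun pow_on :: "'a set \<Rightarrow> ('a \<Rightarrow> 'a \<Rightarrow> 'c::semiring_1) \<Rightarrow> nat \<Rightarrow> 'a \<Rightarrow> 'a \<Rightarrow> 'c" where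
  "pow_on S f 0 = (\<lambda>x y. of_bool (x = y))"
| "pow_on S f (Suc k) = (\<lambda>x z. \<Sum>y\<in>S. pow_on S f k x y * f y z)"

lemma mat_on_pow:
  assumes "finite S"
  shows "mat_on S S f ^\<^sub>m k = mat_on S S (pow_on S f k)"
proof (induction k)
  case 0
  show ?case using mat_on_one[OF assms, where ?'b = 'b] by (simp add: mat_on_def)
qed (simp add: mat_on_mult assms)

lemma trace_mult_commute:
  fixes X Y :: "'c::comm_semiring_0 mat"
  assumes "X \<in> carrier_mat m n" "Y \<in> carrier_mat n m"
  shows "(\<Sum>i<m. (X * Y) $$ (i, i)) = (\<Sum>i<n. (Y * X) $$ (i, i))"
proof -
  have "(\<Sum>i<m. (X * Y) $$ (i, i)) = (\<Sum>i<m. \<Sum>j<n. X $$ (i, j) * Y $$ (j, i))"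
    using assms by (auto simp: scalar_prod_def atLeast0LessThan intro!: sum.cong)
  also have "\<dots> = (\<Sum>j<n. \<Sum>i<m. Y $$ (j, i) * X $$ (i, j))"
    by (subst sum.swap) (simp add: mult.commute)
  also have "\<dots> = (\<Sum>i<n. (Y * X) $$ (i, i))"
    using assms by (auto simp: scalar_prod_def atLeast0LessThan intro!: sum.cong)
  finally show ?thesis .
qed

lemma upper_triangular_pow:
  fixes B :: "'c::semiring_1 mat"
  assumes B: "B \<in> carrier_mat n n" "upper_triangular B"
  shows "upper_triangular (B ^\<^sub>m k) \<and> (\<forall>i<n. (B ^\<^sub>m k) $$ (i, i) = B $$ (i, i) ^ k)"
proof (induction k)
  case (Suc k)
  let ?C = "B ^\<^sub>m k"
  have C: "?C \<in> carrier_mat n n" using B by simp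
  have entry: "(?C * B) $$ (i, j) = (\<Sum>l<n. ?C $$ (i, l) * B $$ (l, j))" if "i < n" "j < n" for i j
    using B C that by (auto simp: scalar_prod_def atLeast0LessThan intro!: sum.cong)
  have zero: "?C $$ (i, l) = 0" if "l < i" "i < n" for i l
    using Suc C that by auto
  have zero': "B $$ (i, l) = 0" if "l < i" "i < n" for i l
    using B that by auto
  have "(?C * B) $$ (i, j) = 0" if "j < i" "i < n" for i j
    unfolding entry[OF that(2) less_trans[OF that]]
  proof (rule sum.neutral, rule ballI)
    fix l assume "l \<in> {..<n}"
    then show "?C $$ (i, l) * B $$ (l, j) = 0"
      using zero[of l i] zero'[of j l] that by (cases "l < i") auto
  qed
  moreover have "(?C * B) $$ (i, i) = B $$ (i, i) ^ Suc k" if i: "i < n" for i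
  proof -
    have "(\<Sum>l<n. ?C $$ (i, l) * B $$ (l, i)) = (\<Sum>l\<in>{i}. ?C $$ (i, l) * B $$ (l, i))"
    proof (rule sum.mono_neutral_right)
      show "\<forall>l\<in>{..<n} - {i}. ?C $$ (i, l) * B $$ (l, i) = 0"
        using zero zero' i by (metis DiffE insertI1 lessThan_iff linorder_neqE_nat mult_zero_left mult_zero_right)
    qed (use i in auto)
    then show ?thesis using Suc i entry[OF i i] by (simp add: power_commutes)
  qed
  ultimately show ?case using B by auto
qed (use B in auto)

text \<open>The matrix need not be diagonalisable, so it is brought to upper triangular form
  \<open>B\<close> by Schur decomposition; \<open>e\<close> lists the diagonal of \<open>B\<close>.
  Determinant and traces of powers are both read off this diagonal, and it is the common
  \<open>e\<close> that links the characteristic determinant with the counting of closed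
  walks.\<close>

lemma det_on_eigenvalues:
  fixes f :: "'a \<Rightarrow> 'a \<Rightarrow> complex"
  assumes fin: "finite S"
  obtains e :: "nat \<Rightarrow> complex" where
    "\<And>u. det_on S (\<lambda>x y. of_bool (x = y) - u * f x y) = (\<Prod>i<card S. 1 - u * e i)"
    "\<And>k. (\<Sum>x\<in>S. pow_on S f k x x) = (\<Sum>i<card S. e i ^ k)"
proof -
  define n where "n = card S"
  define M where "M = mat_on S S f"
  have M: "M \<in> carrier_mat n n" by (simp add: M_def n_def)
  from char_poly_factorized[OF M] obtain es where es: "char_poly M = (\<Prod>a\<leftarrow>es. [:- a, 1:])" by auto
  from schur_decomposition_exists[OF M es] obtain B where
    B: "B \<in> carrier_mat n n" "upper_triangular B" "similar_mat M B" by auto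
  then obtain P Q where wit: "similar_mat_wit M B P Q" by (auto simp: similar_mat_def)
  note w = similar_mat_witD2[OF M wit]
  note c = w(4-7)
  have "det_on S (\<lambda>x y. of_bool (x = y) - u * f x y) = (\<Prod>i<card S. 1 - u * B $$ (i, i))" for u
  proof -
    let ?D = "1\<^sub>m n - u \<cdot>\<^sub>m B"
    have D: "?D \<in> carrier_mat n n" using c by auto
    have ut: "upper_triangular ?D"
      using B(1,2) by (auto simp: upper_triangular_def)
    have "mat_on S S (\<lambda>x y. of_bool (x = y) - u * f x y) = 1\<^sub>m n - u \<cdot>\<^sub>m M"
      unfolding n_def M_def mat_on_one[OF fin, symmetric] by (rule eq_matI) (auto simp: mat_on_def)
    also have "\<dots> = P * ?D * Q"
    proof -
      have "P * ?D = P - u \<cdot>\<^sub>m (P * B)"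
        using c by (simp add: mult_minus_distrib_mat[OF c(3), of _ n] mult_smult_distrib[OF c(3) c(2)])
      then have "P * ?D * Q = P * Q - u \<cdot>\<^sub>m (P * B) * Q"
        using c by (simp add: minus_mult_distrib_mat[of _ n n _ _ n])
      also have "u \<cdot>\<^sub>m (P * B) * Q = u \<cdot>\<^sub>m (P * B * Q)"
        using c by (intro mult_smult_assoc_mat[of _ n n _ n]) auto
      finally show ?thesis using w(1,3) by simp
    qed
    finally have "det_on S (\<lambda>x y. of_bool (x = y) - u * f x y) =
        Determinant.det (P * ?D * Q)"
      unfolding det_on_def by simp
    also have "\<dots> = Determinant.det P * Determinant.det Q * Determinant.det ?D"
      using D by (simp add: det_mult[OF mult_carrier_mat[OF c(3) D] c(4)] det_mult[OF c(3) D])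
    also have "\<dots> = Determinant.det (P * Q) * Determinant.det ?D"
      by (simp add: det_mult[OF c(3,4)])
    also have "\<dots> = prod_list (diag_mat ?D)"
      using det_upper_triangular[OF ut D] by (simp add: w(1))
    also have "\<dots> = (\<Prod>i<n. 1 - u * B $$ (i, i))"
      using B(1) D by (simp add: prod_list_diag_prod atLeast0LessThan)
    finally show ?thesis by (simp add: n_def)
  qed
  moreover have "(\<Sum>x\<in>S. pow_on S f k x x) = (\<Sum>i<card S. (B $$ (i, i)) ^ k)" for k
  proof -
    have Bk: "B ^\<^sub>m k \<in> carrier_mat n n" using B by simp
    have "(\<Sum>x\<in>S. pow_on S f k x x) = (\<Sum>i<n. pow_on S f k (from_nat_into S i) (from_nat_into S i))"
      unfolding n_def by (rule sum_from_nat_into[OF fin, symmetric])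
    also have "\<dots> = (\<Sum>i<n. (M ^\<^sub>m k) $$ (i, i))"
      unfolding M_def mat_on_pow[OF fin] by (simp add: mat_on_def n_def)
    also have "M ^\<^sub>m k = P * (B ^\<^sub>m k * Q)"
      unfolding similar_mat_wit_pow_id[OF wit] by (rule assoc_mult_mat[OF c(3) Bk c(4)])
    also have "(\<Sum>i<n. (P * (B ^\<^sub>m k * Q)) $$ (i, i)) = (\<Sum>i<n. (B ^\<^sub>m k * Q * P) $$ (i, i))"
      by (rule trace_mult_commute[OF c(3) mult_carrier_mat[OF Bk c(4)]])
    also have "B ^\<^sub>m k * Q * P = B ^\<^sub>m k"
      unfolding assoc_mult_mat[OF Bk c(4) c(3)] w(2) by (rule right_mult_one_mat[OF Bk])
    also have "(\<Sum>i<n. (B ^\<^sub>m k) $$ (i, i)) = (\<Sum>i<n. (B $$ (i, i)) ^ k)"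
      using upper_triangular_pow[OF B(1,2)] by simp
    finally show ?thesis by (simp add: n_def)
  qed
  ultimately show thesis by (rule that)
qed

section \<open>Cyclic walks and their primitive roots\<close>

text \<open>This and the next two definitions copy the shape of \<open>closed_geodesic\<close>,
  \<open>prime_geodesic\<close> and the relation in \<open>prime_cycles\<close> for an arbitrary
  step relation, so that once geodesics are identified with walks the other two notions translate by
  unfolding.\<close>

definition cyclic_walk :: "('a \<times> 'a) set \<Rightarrow> 'a list \<Rightarrow> bool" where
  "cyclic_walk T c \<longleftrightarrow> c \<noteq> [] \<and> (\<forall>i<length c. (c ! i, c ! (Suc i mod length c)) \<in> T)"

definition primitive_walk :: "('a \<times> 'a) set \<Rightarrow> 'a list \<Rightarrow> bool" where
  "primitive_walk T c \<longleftrightarrow>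
     cyclic_walk T c \<and> \<not> (\<exists>b r. cyclic_walk T b \<and> r \<ge> 2 \<and> c = concat (replicate r b))"

definition rotation_rel :: "('a \<times> 'a) set \<Rightarrow> ('a list \<times> 'a list) set" where
  "rotation_rel T = {(b, c). primitive_walk T b \<and> primitive_walk T c \<and> (\<exists>k. c = rotate k b)}"

lemma length_concat_replicate: "length (concat (replicate r b)) = r * length b"
  by (induction r) auto

lemma nth_concat_replicate:
  "i < r * length b \<Longrightarrow> concat (replicate r b) ! i = b ! (i mod length b)"
proof (induction r arbitrary: i)
  case (Suc r)
  then show ?case
    by (cases "i < length b") (auto simp: nth_append le_mod_geq)
qed simp

lemma concat_replicate_mult:
  "concat (replicate r (concat (replicate s b))) = concat (replicate (r * s) b)"
  by (induction r) (auto simp: replicate_add)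

lemma rotate_concat_replicate:
  "rotate k (concat (replicate r b)) = concat (replicate r (rotate k b))"
proof (cases "b = [] \<or> r = 0")
  case False
  show ?thesis
  proof (rule nth_equalityI)
    fix i assume "i < length (rotate k (concat (replicate r b)))"
    then have i: "i < r * length b" by (simp add: length_concat_replicate)
    have pos: "0 < r * length b" using False by simp
    have "rotate k (concat (replicate r b)) ! i = b ! ((k + i) mod (r * length b) mod length b)"
      using i pos by (simp add: nth_rotate length_concat_replicate nth_concat_replicate)
    also have "(k + i) mod (r * length b) mod length b = (k + i mod length b) mod length b"
      by (simp add: mod_mult_left_eq mod_mod_cancel mod_add_right_eq)
    also have "b ! ((k + i mod length b) mod length b) = concat (replicate r (rotate k b)) ! i"
      using i False by (simp add: nth_rotate nth_concat_replicate)
    finally show "rotate k (concat (replicate r b)) ! i = concat (replicate r (rotate k b)) ! i" .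
  qed (simp add: length_concat_replicate)
qed auto

lemma rotate_inverse: "\<exists>j. rotate j (rotate k c) = c"
proof -
  have "rotate (length c - k mod length c) (rotate (k mod length c) c) = c"
  proof (cases "c = []")
    case False
    then have "k mod length c < length c" by simp
    then show ?thesis by (simp add: rotate_rotate)
  qed simp
  then show ?thesis by (metis rotate_conv_mod)
qed

lemma rotate_inj: "rotate k b = rotate k c \<Longrightarrow> b = c"
  unfolding rotate_def by (rule injD[OF inj_fn[OF inj_rotate1]])

lemma rotate_mult_fixed: "rotate k c = c \<Longrightarrow> rotate (k * x) c = c"
  by (induction x) (simp_all add: rotate_rotate[symmetric])

text \<open>Bezout without subtraction: rotating by \<open>l * y\<close> and then by the gcd is
  rotating by \<open>k * x\<close>, and the multiples of \<open>k\<close> and of \<open>l\<close>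
  already fix the list.\<close>

lemma rotate_gcd_fixed:
  assumes "rotate k c = c" "rotate l c = c"
  shows "rotate (gcd k l) c = c"
proof (cases "k = 0")
  case False
  then obtain x y where xy: "k * x = l * y + gcd k l" using bezout_nat by blast
  have "rotate (gcd k l) (rotate (l * y) c) = rotate (k * x) c"
    by (simp add: rotate_rotate xy add.commute)
  then show ?thesis using assms rotate_mult_fixed by metis
qed (use assms in simp)

lemma nth_rotate_fixed:
  assumes "rotate g c = c" "g dvd length c" "i < length c"
  shows "c ! i = c ! (i mod g)"
proof -
  have g: "g > 0" using assms by (cases "g = 0") auto
  have "i mod g < length c"
    by (rule le_less_trans[OF mod_less_eq_dividend assms(3)])
  then have "rotate (g * (i div g)) c ! (i mod g) = c ! ((g * (i div g) + i mod g) mod length c)"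
    by (simp add: nth_rotate)
  then show ?thesis using rotate_mult_fixed[OF assms(1)] assms(3) by simp
qed

lemma take_rotate_fixed:
  assumes "rotate g c = c" "g dvd length c" "g dvd k" "k \<le> length c"
  shows "take k c = concat (replicate (k div g) (take g c))"
proof (cases "k = 0")
  case False
  then have "g \<le> k" "g > 0" using assms by (auto simp: dvd_imp_le intro: Nat.gr0I)
  then show ?thesis
    using assms
    by (intro nth_equalityI)
      (auto simp: length_concat_replicate nth_concat_replicate nth_rotate_fixed[of g c] min_absorb2)
qed simp

lemma cyclic_walk_concat_replicate:
  assumes "r \<ge> 1"
  shows "cyclic_walk T (concat (replicate r b)) \<longleftrightarrow> cyclic_walk T b"
proof -
  let ?l = "length b"
  have len: "?l \<le> r * ?l" using assms by simp
  have step: "concat (replicate r b) ! i = b ! (i mod ?l)"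
    "concat (replicate r b) ! (Suc i mod (r * ?l)) = b ! (Suc i mod ?l)" if "i < r * ?l" for i
  proof -
    show "concat (replicate r b) ! i = b ! (i mod ?l)" using that by (rule nth_concat_replicate)
    have "0 < r * ?l" using that by linarith
    then show "concat (replicate r b) ! (Suc i mod (r * ?l)) = b ! (Suc i mod ?l)"
      by (subst nth_concat_replicate) (simp_all add: mod_mod_cancel)
  qed
  have "(\<forall>i<r * ?l. (b ! (i mod ?l), b ! (Suc i mod ?l)) \<in> T) \<longleftrightarrow>
      (\<forall>i<?l. (b ! i, b ! (Suc i mod ?l)) \<in> T)" (is "?P \<longleftrightarrow> ?Q")
  proof
    assume ?P
    then show ?Q using len by (metis mod_less order_less_le_trans)
  next
    assume Q: ?Q
    show ?P
    proof (intro allI impI)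
      fix i assume "i < r * ?l"
      then have "i mod ?l < ?l" by (cases "?l = 0") auto
      with Q have "(b ! (i mod ?l), b ! (Suc (i mod ?l) mod ?l)) \<in> T" by blast
      then show "(b ! (i mod ?l), b ! (Suc i mod ?l)) \<in> T" by (simp add: mod_Suc_eq)
    qed
  qed
  moreover have "concat (replicate r b) \<noteq> [] \<longleftrightarrow> b \<noteq> []" using assms by auto
  ultimately show ?thesis by (simp add: cyclic_walk_def length_concat_replicate step)
qed

lemma cyclic_walk_rotate:
  assumes "cyclic_walk T c"
  shows "cyclic_walk T (rotate k c)"
proof -
  let ?l = "length c"
  have "(rotate k c ! i, rotate k c ! (Suc i mod ?l)) \<in> T" if i: "i < ?l" for i
  proof -
    have "0 < ?l" using i by linarith
    then have "rotate k c ! i = c ! ((k + i) mod ?l)" "rotate k c ! (Suc i mod ?l) = c ! (Suc ((k + i) mod ?l) mod ?l)"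
      using i by (simp_all add: nth_rotate mod_add_right_eq mod_Suc_eq)
    then show ?thesis using assms \<open>0 < ?l\<close> by (simp add: cyclic_walk_def)
  qed
  then show ?thesis using assms by (simp add: cyclic_walk_def)
qed

lemma primitive_walk_rotate:
  assumes "primitive_walk T c"
  shows "primitive_walk T (rotate k c)"
  unfolding primitive_walk_def
proof (intro conjI notI)
  show "cyclic_walk T (rotate k c)"
    using assms cyclic_walk_rotate by (auto simp: primitive_walk_def)
  assume "\<exists>b r. cyclic_walk T b \<and> r \<ge> 2 \<and> rotate k c = concat (replicate r b)"
  then obtain b r where br: "cyclic_walk T b" "r \<ge> 2" "rotate k c = concat (replicate r b)" by blast
  obtain j where "rotate j (rotate k c) = c" using rotate_inverse by blast
  then have "c = concat (replicate r (rotate j b))" by (simp add: br rotate_concat_replicate)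
  moreover have "cyclic_walk T (rotate j b)" using br(1) by (rule cyclic_walk_rotate)
  ultimately show False using assms br(2) unfolding primitive_walk_def by blast
qed

text \<open>A smaller period \<open>g\<close> would exhibit \<open>b\<close> as the power of the
  closed walk \<open>take g b\<close> with exponent \<open>length b div g\<close>, which is at least
  2.\<close>

lemma primitive_walk_period:
  assumes "primitive_walk T b" "rotate g b = b" "g dvd length b"
  shows "g = length b"
proof (rule ccontr)
  assume ne: "g \<noteq> length b"
  have b: "b = concat (replicate (length b div g) (take g b))"
    using take_rotate_fixed[OF assms(2,3), of "length b"] assms(3) by simp
  have "b \<noteq> []" using assms by (auto simp: primitive_walk_def cyclic_walk_def)
  obtain s where s: "length b = g * s" using assms by (auto simp: dvd_def)
  then have "g > 0" "s \<noteq> 0" "s \<noteq> 1" using \<open>b \<noteq> []\<close> ne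
    by (auto intro: Nat.gr0I)
  then have "length b div g \<ge> 2" using s by simp
  moreover from this have "cyclic_walk T (take g b)"
    using assms(1) b cyclic_walk_concat_replicate[of "length b div g" T "take g b"]
    by (simp add: primitive_walk_def)
  ultimately show False using assms(1) b by (auto simp: primitive_walk_def)
qed

lemma rotate_length_concat_replicate:
  "rotate (length b) (concat (replicate r b)) = concat (replicate r b)"
  by (simp add: rotate_concat_replicate)

text \<open>Both root lengths are rotation periods of the common word \<open>c\<close>, hence so is
  their gcd \<open>g\<close>. Each root is a prefix of \<open>c\<close> whose length is a multiple
  of \<open>g\<close>, so it inherits the period, and primitivity forces its length to be
  \<open>g\<close>.\<close>

lemma primitive_root_unique:
  assumes "primitive_walk T b" "primitive_walk T b'" "r \<ge> 1" "s \<ge> 1"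
    and eq: "concat (replicate r b) = concat (replicate s b')"
  shows "b = b' \<and> r = s"
proof -
  define c where "c = concat (replicate r b)"
  define g where "g = gcd (length b) (length b')"
  have nonempty: "b \<noteq> []" "b' \<noteq> []"
    using assms by (auto simp: primitive_walk_def cyclic_walk_def)
  have c': "c = concat (replicate s b')" using eq by (simp add: c_def)
  have len: "length c = r * length b" "length c = s * length b'"
    by (simp add: c_def length_concat_replicate) (simp add: c' length_concat_replicate)
  have g: "rotate g c = c"
    unfolding g_def
    by (rule rotate_gcd_fixed)
      (simp add: c_def rotate_length_concat_replicate, simp add: c' rotate_length_concat_replicate)
  have period: "length d = g \<and> d = take g c"
    if d: "primitive_walk T d" "g dvd length d" "t \<ge> 1" "c = concat (replicate t d)" for d t
  proof -
    have "take (length d) c = d" using d by (cases t) auto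
    moreover have lenc: "length c = t * length d" using d by (simp add: length_concat_replicate)
    moreover have "g dvd length c" "length d \<le> length c" using d lenc by auto
    \<comment> \<open>The period passes from \<open>c\<close> to its prefix \<open>d\<close> because
      \<open>g\<close> divides \<open>length d\<close>: the prefix is a repetition of the block
      \<open>take g c\<close>.\<close>
    ultimately have d_eq: "d = concat (replicate (length d div g) (take g c))"
      using take_rotate_fixed[OF g, of "length d"] d(2) by simp
    have "g > 0" using nonempty by (simp add: g_def)
    have "g \<le> length c" using d lenc \<open>length d \<le> length c\<close> \<open>g > 0\<close>
      by (metis dvd_imp_le le_trans primitive_walk_def cyclic_walk_def length_greater_0_conv)
    then have "rotate g d = d"
      using rotate_length_concat_replicate[of "take g c" "length d div g"] d_eq by simp
    then have "g = length d" using primitive_walk_period d by blast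
    then show ?thesis using \<open>take (length d) c = d\<close> by simp
  qed
  have g_dvd: "g dvd length b" "g dvd length b'" by (simp_all add: g_def)
  have "b = take g c" using period[OF assms(1) _ assms(3) c_def] g_dvd(1) by blast
  moreover have "b' = take g c" using period[OF assms(2) _ assms(4) c'] g_dvd(2) by blast
  ultimately have "b = b'" by simp
  then show ?thesis using len nonempty by simp
qed

lemma primitive_root_exists:
  assumes "cyclic_walk T c"
  shows "\<exists>b r. primitive_walk T b \<and> r \<ge> 1 \<and> c = concat (replicate r b)"
  using assms
proof (induction "length c" arbitrary: c rule: less_induct)
  case less
  show ?case
  proof (cases "primitive_walk T c")
    case True
    then show ?thesis by (intro exI[of _ c] exI[of _ 1]) simp
  next
    case False
    then obtain b r where br: "cyclic_walk T b" "r \<ge> 2" "c = concat (replicate r b)"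
      using less.prems by (auto simp: primitive_walk_def)
    then have "length b < length c"
      by (auto simp: length_concat_replicate cyclic_walk_def)
    then obtain d s where "primitive_walk T d" "s \<ge> 1" "b = concat (replicate s d)"
      using less.hyps br by blast
    then show ?thesis
      using br by (intro exI[of _ d] exI[of _ "r * s"]) (simp add: concat_replicate_mult)
  qed
qed

text \<open>Allows a sum over closed walks to be taken as a double sum over primitive walks and
  exponents. The exponents start at 1, just as the logarithm series does.\<close>

lemma primitive_power_bij:
  "bij_betw (\<lambda>(b, r). concat (replicate r b)) ({b. primitive_walk T b} \<times> {1..}) {c. cyclic_walk T c}"
  unfolding bij_betw_def
proof
  show "inj_on (\<lambda>(b, r). concat (replicate r b)) ({b. primitive_walk T b} \<times> {1..})"
    using primitive_root_unique by (fastforce simp: inj_on_def)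
  show "(\<lambda>(b, r). concat (replicate r b)) ` ({b. primitive_walk T b} \<times> {1..}) = {c. cyclic_walk T c}"
    using primitive_root_exists
    by (fastforce simp: image_iff cyclic_walk_concat_replicate primitive_walk_def)
qed

lemma equiv_rotation_rel: "equiv {c. primitive_walk T c} (rotation_rel T)"
proof (rule equivI)
  show "refl_on {c. primitive_walk T c} (rotation_rel T)"
    by (auto simp: refl_on_def rotation_rel_def intro: exI[of _ 0])
  show "sym (rotation_rel T)"
    using rotate_inverse unfolding sym_def rotation_rel_def by (auto, metis)
  show "trans (rotation_rel T)"
    by (fastforce simp: trans_def rotation_rel_def rotate_rotate)
  show "rotation_rel T \<subseteq> {c. primitive_walk T c} \<times> {c. primitive_walk T c}"
    by (auto simp: rotation_rel_def)
qed

text \<open>If two of the first \<open>length b\<close> rotations agreed, a rotation by a smaller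
  positive amount would fix \<open>b\<close>, and the gcd of this amount with the length would be a
  proper period. The resulting cardinality cancels the weight 1 / length in the Euler
  product.\<close>

lemma rotation_class:
  assumes "p \<in> {c. primitive_walk T c} // rotation_rel T" "b \<in> p"
  shows "p = (\<lambda>k. rotate k b) ` {..<length b}" "card p = length b" "primitive_walk T b"
proof -
  have p: "p = rotation_rel T `` {b}"
    using assms equiv_rotation_rel by (metis Image_singleton_iff equiv_class_eq_iff quotientE)
  have "p \<subseteq> {c. primitive_walk T c}"
    using assms(1) equiv_rotation_rel in_quotient_imp_subset by blast
  then show b: "primitive_walk T b" using assms by auto
  then have "b \<noteq> []" by (auto simp: primitive_walk_def cyclic_walk_def)
  then show eq: "p = (\<lambda>k. rotate k b) ` {..<length b}"
    unfolding p using b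
    by (auto simp: rotation_rel_def primitive_walk_rotate image_iff)
      (metis length_greater_0_conv lessThan_iff mod_less_divisor rotate_conv_mod)
  have "inj_on (\<lambda>k. rotate k b) {..<length b}"
  proof (rule linorder_inj_onI')
    fix i j assume ij: "i \<in> {..<length b}" "j \<in> {..<length b}" "i < j"
    show "rotate i b \<noteq> rotate j b"
    proof
      assume "rotate i b = rotate j b"
      then have "rotate i (rotate (j - i) b) = rotate i b" using ij by (simp add: rotate_rotate)
      then have "rotate (j - i) b = b" by (rule rotate_inj)
      then have "rotate (gcd (j - i) (length b)) b = b" by (intro rotate_gcd_fixed) simp_all
      then have "gcd (j - i) (length b) = length b" by (rule primitive_walk_period[OF b]) simp
      then have "length b \<le> j - i" using ij by (metis dvd_imp_le gcd_dvd1 zero_less_diff)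
      then show False using ij by auto
    qed
  qed
  then show "card p = length b" unfolding eq by (simp add: card_image)
qed

section \<open>Counting closed walks by traces of powers\<close>

lemma card_walks_eq_pow_on:
  assumes fin: "finite E" and T: "T \<subseteq> E \<times> E" and xy: "x \<in> E" "y \<in> E"
  shows "of_nat (card {c. length c = Suc k \<and> c ! 0 = x \<and> c ! k = y \<and> (\<forall>i<k. (c ! i, c ! Suc i) \<in> T)}) =
    (pow_on E (\<lambda>x y. of_bool ((x, y) \<in> T)) k x y :: 'c::semiring_1)
    \<and> finite {c. length c = Suc k \<and> c ! 0 = x \<and> c ! k = y \<and> (\<forall>i<k. (c ! i, c ! Suc i) \<in> T)}"
  using xy(2)
proof (induction k arbitrary: y)
  case 0
  have "{c. length c = Suc 0 \<and> c ! 0 = x \<and> c ! 0 = y \<and> (\<forall>i<0. (c ! i, c ! Suc i) \<in> T)} =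
      (if x = y then {[x]} else {})"
    by (auto simp: length_Suc_conv)
  then show ?case by simp
next
  case (Suc k)
  let ?W = "\<lambda>k y. {c. length c = Suc k \<and> c ! 0 = x \<and> c ! k = y \<and> (\<forall>i<k. (c ! i, c ! Suc i) \<in> T)}"
  let ?E = "{y' \<in> E. (y', y) \<in> T}"
  \<comment> \<open>A walk is split at its last step. As \<open>T\<close> stays inside
    \<open>E\<close>, the penultimate vertex lies in the finite set over which the matrix product
    sums.\<close>
  have W: "?W (Suc k) y = (\<Union>y'\<in>?E. (\<lambda>c. c @ [y]) ` ?W k y')"
  proof (intro equalityI subsetI)
    fix c assume c: "c \<in> ?W (Suc k) y"
    then have ne: "c \<noteq> []" by auto
    then have "last c = y" using c by (simp add: last_conv_nth)
    then have "c = butlast c @ [y]" using ne by (metis append_butlast_last_id)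
    moreover have "butlast c \<in> ?W k (c ! k)"
      using c by (auto simp: nth_butlast)
    moreover have "c ! k \<in> ?E" using c T by auto
    ultimately show "c \<in> (\<Union>y'\<in>?E. (\<lambda>c. c @ [y]) ` ?W k y')" by blast
  next
    fix c assume "c \<in> (\<Union>y'\<in>?E. (\<lambda>c. c @ [y]) ` ?W k y')"
    then show "c \<in> ?W (Suc k) y" by (auto simp: nth_append less_Suc_eq)
  qed
  have fins: "finite (?W k y')" if "y' \<in> E" for y' using Suc.IH that by blast
  have "card (?W (Suc k) y) = (\<Sum>y'\<in>?E. card ((\<lambda>c. c @ [y]) ` ?W k y'))"
    unfolding W by (rule card_UN_disjoint) (use fin fins in auto)
  also have "\<dots> = (\<Sum>y'\<in>?E. card (?W k y'))"
    by (intro sum.cong refl card_image) (simp add: inj_on_def)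
  finally have "(of_nat (card (?W (Suc k) y)) :: 'c) = (\<Sum>y'\<in>?E. of_nat (card (?W k y')))"
    by (simp only: of_nat_sum)
  also have "\<dots> = (\<Sum>y'\<in>?E. pow_on E (\<lambda>x y. of_bool ((x, y) \<in> T)) k x y')"
    using Suc.IH by (intro sum.cong) auto
  also have "\<dots> = pow_on E (\<lambda>x y. of_bool ((x, y) \<in> T)) (Suc k) x y"
    using fin by (simp add: sum.inter_filter of_bool_def if_distrib cong: if_cong)
  finally show ?case unfolding W using fin fins by auto
qed

text \<open>A closed walk of length \<open>m\<close> is an open walk of \<open>m - 1\<close> steps
  together with the closing step from its last vertex to its first. The closing step supplies the
  last matrix factor, and summing over the starting vertex gives the trace.\<close>

lemma card_cyclic_walks:
  assumes fin: "finite E" and T: "T \<subseteq> E \<times> E" and m: "m \<ge> 1"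
  shows "of_nat (card {c. cyclic_walk T c \<and> length c = m}) =
    (\<Sum>x\<in>E. pow_on E (\<lambda>x y. of_bool ((x, y) \<in> T)) m x x :: 'c::semiring_1)"
    and "finite {c. cyclic_walk T c \<and> length c = m}"
proof -
  obtain k where k: "m = Suc k" using m by (cases m) auto
  let ?W = "\<lambda>x y. {c. length c = Suc k \<and> c ! 0 = x \<and> c ! k = y \<and> (\<forall>i<k. (c ! i, c ! Suc i) \<in> T)}"
  let ?I = "{(x, y) \<in> E \<times> E. (y, x) \<in> T}"
  let ?p = "pow_on E (\<lambda>x y. of_bool ((x, y) \<in> T) :: 'c)"
  have U: "{c. cyclic_walk T c \<and> length c = m} = (\<Union>(x, y)\<in>?I. ?W x y)"
  proof (intro equalityI subsetI)
    fix c assume c: "c \<in> {c. cyclic_walk T c \<and> length c = m}"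
    then have l: "length c = Suc k" and step: "\<And>i. i < Suc k \<Longrightarrow> (c ! i, c ! (Suc i mod Suc k)) \<in> T"
      by (auto simp: cyclic_walk_def k)
    have "(c ! i, c ! Suc i) \<in> T" if "i < k" for i using step[of i] that by simp
    moreover have "(c ! k, c ! 0) \<in> T" using step[of k] by simp
    ultimately show "c \<in> (\<Union>(x, y)\<in>?I. ?W x y)" using l T by auto
  next
    fix c assume "c \<in> (\<Union>(x, y)\<in>?I. ?W x y)"
    then have l: "length c = Suc k" and *: "\<And>i. i < k \<Longrightarrow> (c ! i, c ! Suc i) \<in> T" "(c ! k, c ! 0) \<in> T"
      by auto
    have "(c ! i, c ! (Suc i mod Suc k)) \<in> T" if "i < Suc k" for i
      using * that by (cases "i = k") auto
    then show "c \<in> {c. cyclic_walk T c \<and> length c = m}" using l by (auto simp: cyclic_walk_def k)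
  qed
  have finI: "finite ?I" using fin by (auto intro: finite_subset[of _ "E \<times> E"])
  have W: "of_nat (card (?W x y)) = ?p k x y" "finite (?W x y)" if "x \<in> E" "y \<in> E" for x y
    using card_walks_eq_pow_on[OF fin T that, where ?'c = 'c] by auto
  show "finite {c. cyclic_walk T c \<and> length c = m}" unfolding U using finI W(2) by auto
  have "card (\<Union>(x, y)\<in>?I. ?W x y) = (\<Sum>(x, y)\<in>?I. card (?W x y))"
    by (subst card_UN_disjoint) (use finI W(2) in \<open>auto simp: case_prod_unfold\<close>)
  then have "(of_nat (card {c. cyclic_walk T c \<and> length c = m}) :: 'c) = (\<Sum>(x, y)\<in>?I. of_nat (card (?W x y)))"
    unfolding U by (simp add: case_prod_unfold)
  also have "\<dots> = (\<Sum>(x, y)\<in>?I. ?p k x y)"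
    by (intro sum.cong) (auto simp: W)
  also have "\<dots> = (\<Sum>(x, y)\<in>E \<times> E. if (y, x) \<in> T then ?p k x y else 0)"
    using fin by (intro sum.mono_neutral_cong_left) (auto split: if_splits)
  also have "\<dots> = (\<Sum>x\<in>E. ?p m x x)"
    using fin by (simp add: k sum.cartesian_product[symmetric] of_bool_def if_distrib cong: if_cong)
  finally show "of_nat (card {c. cyclic_walk T c \<and> length c = m}) = (\<Sum>x\<in>E. ?p m x x)" .
qed

section \<open>The Euler product over primitive cyclic walks\<close>

lemma has_sum_sum_finite:
  fixes f :: "'i \<Rightarrow> 'a \<Rightarrow> 'c::topological_comm_monoid_add"
  assumes "finite I" "\<And>i. i \<in> I \<Longrightarrow> (f i has_sum s i) A"
  shows "((\<lambda>x. \<Sum>i\<in>I. f i x) has_sum (\<Sum>i\<in>I. s i)) A"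
  using assms by (induction I rule: finite_induct) (auto intro: has_sum_add)

lemma norm_power_divide_le:
  fixes z :: complex
  shows "norm (z ^ m / of_nat m) \<le> norm z ^ m"
proof (cases "m = 0")
  case False
  then have "norm z ^ m * 1 \<le> norm z ^ m * real m" by (intro mult_left_mono) auto
  then show ?thesis using False by (simp add: norm_divide norm_power divide_le_eq)
qed simp

lemma has_sum_Ln:
  fixes z :: complex
  assumes "norm z < 1"
  shows "((\<lambda>m. z ^ m / of_nat m) has_sum - Ln (1 - z)) {1..}"
proof -
  have "(\<lambda>m. - (z ^ m / of_nat m)) sums Ln (1 - z)"
    using Ln_series'[of "- z"] assms by simp
  then have sums: "(\<lambda>m. z ^ m / of_nat m) sums - Ln (1 - z)"
    using sums_minus by fastforce
  have "summable (\<lambda>m. norm (z ^ m / of_nat m))"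
  proof (rule summable_comparison_test)
    show "summable (\<lambda>m. norm z ^ m)" using assms by (simp add: summable_geometric)
    show "\<exists>N. \<forall>m\<ge>N. norm (norm (z ^ m / of_nat m)) \<le> norm z ^ m"
      using norm_power_divide_le by simp
  qed
  from norm_summable_imp_has_sum[OF this sums] have
    "((\<lambda>m. z ^ m / of_nat m) has_sum - Ln (1 - z)) UNIV" .
  \<comment> \<open>The term at \<open>m = 0\<close> is a division by zero and hence 0, so it may be
    dropped from the range.\<close>
  moreover have "((\<lambda>m. z ^ m / of_nat m) has_sum - Ln (1 - z)) UNIV \<longleftrightarrow>
      ((\<lambda>m. z ^ m / of_nat m) has_sum - Ln (1 - z)) {1..}"
    by (rule has_sum_cong_neutral) (auto simp: not_le)
  ultimately show ?thesis by simp
qed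

lemma walk_subset:
  assumes "T \<subseteq> E \<times> E" "cyclic_walk T c"
  shows "set c \<subseteq> E"
proof
  fix x assume "x \<in> set c"
  then obtain i where "i < length c" "x = c ! i" by (auto simp: in_set_conv_nth)
  then show "x \<in> E" using assms unfolding cyclic_walk_def by blast
qed

text \<open>Closed walks of length \<open>m\<close> are among the \<open>card E ^ m\<close> words
  over \<open>E\<close>, so every finite partial sum is bounded by a geometric series of ratio
  \<open>norm u * card E\<close>. Absolute summability is what permits the regroupings of the sum
  below.\<close>

lemma abs_summable_cyclic_walks:
  fixes u :: complex
  assumes fin: "finite E" and T: "T \<subseteq> E \<times> E" and u: "norm u * card E < 1"
  shows "(\<lambda>c. norm (u ^ length c / of_nat (length c))) summable_on {c. cyclic_walk T c}"
proof (rule nonneg_bdd_above_summable_on)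
  let ?x = "norm u * card E"
  show "bdd_above (sum (\<lambda>c. norm (u ^ length c / of_nat (length c))) ` {F. F \<subseteq> {c. cyclic_walk T c} \<and> finite F})"
  proof (rule bdd_aboveI2)
    fix F assume F: "F \<in> {F. F \<subseteq> {c. cyclic_walk T c} \<and> finite F}"
    define M where "M = Max (insert 0 (length ` F))"
    have M: "length c \<le> M" if "c \<in> F" for c using F that by (simp add: M_def)
    let ?L = "\<lambda>m. {c. set c \<subseteq> E \<and> length c = m}"
    have "F \<subseteq> (\<Union>m\<in>{..M}. ?L m)" using F M walk_subset[OF T] by blast
    then have "(\<Sum>c\<in>F. norm (u ^ length c / of_nat (length c))) \<le>
        (\<Sum>c\<in>(\<Union>m\<in>{..M}. ?L m). norm (u ^ length c / of_nat (length c)))"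
      using fin by (intro sum_mono2) (auto simp: finite_lists_length_eq)
    also have "\<dots> \<le> (\<Sum>c\<in>(\<Union>m\<in>{..M}. ?L m). norm u ^ length c)"
      by (intro sum_mono norm_power_divide_le)
    also have "\<dots> = (\<Sum>m\<le>M. \<Sum>c\<in>?L m. norm u ^ length c)"
      using fin by (intro sum.UNION_disjoint) (auto simp: finite_lists_length_eq)
    also have "\<dots> = (\<Sum>m\<le>M. ?x ^ m)"
      using fin by (intro sum.cong refl) (simp add: card_lists_length_eq power_mult_distrib)
    also have "\<dots> \<le> (\<Sum>m. ?x ^ m)"
      using u by (intro sum_le_suminf summable_geometric) auto
    finally show "(\<Sum>c\<in>F. norm (u ^ length c / of_nat (length c))) \<le> (\<Sum>m. ?x ^ m)" .
  qed
qed simp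

text \<open>
  Both sides of the Euler product are the exponential of the sum of \<open>u\<^bsup>m\<^esup> / m\<close> over all closed walks,
  \<open>m\<close> being the length: a class of primitive walks of length \<open>m\<close> has exactly \<open>m\<close> members,
  and the number of closed walks of length \<open>m\<close> is a power sum of eigenvalues.
\<close>

lemma euler_product_eigenvalues:
  fixes u :: complex and e :: "nat \<Rightarrow> complex"
  assumes fin: "finite E" and T: "T \<subseteq> E \<times> E" and u: "norm u * card E < 1"
    and u1: "norm u < 1"
    and trace: "\<And>k. (\<Sum>x\<in>E. pow_on E (\<lambda>x y. of_bool ((x, y) \<in> T)) k x x) = (\<Sum>i<N. e i ^ k)"
    and e: "\<And>i. i < N \<Longrightarrow> norm (u * e i) < 1"
  shows "((\<lambda>P. \<Prod>p\<in>P. inverse (1 - u ^ length (SOME c. c \<in> p))) \<longlongrightarrow> inverse (\<Prod>i<N. 1 - u * e i))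
    (finite_subsets_at_top ({c. primitive_walk T c} // rotation_rel T))"
proof -
  let ?W = "{c. cyclic_walk T c}" and ?P = "{c. primitive_walk T c}"
  let ?C = "?P // rotation_rel T"
  let ?g = "\<lambda>c :: 'a list. u ^ length c / of_nat (length c)"
  obtain S where S: "(?g has_sum S) ?W"
    using Infinite_Sum.abs_summable_summable[OF abs_summable_cyclic_walks[OF fin T u]] by (auto simp: summable_on_def)

  \<comment> \<open>First regrouping, by length: the inner sums are finite, and the traces turn them
    into power sums of the eigenvalues.\<close>
  have W_Sigma: "bij_betw snd (SIGMA m:{1..}. {c. cyclic_walk T c \<and> length c = m}) ?W"
    by (auto simp: bij_betw_def inj_on_def image_iff cyclic_walk_def Suc_le_eq)
  have "((\<lambda>m. \<Sum>c | cyclic_walk T c \<and> length c = m. ?g c) has_sum S) {1..}"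
  proof (rule has_sum_SigmaD)
    show "((\<lambda>x. ?g (snd x)) has_sum S) (SIGMA m:{1..}. {c. cyclic_walk T c \<and> length c = m})"
      by (subst has_sum_reindex_bij_betw[OF W_Sigma]) (rule S)
    show "((\<lambda>y. ?g (snd (m, y))) has_sum (\<Sum>c | cyclic_walk T c \<and> length c = m. ?g c))
        {c. cyclic_walk T c \<and> length c = m}" if "m \<in> {1..}" for m
      unfolding snd_conv using that by (intro has_sum_finite card_cyclic_walks(2)[OF fin T]) simp
  qed
  moreover have "(\<Sum>c | cyclic_walk T c \<and> length c = m. ?g c) = (\<Sum>i<N. (u * e i) ^ m / of_nat m)"
    if "m \<in> {1..}" for m
  proof -
    have "(\<Sum>c | cyclic_walk T c \<and> length c = m. ?g c) =
        of_nat (card {c. cyclic_walk T c \<and> length c = m}) * (u ^ m / of_nat m)"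
      by simp
    also have "of_nat (card {c. cyclic_walk T c \<and> length c = m}) = (\<Sum>i<N. e i ^ m)"
      using card_cyclic_walks(1)[OF fin T, where ?'c = complex] that trace by simp
    also have "(\<Sum>i<N. e i ^ m) * (u ^ m / of_nat m) = (\<Sum>i<N. (u * e i) ^ m / of_nat m)"
      unfolding sum_distrib_right by (intro sum.cong refl) (simp add: power_mult_distrib)
    finally show ?thesis .
  qed
  ultimately have "((\<lambda>m. \<Sum>i<N. (u * e i) ^ m / of_nat m) has_sum S) {1..}"
    using has_sum_cong by (metis (no_types, lifting))
  moreover have "((\<lambda>m. \<Sum>i<N. (u * e i) ^ m / of_nat m) has_sum (\<Sum>i<N. - Ln (1 - u * e i))) {1..}"
    by (rule has_sum_sum_finite) (use e has_sum_Ln in auto)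
  ultimately have S_eq: "S = (\<Sum>i<N. - Ln (1 - u * e i))" by (rule has_sum_unique)
  \<comment> \<open>Only exponentials are compared, so a sum of principal logarithms is good enough:
    no logarithm of a product is formed and no branch has to be chosen.\<close>
  have "exp S = (\<Prod>i<N. inverse (1 - u * e i))"
    unfolding S_eq exp_sum[OF finite_lessThan]
  proof (rule prod.cong[OF refl])
    fix i assume "i \<in> {..<N}"
    then have "1 - u * e i \<noteq> 0" using e[of i] by auto
    then show "exp (- Ln (1 - u * e i)) = inverse (1 - u * e i)" by (simp add: exp_minus)
  qed
  then have exp_S: "exp S = inverse (\<Prod>i<N. 1 - u * e i)" by (simp add: prod_inversef[symmetric] o_def)

  \<comment> \<open>Second regrouping of the same sum, by primitive root: for a fixed root
    \<open>b\<close> the sum over exponents is the logarithm series at \<open>u ^ length b\<close>,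
    divided by \<open>length b\<close>.\<close>
  have "((\<lambda>b. - Ln (1 - u ^ length b) / of_nat (length b)) has_sum S) ?P"
  proof (rule has_sum_SigmaD)
    show "((\<lambda>x. ?g (case x of (b, r) \<Rightarrow> concat (replicate r b))) has_sum S) (?P \<times> {1..})"
      by (subst has_sum_reindex_bij_betw[OF primitive_power_bij]) (rule S)
    fix b assume "b \<in> ?P"
    then have b: "length b > 0" by (auto simp: primitive_walk_def cyclic_walk_def)
    have "norm (u ^ length b) < 1" using u1 b by (simp add: norm_power power_less_one_iff)
    from has_sum_cmult_left[OF has_sum_Ln[OF this], of "1 / of_nat (length b)"]
    show "((\<lambda>r. ?g (case (b, r) of (b, r) \<Rightarrow> concat (replicate r b))) has_sum
        - Ln (1 - u ^ length b) / of_nat (length b)) {1..}"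
      by (simp add: length_concat_replicate power_mult[symmetric] mult.commute)
  qed
  moreover have C_Sigma: "bij_betw snd (SIGMA p:?C. p) ?P"
    unfolding bij_betw_def
  proof
    show "inj_on snd (SIGMA p:?C. p)"
    proof (rule inj_onI)
      fix x y assume "x \<in> (SIGMA p:?C. p)" "y \<in> (SIGMA p:?C. p)" "snd x = snd y"
      then show "x = y"
        using quotient_disj[OF equiv_rotation_rel, of "fst x" T "fst y"] by (auto simp: prod_eq_iff)
    qed
    show "snd ` (SIGMA p:?C. p) = ?P"
      using Union_quotient[OF equiv_rotation_rel, of T] by (simp add: snd_image_Sigma)
  qed
  ultimately have "((\<lambda>x. - Ln (1 - u ^ length (snd x)) / of_nat (length (snd x))) has_sum S) (SIGMA p:?C. p)"
    by (simp only: has_sum_reindex_bij_betw[OF C_Sigma, of "\<lambda>b. - Ln (1 - u ^ length b) / of_nat (length b)"])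
  \<comment> \<open>Third regrouping, by rotation class: the \<open>length b\<close> equal terms of
    a class cancel the divisor \<open>length b\<close>.\<close>
  then have "((\<lambda>p. - Ln (1 - u ^ length (SOME c. c \<in> p))) has_sum S) ?C"
  proof (rule has_sum_SigmaD)
    fix p assume p: "p \<in> ?C"
    then have "p \<noteq> {}" by (rule in_quotient_imp_non_empty[OF equiv_rotation_rel])
    define b where "b = (SOME c. c \<in> p)"
    have b: "b \<in> p" unfolding b_def using \<open>p \<noteq> {}\<close> by (simp add: some_in_eq)
    note cls = rotation_class[OF p b]
    have "length b > 0" using cls(3) by (auto simp: primitive_walk_def cyclic_walk_def)
    have "finite p" using cls(1) by (metis finite_imageI finite_lessThan)
    moreover have "length c = length b" if "c \<in> p" for c using that cls(1) by auto
    ultimately show "((\<lambda>c. - Ln (1 - u ^ length (snd (p, c))) / of_nat (length (snd (p, c)))) has_sum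
        - Ln (1 - u ^ length (SOME c. c \<in> p))) p"
      unfolding b_def[symmetric]
      using \<open>length b > 0\<close> cls(2) by (simp add: has_sum_finite_iff)
  qed
  \<comment> \<open>An unordered sum is a limit along finite subsets, the very filter of the
    unordered product, so continuity of the exponential carries one to the other.\<close>
  then have "((\<lambda>P. exp (\<Sum>p\<in>P. - Ln (1 - u ^ length (SOME c. c \<in> p)))) \<longlongrightarrow> exp S) (finite_subsets_at_top ?C)"
    unfolding has_sum_def by (intro tendsto_exp)
  moreover have "\<forall>\<^sub>F P in finite_subsets_at_top ?C.
      exp (\<Sum>p\<in>P. - Ln (1 - u ^ length (SOME c. c \<in> p))) =
      (\<Prod>p\<in>P. inverse (1 - u ^ length (SOME c. c \<in> p)))"
  proof (rule eventually_finite_subsets_at_top_weakI)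
    fix P assume P: "finite P" "P \<subseteq> ?C"
    show "exp (\<Sum>p\<in>P. - Ln (1 - u ^ length (SOME c. c \<in> p))) =
      (\<Prod>p\<in>P. inverse (1 - u ^ length (SOME c. c \<in> p)))"
      unfolding exp_sum[OF P(1)]
    proof (rule prod.cong[OF refl])
      fix p assume "p \<in> P"
      then have p: "p \<in> ?C" using P by blast
      then have "p \<noteq> {}" by (rule in_quotient_imp_non_empty[OF equiv_rotation_rel])
      then have "(SOME c. c \<in> p) \<in> p" by (simp add: some_in_eq)
      then have "primitive_walk T (SOME c. c \<in> p)" using rotation_class(3)[OF p] by blast
      then have "length (SOME c. c \<in> p) > 0" by (auto simp: primitive_walk_def cyclic_walk_def)
      then have "norm (u ^ length (SOME c. c \<in> p)) < 1"
        using u1 by (simp add: norm_power power_less_one_iff)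
      then have "1 - u ^ length (SOME c. c \<in> p) \<noteq> 0" by (metis norm_one less_irrefl right_minus_eq)
      then show "exp (- Ln (1 - u ^ length (SOME c. c \<in> p))) = inverse (1 - u ^ length (SOME c. c \<in> p))"
        by (simp add: exp_minus)
    qed
  qed
  ultimately show ?thesis unfolding exp_S by (rule Lim_transform_eventually)
qed

text \<open>Only finitely many eigenvalues occur, so all smallness conditions hold together near 0.
  That \<open>D u\<close> is nonzero is recorded because the convergence required of the zeta
  function includes a nonzero limit.\<close>

theorem euler_product:
  fixes T :: "('a \<times> 'a) set"
  assumes fin: "finite E" and T: "T \<subseteq> E \<times> E"
  defines "D \<equiv> \<lambda>u :: complex. det_on E (\<lambda>x y. of_bool (x = y) - u * of_bool ((x, y) \<in> T))"
  shows "\<forall>\<^sub>F u in nhds 0. D u \<noteq> 0 \<and>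
    ((\<lambda>P. \<Prod>p\<in>P. inverse (1 - u ^ length (SOME c. c \<in> p))) \<longlongrightarrow> inverse (D u))
      (finite_subsets_at_top ({c. primitive_walk T c} // rotation_rel T))"
proof -
  obtain e where D: "\<And>u. D u = (\<Prod>i<card E. 1 - u * e i)"
    and trace: "\<And>k. (\<Sum>x\<in>E. pow_on E (\<lambda>x y. of_bool ((x, y) \<in> T)) k x x) = (\<Sum>i<card E. e i ^ k)"
    unfolding D_def
    by (rule det_on_eigenvalues[OF fin, of "\<lambda>x y. of_bool ((x, y) \<in> T)"]) blast
  have "((\<lambda>u :: complex. norm u * card E) \<longlongrightarrow> norm (0 :: complex) * card E) (nhds 0)"
    by (intro tendsto_intros filterlim_ident)
  then have ev1: "\<forall>\<^sub>F u :: complex in nhds 0. norm u * card E < 1"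
    by (rule order_tendstoD) simp
  have "((\<lambda>u :: complex. norm u) \<longlongrightarrow> norm (0 :: complex)) (nhds 0)"
    by (intro tendsto_intros filterlim_ident)
  then have ev0: "\<forall>\<^sub>F u :: complex in nhds 0. norm u < 1"
    by (rule order_tendstoD) simp
  have "((\<lambda>u. norm (u * e i)) \<longlongrightarrow> norm (0 * e i)) (nhds 0)" for i
    by (intro tendsto_intros filterlim_ident)
  then have "\<forall>\<^sub>F u in nhds 0. norm (u * e i) < 1" for i
    by (rule order_tendstoD) simp
  then have ev2: "\<forall>\<^sub>F u in nhds 0. \<forall>i\<in>{..<card E}. norm (u * e i) < 1"
    by (intro eventually_ball_finite) auto
  show ?thesis
    using ev1 ev0 ev2
  proof eventually_elim
    case (elim u)
    have "u * e i \<noteq> 1" if "i < card E" for i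
      using elim(3) that by (metis lessThan_iff less_irrefl norm_one)
    then have "D u \<noteq> 0" unfolding D by auto
    then show ?case
      using euler_product_eigenvalues[OF fin T elim(1,2) trace] elim(3) by (simp add: D)
  qed
qed

section \<open>Geodesic steps on a biregular bipartite graph\<close>

lemma sum_of_bool_filter:
  "finite A \<Longrightarrow> (\<Sum>x\<in>A. of_bool (P x) * f x) = (\<Sum>x | x \<in> A \<and> P x. f x :: 'c::semiring_1)"
  by (simp add: sum.inter_filter of_bool_def if_distrib[of "\<lambda>c. c * _"] cong: if_cong)

lemma sum_flags_fst:
  fixes f :: "'a \<times> 'b \<Rightarrow> 'c::semiring_1"
  assumes "finite E" "finite S" "E \<subseteq> R \<times> S"
  shows "(\<Sum>z\<in>E. of_bool (fst z = t) * f z) = (\<Sum>s\<in>S. of_bool ((t, s) \<in> E) * f (t, s))"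
  unfolding sum_of_bool_filter[OF assms(1)] sum_of_bool_filter[OF assms(2)]
  by (rule sum.reindex_bij_witness[of _ "\<lambda>s. (t, s)" snd]) (use assms in auto)

lemma sum_flags_snd:
  fixes f :: "'a \<times> 'b \<Rightarrow> 'c::semiring_1"
  assumes "finite E" "finite R" "E \<subseteq> R \<times> S"
  shows "(\<Sum>z\<in>E. of_bool (snd z = s) * f z) = (\<Sum>t\<in>R. of_bool ((t, s) \<in> E) * f (t, s))"
  unfolding sum_of_bool_filter[OF assms(1)] sum_of_bool_filter[OF assms(2)]
  by (rule sum.reindex_bij_witness[of _ "\<lambda>t. (t, s)" fst]) (use assms in auto)

text \<open>Membership of \<open>(fst y, snd x)\<close> says that the next lower cell lies in the
  present upper cell; that it also lies in the next upper cell is membership of \<open>y\<close>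
  itself.\<close>

definition geodesic_step :: "('a \<times> 'b) set \<Rightarrow> (('a \<times> 'b) \<times> ('a \<times> 'b)) set" where
  "geodesic_step E = {(x, y). x \<in> E \<and> y \<in> E \<and> fst x \<noteq> fst y \<and> snd x \<noteq> snd y \<and> (fst y, snd x) \<in> E}"

text \<open>
  With \<open>P\<close> and \<open>Q\<close> the relations of sharing the second and the first component, the step matrix is
  \<open>(P - 1) * (Q - 1)\<close>. As \<open>P\<close> factors through \<open>S\<close> and \<open>Q\<close> through \<open>R\<close>, splitting off the factor
  \<open>1 - u + u * Q\<close> reduces the determinant over the flags to one over \<open>S\<close>.
\<close>

theorem det_geodesic_step:
  fixes u :: complex
  assumes fin: "finite R" "finite S" and E: "E \<subseteq> R \<times> S"
    and a: "\<And>s. s \<in> S \<Longrightarrow> card {t \<in> R. (t, s) \<in> E} = a"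
    and b: "\<And>t. t \<in> R \<Longrightarrow> card {s \<in> S. (t, s) \<in> E} = b"
    and u: "1 - u \<noteq> 0" and \<beta>: "1 + (of_nat b - 1) * u \<noteq> 0"
  shows "det_on E (\<lambda>x y. of_bool (x = y) - u * of_bool ((x, y) \<in> geodesic_step E)) =
    (1 - u) ^ card E * ((1 + (of_nat b - 1) * u) / (1 - u)) ^ card R *
    (1 / ((1 + (of_nat b - 1) * u) * (1 - u))) ^ card S *
    det_on S (\<lambda>s s'. of_bool (s = s') * ((1 + (of_nat a - 1) * u) * (1 + (of_nat b - 1) * u))
      - u * (\<Sum>t\<in>R. of_bool ((t, s) \<in> E) * of_bool ((t, s') \<in> E)))"
proof -
  define \<beta> where "\<beta> = 1 + (of_nat b - 1) * u"
  \<comment> \<open>With \<open>C = (1 - u) + u Q\<close> the matrix to be factored is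
    \<open>C + u P (1 - Q)\<close>. Since \<open>Q Q = b Q\<close>, the quotient of
    \<open>Q - 1\<close> by \<open>C\<close> lies in the span of 1 and \<open>Q\<close>;
    \<open>c0\<close> and \<open>c1\<close> are its coefficients. The number \<open>\<beta>\<close>
    is the eigenvalue of \<open>C\<close> on the image of \<open>Q\<close>.\<close>
  define c0 where "c0 = - 1 / (1 - u)"
  define c1 where "c1 = 1 / (\<beta> * (1 - u))"
  have \<beta>0: "\<beta> \<noteq> 0" using \<beta> by (simp add: \<beta>_def)
  have c0: "(1 - u) * c0 = - 1" using u by (simp add: c0_def)
  have c1: "(1 - u) * c1 + u * (c0 + c1 * of_nat b) = 1"
  proof -
    have "(1 - u) * c1 + u * (c0 + c1 * of_nat b) = c1 * \<beta> + u * c0"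
      by (simp add: \<beta>_def algebra_simps)
    also have "c1 * \<beta> = 1 / (1 - u)" using \<beta>0 by (simp add: c1_def)
    also have "1 / (1 - u) + u * c0 = 1" using u by (simp add: c0_def field_simps)
    finally show ?thesis .
  qed
  have finE: "finite E" using E fin finite_subset by blast
  let ?m = "\<lambda>x y. of_bool ((fst y, snd x) \<in> E) :: complex"
  define g :: "'b \<Rightarrow> 'a \<times> 'b \<Rightarrow> complex" where
    "g = (\<lambda>s z. c0 * of_bool (snd z = s) + c1 * of_bool ((fst z, s) \<in> E))"
  \<comment> \<open>\<open>A\<close> is \<open>1 - u P (c0 + c1 Q)\<close>, written as one minus a
    product through \<open>S\<close>; \<open>C\<close> is \<open>1 - u\<close> times one minus a
    product through \<open>R\<close>. In this form both determinants can be moved off the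
    flags.\<close>
  define A :: "'a \<times> 'b \<Rightarrow> 'a \<times> 'b \<Rightarrow> complex" where "A = (\<lambda>x z. of_bool (x = z) - (\<Sum>s\<in>S. of_bool (snd x = s) * (u * g s z)))"
  define C :: "'a \<times> 'b \<Rightarrow> 'a \<times> 'b \<Rightarrow> complex" where "C = (\<lambda>z y. (1 - u) * (of_bool (z = y) - (\<Sum>t\<in>R. of_bool (fst z = t) *
    (- (u / (1 - u)) * of_bool (fst y = t)))))"

  have A: "A x z = of_bool (x = z) - u * (c0 * of_bool (snd z = snd x) + c1 * ?m x z)" if "x \<in> E" for x z
    using that E fin by (auto simp: A_def g_def)
  have C: "C z y = (1 - u) * of_bool (z = y) + u * of_bool (fst z = fst y)" if "z \<in> E" for z y
  proof -
    have "(\<Sum>t\<in>R. of_bool (fst z = t) * (- (u / (1 - u)) * of_bool (fst y = t))) =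
        - (u / (1 - u)) * of_bool (fst y = fst z)"
      using that E fin by (intro sum_of_bool_delta) auto
    then show ?thesis using u by (simp add: C_def eq_commute[of "fst y"] field_simps)
  qed
  have step: "(of_bool ((x, y) \<in> geodesic_step E) :: complex) =
      ?m x y - of_bool (snd x = snd y) - of_bool (fst x = fst y) + of_bool (x = y)"
    if "x \<in> E" "y \<in> E" for x y
    using that by (cases x; cases y) (auto simp: geodesic_step_def)

  have "det_on E (\<lambda>x y. of_bool (x = y) - u * of_bool ((x, y) \<in> geodesic_step E)) =
      det_on E (\<lambda>x y. \<Sum>z\<in>E. A x z * C z y)"
  proof (rule det_on_cong[OF finE])
    fix x y assume xy: "x \<in> E" "y \<in> E"
    have collect: "(1 - u) * (d - u * (c0 * p + c1 * m)) + u * (f - u * (c0 + c1 * of_nat b) * m) =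
        (1 - u) * d - u * ((1 - u) * c0) * p - u * ((1 - u) * c1 + u * (c0 + c1 * of_nat b)) * m + u * f"
      for d p m f :: complex
      by (simp add: algebra_simps)
    \<comment> \<open>An entry of the product of \<open>A\<close> with \<open>Q\<close>. The degree
      \<open>b\<close> enters here: \<open>P Q Q\<close> is \<open>b\<close> times
      \<open>P Q\<close>, because every lower cell lies in \<open>b\<close> upper cells.\<close>
    have sy: "(\<Sum>z\<in>E. of_bool (fst z = fst y) * A x z) =
        of_bool (fst x = fst y) - u * (c0 + c1 * of_nat b) * ?m x y"
    proof -
      have "fst y \<in> R" "snd x \<in> S" using xy E by auto
      have "(\<Sum>z\<in>E. of_bool (fst z = fst y) * A x z) =
          (\<Sum>z\<in>E. of_bool (fst z = fst y) * of_bool (x = z)) -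
          u * (c0 * (\<Sum>z\<in>E. of_bool (fst z = fst y) * of_bool (snd z = snd x)) +
               c1 * (\<Sum>z\<in>E. of_bool (fst z = fst y) * ?m x z))"
        using xy by (simp add: A sum_subtractf sum_distrib_left sum.distrib algebra_simps)
      also have "(\<Sum>z\<in>E. of_bool (fst z = fst y) * of_bool (x = z)) = (of_bool (fst x = fst y) :: complex)"
        using xy finE by simp
      also have "(\<Sum>z\<in>E. of_bool (fst z = fst y) * of_bool (snd z = snd x)) = ?m x y"
        using fin \<open>snd x \<in> S\<close> by (subst sum_flags_fst[OF finE fin(2) E]) simp
      also have "(\<Sum>z\<in>E. of_bool (fst z = fst y) * ?m x z) = of_nat b * ?m x y"
        using b[OF \<open>fst y \<in> R\<close>] fin
        by (subst sum_flags_fst[OF finE fin(2) E])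
          (simp add: sum_distrib_right[symmetric] Int_def)
      finally show ?thesis by (simp add: algebra_simps)
    qed
    have "(\<Sum>z\<in>E. A x z * C z y) =
        (1 - u) * (\<Sum>z\<in>E. of_bool (z = y) * A x z) + u * (\<Sum>z\<in>E. of_bool (fst z = fst y) * A x z)"
      unfolding sum_distrib_left sum.distrib[symmetric]
      by (intro sum.cong refl) (simp add: C algebra_simps)
    also have "(\<Sum>z\<in>E. of_bool (z = y) * A x z) = A x y" using xy finE by simp
    finally have "(\<Sum>z\<in>E. A x z * C z y) = (1 - u) * A x y +
        u * (of_bool (fst x = fst y) - u * (c0 + c1 * of_nat b) * of_bool ((fst y, snd x) \<in> E))"
      unfolding sy .
    then have "(\<Sum>z\<in>E. A x z * C z y) = (1 - u) * of_bool (x = y)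
        - u * ((1 - u) * c0) * of_bool (snd y = snd x)
        - u * ((1 - u) * c1 + u * (c0 + c1 * of_nat b)) * ?m x y + u * of_bool (fst x = fst y)"
      by (simp only: A[OF xy(1)] collect)
    then show "of_bool (x = y) - u * of_bool ((x, y) \<in> geodesic_step E) = (\<Sum>z\<in>E. A x z * C z y)"
      unfolding c0 c1 step[OF xy] by (simp add: algebra_simps eq_commute[of "snd y"])
  qed
  also have "\<dots> = det_on E A * det_on E C" by (rule det_on_mult[OF finE])
  \<comment> \<open>Moved to \<open>R\<close>, the matrix becomes diagonal: a flag has a single
    lower cell, and each lower cell occurs in \<open>b\<close> flags.\<close>
  also have "det_on E C = (1 - u) ^ card E * (\<beta> / (1 - u)) ^ card R"
  proof -
    have "det_on E (\<lambda>z y. of_bool (z = y) - (\<Sum>t\<in>R. of_bool (fst z = t) * (- (u / (1 - u)) * of_bool (fst y = t)))) =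
        det_on R (\<lambda>t s. of_bool (t = s) - (\<Sum>x\<in>E. - (u / (1 - u)) * of_bool (fst x = t) * of_bool (fst x = s)))"
      by (rule det_on_one_minus_commute[OF finE fin(1)])
    also have "\<dots> = det_on R (\<lambda>t s. of_bool (t = s) * (\<beta> / (1 - u)))"
    proof (rule det_on_cong[OF fin(1)])
      fix t s assume ts: "t \<in> R" "s \<in> R"
      have "(\<Sum>x\<in>E. - (u / (1 - u)) * of_bool (fst x = t) * of_bool (fst x = s)) =
          - (u / (1 - u)) * (\<Sum>x\<in>E. of_bool (fst x = t) * of_bool (fst x = s))"
        by (simp add: sum_distrib_left mult.assoc)
      also have "(\<Sum>x\<in>E. of_bool (fst x = t) * of_bool (fst x = s)) = (of_nat b * of_bool (t = s) :: complex)"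
        using b[OF ts(1)] fin
        by (subst sum_flags_fst[OF finE fin(2) E])
          (simp add: sum_distrib_right[symmetric] Int_def)
      finally show "of_bool (t = s) - (\<Sum>x\<in>E. - (u / (1 - u)) * of_bool (fst x = t) * of_bool (fst x = s)) =
          of_bool (t = s) * (\<beta> / (1 - u))"
        using u by (auto simp: \<beta>_def field_simps)
    qed
    also have "\<dots> = (\<beta> / (1 - u)) ^ card R" unfolding det_on_diag[OF fin(1)] by simp
    finally show ?thesis unfolding C_def det_on_scale by simp
  qed
  also have "det_on E A = (1 / (\<beta> * (1 - u))) ^ card S *
      det_on S (\<lambda>s s'. of_bool (s = s') * ((1 + (of_nat a - 1) * u) * \<beta>)
        - u * (\<Sum>t\<in>R. of_bool ((t, s) \<in> E) * of_bool ((t, s') \<in> E)))"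
  proof -
    have "det_on E A = det_on S (\<lambda>s s'. of_bool (s = s') - (\<Sum>x\<in>E. u * g s x * of_bool (snd x = s')))"
      unfolding A_def by (rule det_on_one_minus_commute[OF finE fin(2)])
    also have "\<dots> = det_on S (\<lambda>s s'. 1 / (\<beta> * (1 - u)) *
        (of_bool (s = s') * ((1 + (of_nat a - 1) * u) * \<beta>)
        - u * (\<Sum>t\<in>R. of_bool ((t, s) \<in> E) * of_bool ((t, s') \<in> E))))"
    proof (rule det_on_cong[OF fin(2)])
      fix s s' assume s: "s \<in> S" "s' \<in> S"
      define K :: complex where "K = (\<Sum>t\<in>R. of_bool ((t, s) \<in> E) * of_bool ((t, s') \<in> E))"
      have "(\<Sum>x\<in>E. u * g s x * of_bool (snd x = s')) = u * (\<Sum>x\<in>E. of_bool (snd x = s') * g s x)"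
        by (simp add: sum_distrib_left mult_ac)
      also have "(\<Sum>x\<in>E. of_bool (snd x = s') * g s x) =
          (\<Sum>t\<in>R. of_bool ((t, s') \<in> E) * (c0 * of_bool (s' = s) + c1 * of_bool ((t, s) \<in> E)))"
        by (subst sum_flags_snd[OF finE fin(1) E]) (simp add: g_def)
      also have "\<dots> = c0 * of_bool (s' = s) * (\<Sum>t\<in>R. of_bool ((t, s') \<in> E)) + c1 * K"
        by (simp add: K_def sum_distrib_left sum.distrib algebra_simps)
      also have "(\<Sum>t\<in>R. of_bool ((t, s') \<in> E)) = (of_nat a :: complex)"
        using a[OF s(2)] fin by (simp add: Int_def)
      finally have *: "(\<Sum>x\<in>E. u * g s x * of_bool (snd x = s')) =
          u * (c0 * of_bool (s' = s) * of_nat a + c1 * K)" .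
      \<comment> \<open>The left side is \<open>(1 + (a - 1) * u) / (1 - u)\<close>, and
        \<open>c1 * \<beta>\<close> is \<open>1 / (1 - u)\<close>. So \<open>c1\<close> comes out of
        the diagonal as well as of the Gram term.\<close>
      have e1: "1 - u * (c0 * of_nat a) = c1 * ((1 + (of_nat a - 1) * u) * \<beta>)"
        using u \<beta>0 by (simp add: c0_def c1_def field_simps)
      show "of_bool (s = s') - (\<Sum>x\<in>E. u * g s x * of_bool (snd x = s')) =
          1 / (\<beta> * (1 - u)) * (of_bool (s = s') * ((1 + (of_nat a - 1) * u) * \<beta>) -
            u * (\<Sum>t\<in>R. of_bool ((t, s) \<in> E) * of_bool ((t, s') \<in> E)))"
        unfolding * K_def[symmetric] c1_def[symmetric]
        by (cases "s = s'") (simp_all add: right_diff_distrib e1[symmetric], simp_all add: algebra_simps)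
    qed
    also note det_on_scale
    finally show ?thesis .
  qed
  finally show ?thesis by (simp add: \<beta>_def mult_ac)
qed

section \<open>Cubes of the periodic lattice\<close>

text \<open>Merges unit and degenerate intervals into one family, \<open>a\<close> being the left
  end and \<open>b\<close> telling whether the interval is nondegenerate, so that containment needs
  a single criterion.\<close>

definition circle_cell :: "nat \<Rightarrow> bool \<Rightarrow> nat \<Rightarrow> real set set" where
  "circle_cell m b a = circle_point m ` {real a..real a + of_bool b}"

lemma circle_point_eq_iff:
  "circle_point m x = circle_point m y \<longleftrightarrow> (\<exists>k::int. x = y + of_int k * real m)"
proof
  assume eq: "circle_point m x = circle_point m y"
  have "x \<in> circle_point m x" by (auto simp: circle_point_def intro: exI[of _ 0])
  then show "\<exists>k::int. x = y + of_int k * real m" unfolding eq by (simp add: circle_point_def)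
next
  assume "\<exists>k::int. x = y + of_int k * real m"
  then obtain k :: int where k: "x = y + of_int k * real m" by blast
  have "\<exists>l::int. z = y + of_int l * real m" if "z = x + of_int j * real m" for z j
    using that k by (intro exI[of _ "k + j"]) (simp add: algebra_simps)
  moreover have "\<exists>l::int. z = x + of_int l * real m" if "z = y + of_int j * real m" for z j
    using that k by (intro exI[of _ "j - k"]) (simp add: algebra_simps)
  ultimately show "circle_point m x = circle_point m y" by (auto simp: circle_point_def)
qed

lemma circle_point_in_cell_iff:
  "circle_point m x \<in> circle_cell m b a \<longleftrightarrow>
    (\<exists>k::int. real a \<le> x + of_int k * real m \<and> x + of_int k * real m \<le> real a + of_bool b)"
proof
  assume "circle_point m x \<in> circle_cell m b a"
  then obtain y where y: "circle_point m y = circle_point m x" "real a \<le> y" "y \<le> real a + of_bool b"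
    by (auto simp: circle_cell_def)
  then show "\<exists>k::int. real a \<le> x + of_int k * real m \<and> x + of_int k * real m \<le> real a + of_bool b"
    by (auto simp: circle_point_eq_iff)
next
  assume "\<exists>k::int. real a \<le> x + of_int k * real m \<and> x + of_int k * real m \<le> real a + of_bool b"
  then obtain k :: int where k: "x + of_int k * real m \<in> {real a..real a + of_bool b}" by auto
  moreover have "circle_point m (x + of_int k * real m) = circle_point m x"
    by (auto simp: circle_point_eq_iff)
  ultimately show "circle_point m x \<in> circle_cell m b a" unfolding circle_cell_def by (metis image_eqI)
qed

lemma residue_eq_iff:
  assumes "a < m" "a' < m"
  shows "(\<exists>k::int. int a' = int a + k * int m) \<longleftrightarrow> a = a'"
proof
  assume "\<exists>k::int. int a' = int a + k * int m"
  then obtain k where "int a' = int a + k * int m" by blast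
  then have "int a' mod int m = int a mod int m" by simp
  then show "a = a'" using assms by simp
next
  assume "a = a'"
  then show "\<exists>k::int. int a' = int a + k * int m" by (intro exI[of _ 0]) simp
qed

text \<open>For integer translates the real bounds become integer bounds, and the only integers
  between the ends of a cell are the ends themselves.\<close>

lemma int_point_in_cell_iff:
  assumes "2 \<le> m" "a < m" "a' < m"
  shows "circle_point m (real a) \<in> circle_cell m b a' \<longleftrightarrow> a = a' \<or> b \<and> a = Suc a' mod m"
proof -
  have real: "real a + of_int k * real m = real_of_int (int a + k * int m)" for k by simp
  have le1: "real a' \<le> real_of_int x \<longleftrightarrow> int a' \<le> x" for x
    by (simp flip: of_int_le_iff[where 'a = real])
  have le2: "real_of_int x \<le> real a' + of_bool b \<longleftrightarrow> x \<le> int a' + of_bool b" for x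
    by (simp flip: of_int_le_iff[where 'a = real])
  have ends: "int a' \<le> x \<and> x \<le> int a' + of_bool b \<longleftrightarrow> int a' = x \<or> b \<and> int a' + 1 = x" for x
    by (cases b) auto
  have "circle_point m (real a) \<in> circle_cell m b a' \<longleftrightarrow>
      (\<exists>k::int. int a' \<le> int a + k * int m \<and> int a + k * int m \<le> int a' + of_bool b)"
    unfolding circle_point_in_cell_iff real le1 le2 ..
  also have "\<dots> \<longleftrightarrow> (\<exists>k::int. int a' = int a + k * int m) \<or> b \<and> (\<exists>k::int. int a' + 1 = int a + k * int m)"
    unfolding ends by blast
  also have "(\<exists>k::int. int a' + 1 = int a + k * int m) \<longleftrightarrow> a = Suc a' mod m"
  proof
    assume "\<exists>k::int. int a' + 1 = int a + k * int m"
    then obtain k where "int a' + 1 = int a + k * int m" by blast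
    then have "int (Suc a') = int a + k * int m" by simp
    then have "int (Suc a') mod int m = int a mod int m" by (metis mod_mult_self1)
    then have "int (Suc a' mod m) = int (a mod m)" by (simp only: of_nat_mod)
    then have "Suc a' mod m = a mod m" by (simp only: of_nat_eq_iff)
    then show "a = Suc a' mod m" using assms by simp
  next
    assume "a = Suc a' mod m"
    then have "Suc a' = a + Suc a' div m * m" by simp
    then have "int (Suc a') = int (a + Suc a' div m * m)" by (rule arg_cong)
    then show "\<exists>k::int. int a' + 1 = int a + k * int m"
      by (intro exI[of _ "int (Suc a' div m)"]) simp
  qed
  finally show ?thesis unfolding residue_eq_iff[OF assms(2,3)] .
qed

text \<open>A unit interval is recognised by its midpoint. Its end points would not do: for
  \<open>m = 2\<close> both unit intervals contain both vertices.\<close>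

lemma circle_cell_subset_iff:
  assumes m: "2 \<le> m" "a < m" "a' < m"
  shows "circle_cell m b a \<subseteq> circle_cell m b' a' \<longleftrightarrow>
    (if b then b' \<and> a = a' else a = a' \<or> b' \<and> a = Suc a' mod m)"
proof (cases b)
  case False
  then have "circle_cell m b a = {circle_point m (real a)}" by (simp add: circle_cell_def)
  then show ?thesis using False int_point_in_cell_iff[OF m] by simp
next
  case True
  have "b' \<and> a = a'" if sub: "circle_cell m b a \<subseteq> circle_cell m b' a'"
  proof -
    have "circle_point m (real a + 1 / 2) \<in> circle_cell m b a"
      using True by (auto simp: circle_cell_def)
    with sub have "circle_point m (real a + 1 / 2) \<in> circle_cell m b' a'" by blast
    then obtain k :: int where
      k: "real a' \<le> real a + 1 / 2 + of_int k * real m"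
        "real a + 1 / 2 + of_int k * real m \<le> real a' + of_bool b'"
      unfolding circle_point_in_cell_iff by blast
    define j where "j = int a + k * int m"
    \<comment> \<open>Doubling makes the bounds integral. The odd number \<open>2 * j + 1\<close>
      fits between them only if the target is nondegenerate and starts at \<open>j\<close>.\<close>
    have "real_of_int (2 * int a') \<le> real_of_int (2 * j + 1)"
      "real_of_int (2 * j + 1) \<le> real_of_int (2 * int a' + 2 * of_bool b')"
      using k by (simp_all add: j_def)
    then have "2 * int a' \<le> 2 * j + 1" "2 * j + 1 \<le> 2 * int a' + 2 * of_bool b'"
      by (simp_all only: of_int_le_iff)
    then have "b' \<and> int a' = j" by (cases b') (auto, presburger)
    then show ?thesis using residue_eq_iff[OF m(2,3)] by (auto simp: j_def)
  qed
  then show ?thesis using True by auto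
qed

lemma Suc_mod_eq_iff:
  assumes "a < m" "b < (m :: nat)"
  shows "b = Suc a mod m \<longleftrightarrow> a = (b + m - 1) mod m"
proof -
  have "(b + m - 1) mod m = (if b = 0 then m - 1 else b - 1)"
    using assms by (cases b) simp_all
  moreover have "Suc a mod m = (if Suc a = m then 0 else Suc a)"
    using assms by (simp add: mod_Suc)
  ultimately show ?thesis using assms by auto
qed

lemma Suc_mod_neq: "a < m \<Longrightarrow> 2 \<le> m \<Longrightarrow> Suc a mod m \<noteq> a"
  by (simp add: mod_Suc)

lemma unit_intervals_eq: "unit_intervals m = circle_cell m True ` {..<m}"
  by (auto simp: unit_intervals_def circle_cell_def)

lemma point_intervals_eq: "point_intervals m = circle_cell m False ` {..<m}"
  by (auto simp: point_intervals_def circle_cell_def)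

definition directions :: "nat \<Rightarrow> nat \<Rightarrow> nat set set" where
  "directions q k = {s. s \<subseteq> {1..q} \<and> card s = k}"

lemma finite_directions [simp]: "finite (directions q k)"
  by (rule finite_subset[of _ "Pow {1..q}"]) (auto simp: directions_def)

lemma card_directions: "card (directions q k) = q choose k"
  unfolding directions_def using n_subsets[of "{1..q}" k] by simp

section \<open>Cubes coded by a set of directions and a corner; faces and cofaces\<close>

locale cubical_lattice =
  fixes q :: nat and n :: "nat \<Rightarrow> nat"
  assumes side: "i \<in> {1..q} \<Longrightarrow> 2 \<le> n i"
begin

definition positions :: "(nat \<Rightarrow> nat) set" where
  "positions = PiE {1..q} (\<lambda>i. {..<n i})"

definition cube_at :: "nat set \<times> (nat \<Rightarrow> nat) \<Rightarrow> cube" where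
  "cube_at x = PiE {1..q} (\<lambda>i. circle_cell (n i) (i \<in> fst x) (snd x i))"

lemma finite_positions [simp]: "finite positions"
  by (simp add: positions_def finite_PiE)

lemma card_positions: "card positions = (\<Prod>i=1..q. n i)"
  by (simp add: positions_def card_PiE)

lemma positions_less: "a \<in> positions \<Longrightarrow> i \<in> {1..q} \<Longrightarrow> a i < n i"
  by (auto simp: positions_def)

lemma positions_eqI:
  "a \<in> positions \<Longrightarrow> a' \<in> positions \<Longrightarrow> (\<And>i. i \<in> {1..q} \<Longrightarrow> a i = a' i) \<Longrightarrow> a = a'"
  unfolding positions_def by (rule PiE_ext)

text \<open>Containment of products is coordinatewise because no factor of the smaller one is empty;
  each coordinate is then a question about one circle.\<close>

lemma cube_at_subset_iff:
  assumes "a \<in> positions" "a' \<in> positions"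
  shows "cube_at (t, a) \<subseteq> cube_at (s, a') \<longleftrightarrow>
    (\<forall>i\<in>{1..q}. if i \<in> t then i \<in> s \<and> a i = a' i else a i = a' i \<or> i \<in> s \<and> a i = Suc (a' i) mod n i)"
proof -
  have "cube_at (t, a) \<noteq> {}" by (auto simp: cube_at_def PiE_eq_empty_iff circle_cell_def)
  then have "cube_at (t, a) \<subseteq> cube_at (s, a') \<longleftrightarrow>
      (\<forall>i\<in>{1..q}. circle_cell (n i) (i \<in> t) (a i) \<subseteq> circle_cell (n i) (i \<in> s) (a' i))"
    unfolding cube_at_def fst_conv snd_conv by (subst subset_PiE) auto
  also have "\<dots> \<longleftrightarrow> (\<forall>i\<in>{1..q}. if i \<in> t then i \<in> s \<and> a i = a' i else a i = a' i \<or> i \<in> s \<and> a i = Suc (a' i) mod n i)"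
    by (intro ball_cong refl circle_cell_subset_iff side positions_less assms)
  finally show ?thesis .
qed

lemma cubes_of_type_eq: "cubes_of_type q n s = (\<lambda>a. cube_at (s, a)) ` positions"
proof (intro equalityI subsetI)
  fix c assume "c \<in> cubes_of_type q n s"
  then obtain I where c: "c = PiE {1..q} I"
    and I: "\<forall>i\<in>{1..q}. I i \<in> (if i \<in> s then unit_intervals (n i) else point_intervals (n i))"
    by (auto simp: cubes_of_type_def)
  have "\<exists>a. a < n i \<and> I i = circle_cell (n i) (i \<in> s) a" if "i \<in> {1..q}" for i
    using I[rule_format, OF that] by (cases "i \<in> s") (auto simp: unit_intervals_eq point_intervals_eq)
  then obtain a where a: "\<And>i. i \<in> {1..q} \<Longrightarrow> a i < n i \<and> I i = circle_cell (n i) (i \<in> s) (a i)"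
    by (metis (no_types, lifting))
  have "c = cube_at (s, restrict a {1..q})"
    unfolding c cube_at_def by (rule PiE_cong) (simp add: a)
  moreover have "restrict a {1..q} \<in> positions" using a by (auto simp: positions_def)
  ultimately show "c \<in> (\<lambda>a. cube_at (s, a)) ` positions" by blast
next
  fix c assume "c \<in> (\<lambda>a. cube_at (s, a)) ` positions"
  then obtain a where a: "a \<in> positions" "c = cube_at (s, a)" by blast
  then show "c \<in> cubes_of_type q n s"
    unfolding cubes_of_type_def cube_at_def
    by (auto simp: unit_intervals_eq point_intervals_eq positions_less
        intro!: exI[of _ "\<lambda>i. circle_cell (n i) (i \<in> s) (a i)"])
qed

text \<open>For injectivity, equality is read as containment both ways. This makes the direction
  sets agree, which excludes the shifted alternative in the containment criterion and leaves equal
  corners.\<close>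

lemma cube_at_bij: "bij_betw cube_at (directions q k \<times> positions) (cubes q n k)"
  unfolding bij_betw_def
proof
  show "cube_at ` (directions q k \<times> positions) = cubes q n k"
    by (auto simp: cubes_def cubes_of_type_eq directions_def)
  show "inj_on cube_at (directions q k \<times> positions)"
  proof (rule inj_onI)
    fix x y assume x: "x \<in> directions q k \<times> positions" and y: "y \<in> directions q k \<times> positions"
      and eq: "cube_at x = cube_at y"
    obtain s a t b where xy: "x = (s, a)" "y = (t, b)" by (cases x, cases y)
    have *: "s \<subseteq> {1..q}" "t \<subseteq> {1..q}" "a \<in> positions" "b \<in> positions"
      using x y by (auto simp: xy directions_def)
    have st: "\<forall>i\<in>{1..q}. if i \<in> s then i \<in> t \<and> a i = b i else a i = b i \<or> i \<in> t \<and> a i = Suc (b i) mod n i"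
      and ts: "\<forall>i\<in>{1..q}. if i \<in> t then i \<in> s \<and> b i = a i else b i = a i \<or> i \<in> s \<and> b i = Suc (a i) mod n i"
      using eq cube_at_subset_iff[OF *(3,4), of s t] cube_at_subset_iff[OF *(4,3), of t s]
      by (simp_all only: xy order_refl)
    have "s = t" using st ts *(1,2) by (metis (no_types, lifting) equalityI subset_iff)
    moreover have "a = b"
      by (rule positions_eqI[OF *(3,4)]) (use st \<open>s = t\<close> in metis)
    ultimately show "x = y" by (simp add: xy)
  qed
qed

lemma cubesE:
  assumes "c \<in> cubes q n k"
  obtains s a where "s \<in> directions q k" "a \<in> positions" "c = cube_at (s, a)"
  using assms unfolding bij_betw_imp_surj_on[OF cube_at_bij, symmetric] by blast

lemma finite_cubes [simp]: "finite (cubes q n k)"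
  using bij_betw_finite[OF cube_at_bij] by simp

lemma card_cubes: "card (cubes q n k) = (q choose k) * (\<Prod>i=1..q. n i)"
  using bij_betw_same_card[OF cube_at_bij, of k] by (simp add: card_cartesian_product card_directions card_positions)

definition succ :: "nat \<Rightarrow> (nat \<Rightarrow> nat) \<Rightarrow> nat \<Rightarrow> nat" where
  "succ i a = a(i := Suc (a i) mod n i)"

text \<open>The side length is added before 1 is subtracted because subtraction of naturals stops at
  0.\<close>

definition pred :: "nat \<Rightarrow> (nat \<Rightarrow> nat) \<Rightarrow> nat \<Rightarrow> nat" where
  "pred i a = a(i := (a i + n i - 1) mod n i)"

lemma succ_positions: "i \<in> {1..q} \<Longrightarrow> a \<in> positions \<Longrightarrow> succ i a \<in> positions"
  using side[of i] by (auto simp: succ_def positions_def PiE_iff extensional_def)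

lemma pred_positions: "i \<in> {1..q} \<Longrightarrow> a \<in> positions \<Longrightarrow> pred i a \<in> positions"
  using side[of i] by (auto simp: pred_def positions_def PiE_iff extensional_def)

text \<open>The lower bound 2 on the sides enters here: opposite faces of a cube are different
  cubes, so that faces come in pairs without coincidences.\<close>

lemma succ_neq: "i \<in> {1..q} \<Longrightarrow> a \<in> positions \<Longrightarrow> succ i a \<noteq> a"
  using Suc_mod_neq[of "a i" "n i"] side[of i] positions_less[of a i] by (auto simp: succ_def fun_eq_iff)

lemma pred_neq:
  assumes "i \<in> {1..q}" "a \<in> positions"
  shows "pred i a \<noteq> a"
proof
  assume "pred i a = a"
  then have "a i = (a i + n i - 1) mod n i" by (metis fun_upd_same pred_def)
  then have "a i = Suc (a i) mod n i" using Suc_mod_eq_iff positions_less assms by metis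
  then show False using Suc_mod_neq side positions_less assms by metis
qed

text \<open>In the parametrisation, \<open>i\<close> is the direction that is collapsed and
  \<open>e\<close> tells whether it is collapsed to its far end.\<close>

lemma faces_eq:
  assumes d: "1 \<le> d" and s: "s \<in> directions q d" and a: "a \<in> positions"
  shows "{x \<in> directions q (d - 1) \<times> positions. cube_at x \<subseteq> cube_at (s, a)} =
    (\<lambda>(i, e). (s - {i}, if e then succ i a else a)) ` (s \<times> UNIV)"
proof (intro equalityI subsetI)
  have fin: "finite s" and sq: "s \<subseteq> {1..q}" and cs: "card s = d"
    using s finite_subset by (auto simp: directions_def)
  fix x assume x: "x \<in> {x \<in> directions q (d - 1) \<times> positions. cube_at x \<subseteq> cube_at (s, a)}"
  then obtain t b where tb: "x = (t, b)" "t \<subseteq> {1..q}" "card t = d - 1" "b \<in> positions"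
    by (auto simp: directions_def)
  have sub: "\<forall>i\<in>{1..q}. if i \<in> t then i \<in> s \<and> b i = a i else b i = a i \<or> i \<in> s \<and> b i = Suc (a i) mod n i"
    using x cube_at_subset_iff[OF tb(4) a] by (simp add: tb(1))
  have "t \<subseteq> s" using sub tb(2) by auto
  then have "card (s - t) = 1" using fin cs tb(3) d by (simp add: card_Diff_subset finite_subset)
  then obtain i where i: "s - t = {i}" by (auto simp: card_1_singleton_iff)
  then have t: "t = s - {i}" and i_s: "i \<in> s" using \<open>t \<subseteq> s\<close> by auto
  have eq: "b j = a j" if "j \<in> {1..q}" "j \<noteq> i" for j
    using sub that by (cases "j \<in> s") (auto simp: t split: if_splits)
  have iq: "i \<in> {1..q}" using i_s sq by auto
  have "b i = a i \<or> b i = Suc (a i) mod n i" using bspec[OF sub iq] by (auto simp: t)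
  then have "b = a \<or> b = succ i a"
  proof
    assume "b i = a i"
    then have "b = a" using eq by (intro positions_eqI[OF tb(4) a]) metis
    then show ?thesis ..
  next
    assume "b i = Suc (a i) mod n i"
    then have "b = succ i a"
      using eq by (intro positions_eqI[OF tb(4) succ_positions[OF iq a]]) (auto simp: succ_def)
    then show ?thesis ..
  qed
  then show "x \<in> (\<lambda>(i, e). (s - {i}, if e then succ i a else a)) ` (s \<times> UNIV)"
  proof
    assume "b = a"
    then show ?thesis using i_s by (intro image_eqI[of _ _ "(i, False)"]) (auto simp: tb t)
  next
    assume "b = succ i a"
    then show ?thesis using i_s by (intro image_eqI[of _ _ "(i, True)"]) (auto simp: tb t)
  qed
next
  fix x assume "x \<in> (\<lambda>(i, e). (s - {i}, if e then succ i a else a)) ` (s \<times> UNIV)"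
  then obtain i e where x: "x = (s - {i}, if e then succ i a else a)" "i \<in> s" by auto
  have fin: "finite s" and sq: "s \<subseteq> {1..q}" and cs: "card s = d"
    using s finite_subset by (auto simp: directions_def)
  have iq: "i \<in> {1..q}" using x(2) sq by auto
  define b where "b = (if e then succ i a else a)"
  have b: "b \<in> positions" using a succ_positions[OF iq a] by (simp add: b_def)
  have "cube_at (s - {i}, b) \<subseteq> cube_at (s, a)"
    unfolding cube_at_subset_iff[OF b a] using x(2) by (auto simp: b_def succ_def)
  moreover have "s - {i} \<in> directions q (d - 1)"
    using fin sq cs x(2) by (auto simp: directions_def)
  ultimately show "x \<in> {x \<in> directions q (d - 1) \<times> positions. cube_at x \<subseteq> cube_at (s, a)}"
    using b by (simp add: x(1) b_def)
qed

text \<open>Dual to the faces: direction \<open>i\<close> is opened, and the given cube becomes the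
  near or the far end of the new one. In the latter case the corner moves back one step.\<close>

lemma cofaces_eq:
  assumes d: "1 \<le> d" and t: "t \<in> directions q (d - 1)" and b: "b \<in> positions"
  shows "{x \<in> directions q d \<times> positions. cube_at (t, b) \<subseteq> cube_at x} =
    (\<lambda>(i, e). (insert i t, if e then pred i b else b)) ` (({1..q} - t) \<times> UNIV)"
proof (intro equalityI subsetI)
  have fin: "finite t" and tq: "t \<subseteq> {1..q}" and ct: "card t = d - 1"
    using t finite_subset by (auto simp: directions_def)
  fix x assume x: "x \<in> {x \<in> directions q d \<times> positions. cube_at (t, b) \<subseteq> cube_at x}"
  then obtain s a where sa: "x = (s, a)" "s \<subseteq> {1..q}" "card s = d" "a \<in> positions"
    by (auto simp: directions_def)
  have sub: "\<forall>i\<in>{1..q}. if i \<in> t then i \<in> s \<and> b i = a i else b i = a i \<or> i \<in> s \<and> b i = Suc (a i) mod n i"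
    using x cube_at_subset_iff[OF b sa(4)] by (simp add: sa(1))
  have "t \<subseteq> s" using sub tq by auto
  then have "card (s - t) = 1" using fin ct sa(3) d by (simp add: card_Diff_subset)
  then obtain i where i: "s - t = {i}" by (auto simp: card_1_singleton_iff)
  then have s: "s = insert i t" and it: "i \<notin> t" using \<open>t \<subseteq> s\<close> by auto
  have eq: "a j = b j" if "j \<in> {1..q}" "j \<noteq> i" for j
    using sub that by (cases "j \<in> t") (auto simp: s split: if_splits)
  have iq: "i \<in> {1..q}" using sa(2) s by auto
  have "b i = a i \<or> b i = Suc (a i) mod n i" using bspec[OF sub iq] it by auto
  then have "a = b \<or> a = pred i b"
  proof
    assume "b i = a i"
    then have "a = b" using eq by (intro positions_eqI[OF sa(4) b]) metis
    then show ?thesis ..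
  next
    assume "b i = Suc (a i) mod n i"
    then have "a i = (b i + n i - 1) mod n i"
      using Suc_mod_eq_iff[of "a i" "n i" "b i"] positions_less[OF _ iq] sa(4) b by simp
    then have "a = pred i b"
      using eq by (intro positions_eqI[OF sa(4) pred_positions[OF iq b]]) (auto simp: pred_def)
    then show ?thesis ..
  qed
  then show "x \<in> (\<lambda>(i, e). (insert i t, if e then pred i b else b)) ` (({1..q} - t) \<times> UNIV)"
  proof
    assume "a = b"
    then show ?thesis using it iq by (intro image_eqI[of _ _ "(i, False)"]) (auto simp: sa s)
  next
    assume "a = pred i b"
    then show ?thesis using it iq by (intro image_eqI[of _ _ "(i, True)"]) (auto simp: sa s)
  qed
next
  fix x assume "x \<in> (\<lambda>(i, e). (insert i t, if e then pred i b else b)) ` (({1..q} - t) \<times> UNIV)"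
  then obtain i e where x: "x = (insert i t, if e then pred i b else b)" "i \<in> {1..q}" "i \<notin> t" by auto
  have fin: "finite t" and tq: "t \<subseteq> {1..q}" and ct: "card t = d - 1"
    using t finite_subset by (auto simp: directions_def)
  define a where "a = (if e then pred i b else b)"
  have a: "a \<in> positions" using b pred_positions[OF x(2) b] by (simp add: a_def)
  have "pred i b i < n i" using positions_less[OF pred_positions[OF x(2) b] x(2)] .
  then have "b i = Suc (pred i b i) mod n i"
    using Suc_mod_eq_iff[of "pred i b i" "n i" "b i"] positions_less[OF b x(2)] by (simp add: pred_def)
  then have "cube_at (t, b) \<subseteq> cube_at (insert i t, a)"
    unfolding cube_at_subset_iff[OF b a] using x(2,3) by (auto simp: a_def pred_def)
  moreover have "insert i t \<in> directions q d"
    using fin tq ct x(2,3) d by (auto simp: directions_def)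
  ultimately show "x \<in> {x \<in> directions q d \<times> positions. cube_at (t, b) \<subseteq> cube_at x}"
    using a by (simp add: x(1) a_def)
qed

text \<open>Used twice: for \<open>f\<close> constant it counts faces, and for \<open>f\<close>
  built from a character it computes the action of the incidence matrix.\<close>

lemma sum_faces:
  fixes f :: "nat set \<times> (nat \<Rightarrow> nat) \<Rightarrow> 'c::semiring_1"
  assumes d: "1 \<le> d" and s: "s \<in> directions q d" and a: "a \<in> positions"
  shows "(\<Sum>x\<in>directions q (d - 1) \<times> positions. of_bool (cube_at x \<subseteq> cube_at (s, a)) * f x) =
    (\<Sum>i\<in>s. f (s - {i}, a) + f (s - {i}, succ i a))"
proof -
  have sq: "s \<subseteq> {1..q}" using s by (simp add: directions_def)
  have "inj_on (\<lambda>(i, e). (s - {i}, if e then succ i a else a)) (s \<times> (UNIV :: bool set))"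
  proof (rule inj_onI, clarify)
    fix i j and e e' :: bool
    assume ij: "i \<in> s" "j \<in> s" and eq: "s - {i} = s - {j}"
      "(if e then succ i a else a) = (if e' then succ j a else a)"
    then have "i = j" by blast
    then show "i = j \<and> e = e'"
      using eq(2) succ_neq[OF _ a, of i] sq ij by (cases e; cases e') auto
  qed
  then have "(\<Sum>x | x \<in> directions q (d - 1) \<times> positions \<and> cube_at x \<subseteq> cube_at (s, a). f x) =
      (\<Sum>(i, e)\<in>s \<times> UNIV. f (s - {i}, if e then succ i a else a))"
    unfolding faces_eq[OF assms] by (subst sum.reindex) (auto simp: case_prod_unfold o_def)
  also have "\<dots> = (\<Sum>i\<in>s. f (s - {i}, a) + f (s - {i}, succ i a))"
    by (simp add: sum.cartesian_product[symmetric] UNIV_bool add.commute)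
  finally show ?thesis by (subst sum_of_bool_filter) simp_all
qed

lemma sum_cofaces:
  fixes f :: "nat set \<times> (nat \<Rightarrow> nat) \<Rightarrow> 'c::semiring_1"
  assumes d: "1 \<le> d" and t: "t \<in> directions q (d - 1)" and b: "b \<in> positions"
  shows "(\<Sum>x\<in>directions q d \<times> positions. of_bool (cube_at (t, b) \<subseteq> cube_at x) * f x) =
    (\<Sum>i\<in>{1..q} - t. f (insert i t, b) + f (insert i t, pred i b))"
proof -
  have "inj_on (\<lambda>(i, e). (insert i t, if e then pred i b else b)) (({1..q} - t) \<times> (UNIV :: bool set))"
  proof (rule inj_onI, clarify)
    fix i j and e e' :: bool
    assume ij: "i \<in> {1..q}" "i \<notin> t" "j \<in> {1..q}" "j \<notin> t" and eq: "insert i t = insert j t"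
      "(if e then pred i b else b) = (if e' then pred j b else b)"
    then have "i = j" by blast
    then show "i = j \<and> e = e'"
      using eq(2) pred_neq[OF ij(1) b] by (cases e; cases e') auto
  qed
  then have "(\<Sum>x | x \<in> directions q d \<times> positions \<and> cube_at (t, b) \<subseteq> cube_at x. f x) =
      (\<Sum>(i, e)\<in>({1..q} - t) \<times> UNIV. f (insert i t, if e then pred i b else b))"
    unfolding cofaces_eq[OF assms] by (subst sum.reindex) (auto simp: case_prod_unfold o_def)
  also have "\<dots> = (\<Sum>i\<in>{1..q} - t. f (insert i t, b) + f (insert i t, pred i b))"
    by (simp add: sum.cartesian_product[symmetric] UNIV_bool add.commute)
  finally show ?thesis by (subst sum_of_bool_filter) simp_all
qed

lemma card_faces:
  assumes d: "1 \<le> d" and c: "c \<in> cubes q n d"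
  shows "card {c' \<in> cubes q n (d - 1). c' \<subseteq> c} = 2 * d"
proof -
  obtain s a where sa: "c = cube_at (s, a)" "s \<in> directions q d" "a \<in> positions"
    using c by (elim cubesE)
  have "card {c' \<in> cubes q n (d - 1). c' \<subseteq> c} = (\<Sum>c'\<in>cubes q n (d - 1). of_bool (c' \<subseteq> c))"
    by (simp add: Int_def)
  also have "\<dots> = (\<Sum>x\<in>directions q (d - 1) \<times> positions. of_bool (cube_at x \<subseteq> c) * 1)"
    by (simp only: sum.reindex_bij_betw[OF cube_at_bij, symmetric] mult_1_right)
  also have "\<dots> = 2 * d"
    unfolding sa(1) sum_faces[OF d sa(2,3)] using sa(2) by (simp add: directions_def)
  finally show ?thesis .
qed

lemma card_cofaces:
  assumes d: "1 \<le> d" and c: "c \<in> cubes q n (d - 1)"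
  shows "card {c' \<in> cubes q n d. c \<subseteq> c'} = 2 * (q - (d - 1))"
proof -
  obtain t b where tb: "c = cube_at (t, b)" "t \<in> directions q (d - 1)" "b \<in> positions"
    using c by (elim cubesE)
  have "card {c' \<in> cubes q n d. c \<subseteq> c'} = (\<Sum>c'\<in>cubes q n d. of_bool (c \<subseteq> c'))"
    by (simp add: Int_def)
  also have "\<dots> = (\<Sum>x\<in>directions q d \<times> positions. of_bool (c \<subseteq> cube_at x) * 1)"
    by (simp only: sum.reindex_bij_betw[OF cube_at_bij, symmetric] mult_1_right)
  also have "\<dots> = 2 * (q - (d - 1))"
    unfolding tb(1) sum_cofaces[OF d tb(2,3)] using tb(2)
    by (auto simp: directions_def card_Diff_subset finite_subset)
  finally show ?thesis .
qed

end

section \<open>Characters of the lattice\<close>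

definition unity_root :: "nat \<Rightarrow> complex" where
  "unity_root m = cis (2 * pi / real m)"

lemma unity_root_power: "unity_root m ^ j = cis (2 * pi * real j / real m)"
  unfolding unity_root_def Complex.DeMoivre by (rule arg_cong[of _ _ cis]) simp

lemma norm_unity_root_power [simp]: "norm (unity_root m ^ j) = 1"
  by (simp add: unity_root_power)

lemma unity_root_power_self: "0 < m \<Longrightarrow> unity_root m ^ m = 1"
  by (simp add: unity_root_power)

lemma unity_root_power_eq_iff:
  assumes "0 < m"
  shows "unity_root m ^ i = unity_root m ^ j \<longleftrightarrow> i mod m = j mod m"
proof -
  have "unity_root m ^ l = exp (2 * of_real pi * \<i> * of_nat l / of_nat m)" for l
    unfolding unity_root_power cis_conv_exp by (simp add: mult_ac)
  then show ?thesis using complex_root_unity_eq[of m i j] assms by simp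
qed

lemma cnj_mult_unit: "norm z = 1 \<Longrightarrow> z * cnj z = 1"
  by (simp add: complex_norm_square[symmetric])

text \<open>A geometric series whose ratio is an \<open>m\<close>-th root of unity. The second
  hypothesis allows any system of residues, so that positions, counted from 0, and frequencies,
  counted from 1, are both covered.\<close>

lemma unity_root_orthogonal:
  assumes m: "0 < m" and xy: "x mod m = y mod m \<longleftrightarrow> x = y"
  shows "(\<Sum>j<m. unity_root m ^ (x * j) * cnj (unity_root m ^ (y * j))) = of_nat m * of_bool (x = y)"
proof -
  define \<eta> where "\<eta> = unity_root m ^ x * cnj (unity_root m ^ y)"
  have "(\<Sum>j<m. unity_root m ^ (x * j) * cnj (unity_root m ^ (y * j))) = (\<Sum>j<m. \<eta> ^ j)"
    by (simp add: \<eta>_def power_mult power_mult_distrib)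
  also have "\<dots> = of_nat m * of_bool (x = y)"
  proof (cases "x = y")
    case True
    then have "\<eta> = 1" by (simp add: \<eta>_def cnj_mult_unit del: complex_cnj_power)
    then show ?thesis using True by simp
  next
    case False
    have "\<eta> \<noteq> 1"
    proof
      assume "\<eta> = 1"
      then have "unity_root m ^ x * (unity_root m ^ y * cnj (unity_root m ^ y)) = unity_root m ^ y"
        by (simp add: \<eta>_def mult_ac)
      then have "unity_root m ^ x = unity_root m ^ y"
        by (simp add: cnj_mult_unit del: complex_cnj_power)
      then show False using False xy unity_root_power_eq_iff[OF m] by blast
    qed
    moreover have "\<eta> ^ m = (unity_root m ^ m) ^ x * cnj ((unity_root m ^ m) ^ y)"
      by (simp add: \<eta>_def power_mult_distrib mult.commute flip: power_mult)
    then have "\<eta> ^ m = 1" by (simp add: unity_root_power_self[OF m] del: complex_cnj_power)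
    ultimately show ?thesis using False by (simp add: geometric_sum)
  qed
  finally show ?thesis .
qed

context cubical_lattice
begin

definition frequencies :: "(nat \<Rightarrow> nat) set" where
  "frequencies = PiE {1..q} (\<lambda>i. {1..n i})"

lemma finite_frequencies [simp]: "finite frequencies"
  by (simp add: frequencies_def finite_PiE)

lemma card_frequencies: "card frequencies = (\<Prod>i=1..q. n i)"
  by (simp add: frequencies_def card_PiE)

definition character :: "(nat \<Rightarrow> nat) \<Rightarrow> (nat \<Rightarrow> nat) \<Rightarrow> complex" where
  "character k a = (\<Prod>i=1..q. unity_root (n i) ^ (k i * a i))"

definition root_at :: "(nat \<Rightarrow> nat) \<Rightarrow> nat \<Rightarrow> complex" where
  "root_at k i = unity_root (n i) ^ k i"

lemma norm_root_at [simp]: "norm (root_at k i) = 1"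
  by (simp add: root_at_def del: norm_power)

lemma character_update:
  assumes i: "i \<in> {1..q}" and eq: "root_at k i ^ m = w * root_at k i ^ a i"
  shows "character k (a(i := m)) = w * character k a"
proof -
  have split: "character k b = root_at k i ^ b i * (\<Prod>j\<in>{1..q} - {i}. root_at k j ^ b j)" for b
    unfolding character_def using i by (subst prod.remove[of _ i]) (simp_all add: root_at_def power_mult)
  show ?thesis unfolding split eq[symmetric] by (simp add: eq)
qed

lemma root_at_power_mod:
  assumes "i \<in> {1..q}"
  shows "root_at k i ^ (m mod n i) = root_at k i ^ m"
proof -
  have "0 < n i" using side[OF assms] by simp
  then have "root_at k i ^ n i = 1"
    by (simp add: root_at_def unity_root_power_self mult.commute[of _ "n i"] power_mult flip: power_mult[of _ _ "n i"])
  then have "root_at k i ^ (n i * (m div n i) + m mod n i) = root_at k i ^ (m mod n i)"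
    by (simp only: power_add power_mult power_one mult_1_left)
  then show ?thesis by (metis mult_div_mod_eq)
qed

lemma character_succ:
  assumes "i \<in> {1..q}"
  shows "character k (succ i a) = root_at k i * character k a"
  unfolding succ_def by (rule character_update[OF assms]) (simp add: root_at_power_mod[OF assms])

lemma character_pred:
  assumes "i \<in> {1..q}"
  shows "character k (pred i a) = cnj (root_at k i) * character k a"
  unfolding pred_def
proof (rule character_update[OF assms])
  have n: "2 \<le> n i" using side[OF assms] .
  let ?z = "root_at k i"
  have "?z ^ (a i + n i - 1) * ?z = ?z ^ Suc (a i + n i - 1)" by simp
  also have "Suc (a i + n i - 1) = a i + n i" using n by simp
  also have "?z ^ (a i + n i) = ?z ^ a i"
    using root_at_power_mod[OF assms, of k "a i + n i"] root_at_power_mod[OF assms, of k "a i"] by simp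
  finally have step: "?z ^ (a i + n i - 1) * ?z = ?z ^ a i" .
  have "?z ^ (a i + n i - 1) = ?z ^ (a i + n i - 1) * (?z * cnj ?z)"
    by (simp only: cnj_mult_unit[OF norm_root_at] mult_1_right)
  also have "\<dots> = cnj ?z * (?z ^ (a i + n i - 1) * ?z)"
    by (simp only: mult_ac)
  finally show "?z ^ ((a i + n i - 1) mod n i) = cnj ?z * ?z ^ a i"
    unfolding step root_at_power_mod[OF assms] .
qed

lemma character_orthogonal_product:
  assumes "\<And>i. i \<in> {1..q} \<Longrightarrow> finite (B i)"
    and "\<And>i. i \<in> {1..q} \<Longrightarrow> (\<Sum>j\<in>B i. f i j) = of_nat (n i) * of_bool (x i = y i)"
    and "x = y \<longleftrightarrow> (\<forall>i\<in>{1..q}. x i = y i)"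
  shows "(\<Sum>g\<in>PiE {1..q} B. \<Prod>i=1..q. f i (g i) :: complex) = of_nat (\<Prod>i=1..q. n i) * of_bool (x = y)"
proof -
  have "(\<Sum>g\<in>PiE {1..q} B. \<Prod>i=1..q. f i (g i)) = (\<Prod>i=1..q. \<Sum>j\<in>B i. f i j)"
    by (rule prod_sum_PiE[symmetric]) (use assms(1) in auto)
  also have "\<dots> = (\<Prod>i=1..q. of_nat (n i) * of_bool (x i = y i))"
    using assms(2) by (intro prod.cong) auto
  also have "\<dots> = of_nat (\<Prod>i=1..q. n i) * (\<Prod>i=1..q. of_bool (x i = y i))"
    by (simp add: prod.distrib)
  also have "(\<Prod>i=1..q. of_bool (x i = y i)) = (of_bool (x = y) :: complex)"
  proof (cases "x = y")
    case False
    then have "\<exists>i\<in>{1..q}. (of_bool (x i = y i) :: complex) = 0" using assms(3) by auto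
    then have "(\<Prod>i=1..q. of_bool (x i = y i) :: complex) = 0" by (intro prod_zero) simp_all
    then show ?thesis using False by simp
  qed simp
  finally show ?thesis .
qed

text \<open>Both orthogonality relations are needed: the one over frequencies factors the Gram
  matrix through the frequencies, and this one evaluates the product in the opposite order.\<close>

lemma sum_positions_characters:
  assumes "k \<in> frequencies" "l \<in> frequencies"
  shows "(\<Sum>a\<in>positions. character k a * cnj (character l a)) = of_nat (\<Prod>i=1..q. n i) * of_bool (k = l)"
proof -
  have "(\<Sum>j<n i. unity_root (n i) ^ (k i * j) * cnj (unity_root (n i) ^ (l i * j))) =
      of_nat (n i) * of_bool (k i = l i)" if i: "i \<in> {1..q}" for i
  proof (rule unity_root_orthogonal)
    have "1 \<le> k i" "k i \<le> n i" "1 \<le> l i" "l i \<le> n i"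
      using i assms by (auto simp: frequencies_def PiE_iff)
    then show "k i mod n i = l i mod n i \<longleftrightarrow> k i = l i" by (auto simp: mod_if split: if_splits)
    show "0 < n i" using side[OF i] by simp
  qed
  moreover have "k = l \<longleftrightarrow> (\<forall>i\<in>{1..q}. k i = l i)"
    using assms by (auto simp: frequencies_def intro: PiE_ext)
  ultimately show ?thesis
    using character_orthogonal_product[of "\<lambda>i. {..<n i}"
        "\<lambda>i j. unity_root (n i) ^ (k i * j) * cnj (unity_root (n i) ^ (l i * j))" k l]
    by (simp add: positions_def character_def prod.distrib)
qed

lemma sum_frequencies_characters:
  assumes "a \<in> positions" "b \<in> positions"
  shows "(\<Sum>k\<in>frequencies. character k a * cnj (character k b)) = of_nat (\<Prod>i=1..q. n i) * of_bool (a = b)"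
proof -
  have "(\<Sum>j\<in>{1..n i}. unity_root (n i) ^ (j * a i) * cnj (unity_root (n i) ^ (j * b i))) =
      of_nat (n i) * of_bool (a i = b i)" if i: "i \<in> {1..q}" for i
  proof -
    let ?f = "\<lambda>j. unity_root (n i) ^ (a i * j) * cnj (unity_root (n i) ^ (b i * j))"
    have n: "0 < n i" using side[OF i] by simp
    \<comment> \<open>Moves the range from 0..n-1 to 1..n: the terms at both ends are 1.\<close>
    have "?f 0 + (\<Sum>j\<in>{1..n i}. ?f j) = (\<Sum>j<Suc (n i). ?f j)"
      by (simp only: sum.lessThan_Suc_shift sum.atLeast1_atMost_eq One_nat_def)
    also have "\<dots> = (\<Sum>j<n i. ?f j) + ?f (n i)" by (rule sum.lessThan_Suc)
    also have "?f (n i) = 1"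
      by (simp add: mult.commute[of _ "n i"] power_mult unity_root_power_self[OF n])
    finally have "(\<Sum>j\<in>{1..n i}. ?f j) = (\<Sum>j<n i. ?f j)" by simp
    also have "\<dots> = of_nat (n i) * of_bool (a i = b i)"
      using positions_less[OF _ i] assms n by (intro unity_root_orthogonal) auto
    finally show ?thesis by (simp add: mult.commute)
  qed
  moreover have "a = b \<longleftrightarrow> (\<forall>i\<in>{1..q}. a i = b i)"
    using positions_eqI[OF assms] by auto
  ultimately show ?thesis
    using character_orthogonal_product[of "\<lambda>i. {1..n i}"
        "\<lambda>i j. unity_root (n i) ^ (j * a i) * cnj (unity_root (n i) ^ (j * b i))" a b]
    by (simp add: frequencies_def character_def prod.distrib)
qed

section \<open>The Gram matrix of the incidence relation and its Fourier transform\<close>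

definition common_faces :: "nat \<Rightarrow> nat set \<times> (nat \<Rightarrow> nat) \<Rightarrow> nat set \<times> (nat \<Rightarrow> nat) \<Rightarrow> complex" where
  "common_faces d x y = (\<Sum>w\<in>directions q (d - 1) \<times> positions.
     of_bool (cube_at w \<subseteq> cube_at x) * of_bool (cube_at w \<subseteq> cube_at y))"

text \<open>The block of the Gram matrix at frequency \<open>k\<close>. Collapsing direction
  \<open>i\<close> costs \<open>1 + root_at k i\<close>, one summand for each of the two ends;
  opening direction \<open>j\<close> costs the conjugate factor, as it moves the corner
  backwards.\<close>

definition symbol :: "(nat \<Rightarrow> nat) \<Rightarrow> nat set \<Rightarrow> nat set \<Rightarrow> complex" where
  "symbol k s t = (\<Sum>i\<in>s. (1 + root_at k i) *
     (\<Sum>j\<in>{1..q} - (s - {i}). (1 + cnj (root_at k j)) * of_bool (insert j (s - {i}) = t)))"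

text \<open>The Gram matrix acts as a sum over cofaces followed by a sum over faces. Each only
  shifts the position, hence multiplies a character by a scalar, and changes the direction
  set.\<close>

lemma common_faces_character:
  assumes d: "1 \<le> d" and s: "s \<in> directions q d" and a: "a \<in> positions"
  shows "(\<Sum>y\<in>directions q d \<times> positions. common_faces d (s, a) y * (of_bool (fst y = t) * character k (snd y))) =
    symbol k s t * character k a"
proof -
  let ?X = "directions q d \<times> positions" and ?W = "directions q (d - 1) \<times> positions"
  let ?G = "\<lambda>y. of_bool (fst y = t) * character k (snd y)"
  let ?h = "\<lambda>w. \<Sum>j\<in>{1..q} - fst w. (1 + cnj (root_at k j)) * of_bool (insert j (fst w) = t)"
  have "(\<Sum>y\<in>?X. common_faces d (s, a) y * ?G y) =
      (\<Sum>w\<in>?W. of_bool (cube_at w \<subseteq> cube_at (s, a)) * (\<Sum>y\<in>?X. of_bool (cube_at w \<subseteq> cube_at y) * ?G y))"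
    unfolding common_faces_def sum_distrib_left sum_distrib_right
    by (subst sum.swap) (simp only: mult.assoc)
  also have "\<dots> = (\<Sum>w\<in>?W. of_bool (cube_at w \<subseteq> cube_at (s, a)) * (?h w * character k (snd w)))"
  proof (rule sum.cong[OF refl])
    fix w assume "w \<in> ?W"
    then obtain r b where w: "w = (r, b)" "r \<in> directions q (d - 1)" "b \<in> positions" by auto
    have "(\<Sum>y\<in>?X. of_bool (cube_at w \<subseteq> cube_at y) * ?G y) = ?h w * character k b"
      unfolding w(1) sum_cofaces[OF d w(2,3)] sum_distrib_right
      by (intro sum.cong refl) (auto simp: character_pred algebra_simps)
    then show "of_bool (cube_at w \<subseteq> cube_at (s, a)) * (\<Sum>y\<in>?X. of_bool (cube_at w \<subseteq> cube_at y) * ?G y) =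
        of_bool (cube_at w \<subseteq> cube_at (s, a)) * (?h w * character k (snd w))"
      by (simp add: w(1))
  qed
  also have "\<dots> = (\<Sum>i\<in>s. (1 + root_at k i) * ?h (s - {i}, a) * character k a)"
    unfolding sum_faces[OF d s a]
  proof (rule sum.cong[OF refl])
    fix i assume "i \<in> s"
    then have "i \<in> {1..q}" using s by (auto simp: directions_def)
    moreover have "h * x + h * (z * x) = (1 + z) * h * x" for h x z :: complex
      by (simp add: algebra_simps)
    ultimately show "?h (s - {i}, a) * character k (snd (s - {i}, a)) +
        ?h (s - {i}, succ i a) * character k (snd (s - {i}, succ i a)) =
        (1 + root_at k i) * ?h (s - {i}, a) * character k a"
      unfolding fst_conv snd_conv by (simp only: character_succ)
  qed
  also have "\<dots> = symbol k s t * character k a"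
    unfolding symbol_def fst_conv by (rule sum_distrib_right[symmetric])
  finally show ?thesis .
qed

text \<open>
  The characters diagonalise the translation action, so the Gram matrix of the incidence matrix
  becomes block diagonal with one block per frequency.
\<close>

lemma det_common_faces:
  fixes c u :: complex
  assumes d: "1 \<le> d" and c: "c \<noteq> 0"
  shows "det_on (directions q d \<times> positions) (\<lambda>x y. of_bool (x = y) * c - u * common_faces d x y) =
    det_on (directions q d \<times> frequencies)
      (\<lambda>x y. of_bool (x = y) * c - u * (of_bool (snd x = snd y) * symbol (snd x) (fst x) (fst y)))"
    (is "det_on ?X _ = det_on ?Y _")
proof -
  define N :: complex where "N = of_nat (\<Prod>i=1..q. n i)"
  have N: "N \<noteq> 0" using side by (fastforce simp: N_def)
  have card: "card ?X = card ?Y"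
    by (simp add: card_cartesian_product card_positions card_frequencies)
  \<comment> \<open>In one order the product of \<open>?f\<close> and \<open>?g\<close> is
    \<open>u / c\<close> times the Gram matrix, in the other it is \<open>u / c\<close> times the
    block diagonal matrix of symbols. The index sets have equal cardinality, so the powers of
    \<open>c\<close> extracted and restored agree.\<close>
  let ?f = "\<lambda>x r. u / (c * N) * (symbol (snd r) (fst x) (fst r) * character (snd r) (snd x))"
  let ?g = "\<lambda>r x. of_bool (fst x = fst r) * cnj (character (snd r) (snd x))"
  have "det_on ?X (\<lambda>x y. of_bool (x = y) * c - u * common_faces d x y) =
      det_on ?X (\<lambda>x y. c * (of_bool (x = y) - (\<Sum>r\<in>?Y. ?f x r * ?g r y)))"
  proof (rule det_on_cong)
    fix x y assume x: "x \<in> ?X" and y: "y \<in> ?X"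
    obtain s a t b where xy: "x = (s, a)" "y = (t, b)" by (cases x, cases y)
    have mem: "s \<in> directions q d" "a \<in> positions" "t \<in> directions q d" "b \<in> positions"
      using x y by (auto simp: xy)
    \<comment> \<open>Symbol times character is turned back into the Gram matrix applied to a
      function of \<open>z\<close>; the sum over frequencies then collapses that function to a point
      mass at \<open>y\<close>.\<close>
    have "(\<Sum>r\<in>?Y. symbol (snd r) s (fst r) * character (snd r) a * ?g r y) =
        (\<Sum>r\<in>?Y. \<Sum>z\<in>?X. common_faces d x z * (of_bool (fst z = fst r) * character (snd r) (snd z)) * ?g r y)"
      unfolding xy common_faces_character[OF d mem(1,2), symmetric] sum_distrib_right ..
    also have "\<dots> = (\<Sum>z\<in>?X. common_faces d x z *
        (\<Sum>r\<in>?Y. of_bool (fst z = fst r) * character (snd r) (snd z) * ?g r y))"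
      by (subst sum.swap) (simp only: sum_distrib_left mult.assoc)
    also have "\<dots> = (\<Sum>z\<in>?X. common_faces d x z * (N * of_bool (z = y)))"
    proof (rule sum.cong[OF refl])
      fix z assume "z \<in> ?X"
      then obtain r e where z: "z = (r, e)" "r \<in> directions q d" "e \<in> positions" by auto
      have "(\<Sum>p\<in>?Y. of_bool (fst z = fst p) * character (snd p) (snd z) * ?g p y) =
          (\<Sum>s\<in>directions q d. \<Sum>k\<in>frequencies.
            of_bool (r = s) * (of_bool (t = s) * (character k e * cnj (character k b))))"
        unfolding sum.cartesian_product by (intro sum.cong refl) (auto simp: z(1) xy(2))
      also have "\<dots> = of_bool (t = r) * (\<Sum>k\<in>frequencies. character k e * cnj (character k b))"
        using z(2) by (simp only: sum_distrib_left[symmetric] finite_directions sum_of_bool_delta)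
      also have "\<dots> = N * of_bool (z = y)"
        unfolding sum_frequencies_characters[OF z(3) mem(4)] N_def by (auto simp: z(1) xy(2))
      finally show "common_faces d x z * (\<Sum>p\<in>?Y. of_bool (fst z = fst p) * character (snd p) (snd z) * ?g p y) =
          common_faces d x z * (N * of_bool (z = y))" by simp
    qed
    also have "\<dots> = N * (\<Sum>z\<in>?X. common_faces d x z * of_bool (z = y))"
      by (simp only: sum_distrib_left mult.left_commute)
    also have "(\<Sum>z\<in>?X. common_faces d x z * of_bool (z = y)) = common_faces d x y"
      using y by (intro sum_of_bool_delta) simp_all
    finally have "(\<Sum>r\<in>?Y. symbol (snd r) s (fst r) * character (snd r) a * ?g r y) = N * common_faces d x y" .
    then have "(\<Sum>r\<in>?Y. ?f x r * ?g r y) = u / (c * N) * (N * common_faces d x y)"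
      by (simp only: xy fst_conv snd_conv mult.assoc sum_distrib_left[symmetric])
    then show "of_bool (x = y) * c - u * common_faces d x y =
        c * (of_bool (x = y) - (\<Sum>r\<in>?Y. ?f x r * ?g r y))"
      using c N by (simp only:) (simp add: field_simps)
  qed simp
  also have "\<dots> = c ^ card ?X * det_on ?Y (\<lambda>r p. of_bool (r = p) - (\<Sum>x\<in>?X. ?g r x * ?f x p))"
    unfolding det_on_scale by (subst det_on_one_minus_commute) simp_all
  also have "\<dots> = det_on ?Y (\<lambda>r p. c * (of_bool (r = p) - (\<Sum>x\<in>?X. ?g r x * ?f x p)))"
    unfolding det_on_scale card ..
  also have "\<dots> = det_on ?Y (\<lambda>x y. of_bool (x = y) * c - u * (of_bool (snd x = snd y) * symbol (snd x) (fst x) (fst y)))"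
  proof (rule det_on_cong)
    fix r p assume "r \<in> ?Y" "p \<in> ?Y"
    then obtain s k t l where rp: "r = (s, k)" "p = (t, l)" "s \<in> directions q d" "k \<in> frequencies"
      "t \<in> directions q d" "l \<in> frequencies" by auto
    have "(\<Sum>x\<in>?X. ?g r x * ?f x p) =
        (\<Sum>s'\<in>directions q d. of_bool (s' = s) * (u / (c * N) * (symbol l s' t *
          (\<Sum>a\<in>positions. character l a * cnj (character k a)))))"
      unfolding sum_distrib_left sum.cartesian_product
      by (intro sum.cong refl) (auto simp: rp(1,2))
    also have "\<dots> = u / (c * N) * (symbol l s t * (N * of_bool (l = k)))"
      unfolding sum_positions_characters[OF rp(6,4)] N_def
      using rp(3) by (subst sum_of_bool_delta) simp_all
    finally show "c * (of_bool (r = p) - (\<Sum>x\<in>?X. ?g r x * ?f x p)) =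
        of_bool (r = p) * c - u * (of_bool (snd r = snd p) * symbol (snd r) (fst r) (fst p))"
      using c N by (auto simp: rp(1,2) field_simps)
  qed simp
  finally show ?thesis .
qed

end

section \<open>Diagonal plus rank one, and elementary symmetric polynomials\<close>

lemma eventually_nhds_nonzero:
  fixes f :: "complex \<Rightarrow> complex"
  assumes "isCont f 0" "f 0 \<noteq> 0"
  shows "\<forall>\<^sub>F u in nhds 0. f u \<noteq> 0"
  using assms tendsto_imp_eventually_ne[of f "f 0" "nhds 0" 0]
  by (simp add: isCont_def tendsto_at_iff_tendsto_nhds)

lemma det_on_row_scale:
  fixes f :: "'a \<Rightarrow> 'a \<Rightarrow> 'c::idom"
  assumes "finite S"
  shows "det_on S (\<lambda>x y. d x * f x y) = prod d S * det_on S f"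
proof -
  have "det_on S (\<lambda>x y. d x * f x y) = det_on S (\<lambda>x y. \<Sum>z\<in>S. of_bool (x = z) * d x * f z y)"
    using assms by (intro det_on_cong) (simp_all add: mult.assoc)
  also have "\<dots> = det_on S (\<lambda>x z. of_bool (x = z) * d x) * det_on S f"
    by (rule det_on_mult[OF assms])
  finally show ?thesis by (simp only: det_on_diag[OF assms])
qed

text \<open>The matrix determinant lemma for all blocks at once. After division of the rows by
  \<open>D\<close> the perturbation factors through \<open>K\<close>, with rank one in each block,
  and the commuted matrix is diagonal on \<open>K\<close>.\<close>

lemma det_on_diag_minus_rank_one:
  fixes D v w :: "'a \<Rightarrow> 'b \<Rightarrow> 'c::field"
  assumes fin: "finite J" "finite K" and D: "\<And>j k. j \<in> J \<Longrightarrow> k \<in> K \<Longrightarrow> D j k \<noteq> 0"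
  shows "det_on (J \<times> K) (\<lambda>x y. of_bool (x = y) * D (fst x) (snd x)
      - of_bool (snd x = snd y) * (v (fst x) (snd x) * w (fst y) (snd x))) =
    (\<Prod>k\<in>K. (\<Prod>j\<in>J. D j k) * (1 - (\<Sum>j\<in>J. v j k * w j k / D j k)))"
proof -
  let ?X = "J \<times> K"
  let ?f = "\<lambda>x k. of_bool (snd x = k) * (v (fst x) (snd x) / D (fst x) (snd x))"
  let ?g = "\<lambda>k x. of_bool (snd x = k) * w (fst x) k"
  have "det_on ?X (\<lambda>x y. of_bool (x = y) * D (fst x) (snd x)
      - of_bool (snd x = snd y) * (v (fst x) (snd x) * w (fst y) (snd x))) =
    det_on ?X (\<lambda>x y. D (fst x) (snd x) * (of_bool (x = y) - (\<Sum>k\<in>K. ?f x k * ?g k y)))"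
  proof (rule det_on_cong)
    fix x y assume "x \<in> ?X" "y \<in> ?X"
    then have x: "fst x \<in> J" "snd x \<in> K" "snd y \<in> K" by auto
    have "(\<Sum>k\<in>K. ?f x k * ?g k y) =
        v (fst x) (snd x) / D (fst x) (snd x) * (of_bool (snd y = snd x) * w (fst y) (snd x))"
      using fin x by (simp only: mult.assoc sum_of_bool_delta)
    then show "of_bool (x = y) * D (fst x) (snd x) - of_bool (snd x = snd y) * (v (fst x) (snd x) * w (fst y) (snd x)) =
        D (fst x) (snd x) * (of_bool (x = y) - (\<Sum>k\<in>K. ?f x k * ?g k y))"
      using D[OF x(1,2)] by (simp add: eq_commute[of "snd y"] field_simps)
  qed (use fin in simp)
  also have "\<dots> = (\<Prod>x\<in>?X. D (fst x) (snd x)) *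
      det_on ?X (\<lambda>x y. of_bool (x = y) - (\<Sum>k\<in>K. ?f x k * ?g k y))"
    by (rule det_on_row_scale) (use fin in simp)
  also have "det_on ?X (\<lambda>x y. of_bool (x = y) - (\<Sum>k\<in>K. ?f x k * ?g k y)) =
      det_on K (\<lambda>k l. of_bool (k = l) - (\<Sum>x\<in>?X. ?g k x * ?f x l))"
    by (rule det_on_one_minus_commute) (use fin in simp_all)
  also have "\<dots> = det_on K (\<lambda>k l. of_bool (k = l) * (1 - (\<Sum>j\<in>J. v j k * w j k / D j k)))"
  proof (rule det_on_cong[OF fin(2)])
    fix k l assume k: "k \<in> K" "l \<in> K"
    have "(\<Sum>x\<in>?X. ?g k x * ?f x l) =
        (\<Sum>j\<in>J. \<Sum>m\<in>K. of_bool (m = k) * (of_bool (m = l) * (v j m * w j k / D j m)))"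
      unfolding sum.cartesian_product by (intro sum.cong refl) auto
    also have "\<dots> = (\<Sum>j\<in>J. of_bool (k = l) * (v j k * w j k / D j k))"
      using fin k by (simp only: sum_of_bool_delta)
    also have "\<dots> = of_bool (k = l) * (\<Sum>j\<in>J. v j k * w j k / D j k)"
      by (rule sum_distrib_left[symmetric])
    finally show "of_bool (k = l) - (\<Sum>x\<in>?X. ?g k x * ?f x l) =
        of_bool (k = l) * (1 - (\<Sum>j\<in>J. v j k * w j k / D j k))"
      by (simp add: right_diff_distrib)
  qed
  also have "\<dots> = (\<Prod>k\<in>K. 1 - (\<Sum>j\<in>J. v j k * w j k / D j k))"
    by (rule det_on_diag[OF fin(2)])
  also have "(\<Prod>x\<in>?X. D (fst x) (snd x)) = (\<Prod>k\<in>K. \<Prod>j\<in>J. D j k)"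
    by (subst prod.swap) (simp add: prod.cartesian_product case_prod_unfold)
  finally show ?thesis by (simp add: prod.distrib)
qed

section \<open>Elementary symmetric polynomials as coefficients\<close>

lemma degree_prod_linear:
  "finite A \<Longrightarrow> degree (\<Prod>k\<in>A. [:t k, 1:]) = card A" for t :: "'a \<Rightarrow> 'c::idom"
  by (subst degree_prod_sum_eq) auto

lemma coeff_prod_linear_scale:
  fixes t :: "'a \<Rightarrow> 'c::idom"
  assumes "finite A" "i \<le> card A"
  shows "coeff (\<Prod>k\<in>A. [:c * t k, 1:]) i = c ^ (card A - i) * coeff (\<Prod>k\<in>A. [:t k, 1:]) i"
  using assms
proof (induction A arbitrary: i rule: finite_induct)
  case (insert a A)
  let ?p = "\<Prod>k\<in>A. [:c * t k, 1:]" and ?r = "\<Prod>k\<in>A. [:t k, 1:]"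
  have zero: "coeff ?p (Suc (card A)) = 0" "coeff ?r (Suc (card A)) = 0"
    by (simp_all add: coeff_eq_0 degree_prod_linear insert.hyps(1))
  show ?case
  proof (cases i)
    case 0
    then show ?thesis using insert by simp
  next
    case (Suc j)
    then have j: "j \<le> card A" using insert by simp
    show ?thesis
    proof (cases "j = card A")
      case True
      then show ?thesis using insert Suc zero by simp
    next
      case False
      then have "card A - j = Suc (card A - Suc j)" "Suc j \<le> card A" using j by auto
      then show ?thesis using insert Suc j by (simp add: algebra_simps)
    qed
  qed
qed simp

lemma elem_sym_scale:
  fixes t :: "nat \<Rightarrow> 'c::idom"
  assumes "l \<le> q"
  shows "elem_sym q (\<lambda>i. c * t i) l = c ^ l * elem_sym q t l"
  using coeff_prod_linear_scale[of "{1..q}" "q - l" c t] assms by (simp add: elem_sym_def)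

lemma prod_add_elem_sym:
  fixes t :: "nat \<Rightarrow> 'c::idom"
  shows "(\<Prod>k=1..q. B + t k) = (\<Sum>l=0..q. elem_sym q t l * B ^ (q - l))"
proof -
  have "(\<Prod>k=1..q. B + t k) = poly (\<Prod>k=1..q. [:t k, 1:]) B"
    by (simp add: poly_prod add.commute)
  also have "\<dots> = (\<Sum>i\<le>q. coeff (\<Prod>k=1..q. [:t k, 1:]) i * B ^ i)"
    unfolding poly_altdef by (subst degree_prod_linear) simp_all
  also have "\<dots> = (\<Sum>l=0..q. elem_sym q t l * B ^ (q - l))"
    unfolding elem_sym_def
    by (rule sum.reindex_bij_witness[of _ "\<lambda>l. q - l" "\<lambda>l. q - l"]) auto
  finally show ?thesis .
qed

text \<open>Writing \<open>t j\<close> as \<open>(B + t j) - B\<close> turns the left side into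
  \<open>q\<close> times the full product minus \<open>B\<close> times its derivative in
  \<open>B\<close>. On the term with \<open>B ^ (q - l)\<close> this acts as multiplication by
  \<open>q - (q - l) = l\<close>.\<close>

lemma sum_prod_omit_elem_sym:
  fixes t :: "nat \<Rightarrow> complex"
  shows "(\<Sum>j=1..q. t j * (\<Prod>k\<in>{1..q} - {j}. B + t k)) = (\<Sum>l=0..q. of_nat l * elem_sym q t l * B ^ (q - l))"
proof -
  have "((\<lambda>B. \<Prod>k=1..q. B + t k) has_field_derivative (\<Sum>j=1..q. 1 * (\<Prod>k\<in>{1..q} - {j}. B + t k))) (at B)"
    by (rule has_field_derivative_prod) (auto intro!: derivative_eq_intros)
  moreover have "((\<lambda>B. \<Sum>l=0..q. elem_sym q t l * B ^ (q - l)) has_field_derivative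
      (\<Sum>l=0..q. elem_sym q t l * (of_nat (q - l) * B ^ (q - l - 1)))) (at B)"
    by (auto intro!: derivative_eq_intros sum.cong)
  ultimately have deriv: "(\<Sum>j=1..q. \<Prod>k\<in>{1..q} - {j}. B + t k) =
      (\<Sum>l=0..q. elem_sym q t l * (of_nat (q - l) * B ^ (q - l - 1)))"
    unfolding prod_add_elem_sym using DERIV_unique by fastforce
  have "(\<Sum>j=1..q. t j * (\<Prod>k\<in>{1..q} - {j}. B + t k)) =
      (\<Sum>j=1..q. (\<Prod>k=1..q. B + t k) - B * (\<Prod>k\<in>{1..q} - {j}. B + t k))"
  proof (rule sum.cong[OF refl])
    fix j assume "j \<in> {1..q}"
    then have "(\<Prod>k=1..q. B + t k) = (B + t j) * (\<Prod>k\<in>{1..q} - {j}. B + t k)"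
      by (subst prod.remove[of _ j]) simp_all
    then show "t j * (\<Prod>k\<in>{1..q} - {j}. B + t k) = (\<Prod>k=1..q. B + t k) - B * (\<Prod>k\<in>{1..q} - {j}. B + t k)"
      by (simp add: algebra_simps)
  qed
  also have "\<dots> = of_nat q * (\<Prod>k=1..q. B + t k) - B * (\<Sum>j=1..q. \<Prod>k\<in>{1..q} - {j}. B + t k)"
    by (simp add: sum_subtractf sum_distrib_left)
  also have "\<dots> = (\<Sum>l=0..q. of_nat q * (elem_sym q t l * B ^ (q - l)) -
      B * (elem_sym q t l * (of_nat (q - l) * B ^ (q - l - 1))))"
    unfolding deriv prod_add_elem_sym by (simp add: sum_subtractf sum_distrib_left)
  also have "\<dots> = (\<Sum>l=0..q. of_nat l * elem_sym q t l * B ^ (q - l))"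
  proof (rule sum.cong[OF refl])
    fix l assume l: "l \<in> {0..q}"
    \<comment> \<open>At \<open>l = q\<close> the exponent \<open>q - l - 1\<close> is cut off at 0,
      but the coefficient vanishes there.\<close>
    have "B * (of_nat (q - l) * B ^ (q - l - 1)) = of_nat (q - l) * B ^ (q - l)"
      by (cases "q - l") simp_all
    then have *: "B * (elem_sym q t l * (of_nat (q - l) * B ^ (q - l - 1))) =
        elem_sym q t l * (of_nat (q - l) * B ^ (q - l))" by (metis mult.left_commute)
    show "of_nat q * (elem_sym q t l * B ^ (q - l)) - B * (elem_sym q t l * (of_nat (q - l) * B ^ (q - l - 1))) =
        of_nat l * elem_sym q t l * B ^ (q - l)"
      unfolding * using l by (simp add: of_nat_diff algebra_simps)
  qed
  finally show ?thesis .
qed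

text \<open>The diagonal shift \<open>2 * u * w j\<close> is twice the rank one weight
  \<open>u * w j\<close>, so the perturbation contributes \<open>l / 2\<close> in degree
  \<open>l\<close>. The factor \<open>1 - l / 2\<close>, times \<open>2 ^ l\<close> from scaling the
  variables, is the coefficient \<open>(2 - l) * 2 ^ (l - 1)\<close>.\<close>

lemma rank_one_factor_elem_sym:
  fixes w :: "nat \<Rightarrow> complex"
  assumes D: "\<And>j. j \<in> {1..q} \<Longrightarrow> B + 2 * u * w j \<noteq> 0"
  shows "(\<Prod>j=1..q. B + 2 * u * w j) * (1 - (\<Sum>j=1..q. u * w j / (B + 2 * u * w j))) =
    (\<Sum>l=0..q. (2 - of_nat l) * 2 powi (int l - 1) * elem_sym q w l * B ^ (q - l) * u ^ l)"
proof -
  let ?t = "\<lambda>j. 2 * u * w j"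
  let ?Q = "\<Prod>j=1..q. B + ?t j"
  have "?Q * (\<Sum>j=1..q. u * w j / (B + ?t j)) = (\<Sum>j=1..q. ?t j * (\<Prod>k\<in>{1..q} - {j}. B + ?t k)) / 2"
    unfolding sum_distrib_left sum_divide_distrib
  proof (rule sum.cong[OF refl])
    fix j assume j: "j \<in> {1..q}"
    then have "?Q = (B + ?t j) * (\<Prod>k\<in>{1..q} - {j}. B + ?t k)"
      by (subst prod.remove[of _ j]) simp_all
    then show "?Q * (u * w j / (B + ?t j)) = ?t j * (\<Prod>k\<in>{1..q} - {j}. B + ?t k) / 2"
      using D[OF j] by simp
  qed
  also have "\<dots> = (\<Sum>l=0..q. of_nat l * elem_sym q ?t l * B ^ (q - l)) / 2"
    unfolding sum_prod_omit_elem_sym ..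
  finally have "?Q * (1 - (\<Sum>j=1..q. u * w j / (B + ?t j))) =
      (\<Sum>l=0..q. elem_sym q ?t l * B ^ (q - l)) - (\<Sum>l=0..q. of_nat l * elem_sym q ?t l * B ^ (q - l)) / 2"
    by (simp only: right_diff_distrib mult_1_right prod_add_elem_sym)
  also have "\<dots> = (\<Sum>l=0..q. elem_sym q ?t l * B ^ (q - l) - of_nat l * elem_sym q ?t l * B ^ (q - l) / 2)"
    by (simp only: sum_subtractf sum_divide_distrib)
  also have "\<dots> = (\<Sum>l=0..q. (2 - of_nat l) * 2 powi (int l - 1) * elem_sym q w l * B ^ (q - l) * u ^ l)"
  proof (rule sum.cong[OF refl])
    fix l assume "l \<in> {0..q}"
    then have e: "elem_sym q ?t l = 2 ^ l * u ^ l * elem_sym q w l"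
      using elem_sym_scale[of l q "2 * u" w] by (simp add: power_mult_distrib)
    have "(2 :: complex) powi (int l - 1) = 2 ^ l / 2" by (simp add: power_int_diff)
    then show "elem_sym q ?t l * B ^ (q - l) - of_nat l * elem_sym q ?t l * B ^ (q - l) / 2 =
        (2 - of_nat l) * 2 powi (int l - 1) * elem_sym q w l * B ^ (q - l) * u ^ l"
      unfolding e by (simp add: field_simps)
  qed
  finally show ?thesis .
qed

section \<open>The zeta function of a skeleton\<close>

definition flags :: "nat \<Rightarrow> (nat \<Rightarrow> nat) \<Rightarrow> nat \<Rightarrow> (cube \<times> cube) set" where
  "flags q n d = {(\<tau>, \<sigma>). \<tau> \<in> cubes q n (d - 1) \<and> \<sigma> \<in> cubes q n d \<and> \<tau> \<subseteq> \<sigma>}"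

text \<open>The path condition at \<open>i\<close> places only the next lower cell. That each pair
  of the list is itself a flag comes from the condition at the cyclic predecessor
  \<open>h\<close>.\<close>

lemma closed_geodesic_iff_cyclic_walk:
  "closed_geodesic q n d c \<longleftrightarrow> cyclic_walk (geodesic_step (flags q n d)) c"
proof
  assume c: "closed_geodesic q n d c"
  then have ne: "c \<noteq> []" and sub: "set c \<subseteq> cubes q n (d - 1) \<times> cubes q n d"
    and step: "\<And>i. i < length c \<Longrightarrow> fst (c ! i) \<noteq> fst (c ! (Suc i mod length c)) \<and>
      fst (c ! (Suc i mod length c)) \<subseteq> snd (c ! i) \<inter> snd (c ! (Suc i mod length c)) \<and>
      snd (c ! i) \<noteq> snd (c ! (Suc i mod length c))"
    by (auto simp: closed_geodesic_def closed_path_def Let_def)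
  have flag: "c ! i \<in> flags q n d" if i: "i < length c" for i
  proof -
    define h where "h = (i + length c - 1) mod length c"
    have h: "h < length c" unfolding h_def by (rule mod_less_divisor) (use i in linarith)
    then have "Suc h mod length c = i" using i unfolding h_def
      by (cases i) (simp_all add: mod_Suc)
    then have "fst (c ! i) \<subseteq> snd (c ! i)" using step[OF h] by auto
    moreover have "c ! i \<in> cubes q n (d - 1) \<times> cubes q n d" using sub i nth_mem by blast
    ultimately show ?thesis by (auto simp: flags_def mem_Times_iff case_prod_unfold)
  qed
  have "(c ! i, c ! (Suc i mod length c)) \<in> geodesic_step (flags q n d)" if i: "i < length c" for i
  proof -
    have j: "Suc i mod length c < length c" using i by (intro mod_less_divisor) linarith
    have "(fst (c ! (Suc i mod length c)), snd (c ! i)) \<in> flags q n d"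
      using flag[OF i] flag[OF j] step[OF i] by (auto simp: flags_def case_prod_unfold)
    then show ?thesis using flag[OF i] flag[OF j] step[OF i] by (simp add: geodesic_step_def)
  qed
  then show "cyclic_walk (geodesic_step (flags q n d)) c" using ne by (simp add: cyclic_walk_def)
next
  assume "cyclic_walk (geodesic_step (flags q n d)) c"
  then have ne: "c \<noteq> []"
    and step: "\<And>i. i < length c \<Longrightarrow> (c ! i, c ! (Suc i mod length c)) \<in> geodesic_step (flags q n d)"
    by (auto simp: cyclic_walk_def)
  have "set c \<subseteq> cubes q n (d - 1) \<times> cubes q n d"
  proof
    fix x assume "x \<in> set c"
    then obtain i where "i < length c" "x = c ! i" by (auto simp: in_set_conv_nth)
    then have "x \<in> flags q n d" using step by (auto simp: geodesic_step_def)
    then show "x \<in> cubes q n (d - 1) \<times> cubes q n d" by (auto simp: flags_def)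
  qed
  moreover have "fst (c ! i) \<noteq> fst (c ! (Suc i mod length c)) \<and>
      fst (c ! (Suc i mod length c)) \<subseteq> snd (c ! i) \<inter> snd (c ! (Suc i mod length c)) \<and>
      snd (c ! i) \<noteq> snd (c ! (Suc i mod length c))" if i: "i < length c" for i
    using step[OF i] by (auto simp: geodesic_step_def flags_def case_prod_unfold)
  ultimately show "closed_geodesic q n d c"
    using ne unfolding closed_geodesic_def closed_path_def Let_def by blast
qed

lemma prime_geodesic_iff_primitive_walk:
  "prime_geodesic q n d c \<longleftrightarrow> primitive_walk (geodesic_step (flags q n d)) c"
  by (simp add: prime_geodesic_def primitive_walk_def closed_geodesic_iff_cyclic_walk)

lemma prime_cycles_eq:
  "prime_cycles q n d = {c. primitive_walk (geodesic_step (flags q n d)) c} // rotation_rel (geodesic_step (flags q n d))"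
  by (simp add: prime_cycles_def rotation_rel_def prime_geodesic_iff_primitive_walk)

lemma one_plus_root_mult_cnj:
  "(1 + cis x) * (1 + cnj (cis x)) = 2 + 2 * complex_of_real (cos x)"
proof -
  have "cis x * cnj (cis x) = 1" by (simp add: cnj_mult_unit)
  moreover have "cis x + cnj (cis x) = 2 * complex_of_real (cos x)" by (simp add: complex_add_cnj)
  ultimately show ?thesis by (simp add: algebra_simps del: cis_cnj)
qed

context cubical_lattice
begin

lemma card_flags:
  assumes "1 \<le> d"
  shows "card (flags q n d) = 2 * d * card (cubes q n d)"
proof -
  have "bij_betw prod.swap (SIGMA \<sigma>:cubes q n d. {\<tau> \<in> cubes q n (d - 1). \<tau> \<subseteq> \<sigma>}) (flags q n d)"
    by (rule bij_betwI[of _ _ _ prod.swap]) (auto simp: flags_def)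
  then have "card (flags q n d) = card (SIGMA \<sigma>:cubes q n d. {\<tau> \<in> cubes q n (d - 1). \<tau> \<subseteq> \<sigma>})"
    using bij_betw_same_card by fastforce
  also have "\<dots> = (\<Sum>\<sigma>\<in>cubes q n d. card {\<tau> \<in> cubes q n (d - 1). \<tau> \<subseteq> \<sigma>})"
    by (rule card_SigmaI) simp_all
  also have "\<dots> = (\<Sum>\<sigma>\<in>cubes q n d. 2 * d)"
    by (rule sum.cong[OF refl card_faces[OF assms]])
  finally show ?thesis by simp
qed

lemma zeta_eventually_det:
  "\<forall>\<^sub>F u in nhds 0. zeta_convergent q n d u \<and> inverse (zeta q n d u) =
     det_on (flags q n d) (\<lambda>x y. of_bool (x = y) - u * of_bool ((x, y) \<in> geodesic_step (flags q n d)))"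
proof -
  have "finite (flags q n d)"
    by (rule finite_subset[of _ "cubes q n (d - 1) \<times> cubes q n d"]) (auto simp: flags_def)
  moreover have "geodesic_step (flags q n d) \<subseteq> flags q n d \<times> flags q n d"
    by (auto simp: geodesic_step_def)
  ultimately have "\<forall>\<^sub>F u in nhds 0.
      det_on (flags q n d) (\<lambda>x y. of_bool (x = y) - u * of_bool ((x, y) \<in> geodesic_step (flags q n d))) \<noteq> 0 \<and>
      (partial_zeta u \<longlongrightarrow> inverse (det_on (flags q n d)
        (\<lambda>x y. of_bool (x = y) - u * of_bool ((x, y) \<in> geodesic_step (flags q n d)))))
      (finite_subsets_at_top (prime_cycles q n d))"
    using euler_product[of "flags q n d" "geodesic_step (flags q n d)"]
    unfolding partial_zeta_def[abs_def] cycle_length_def prime_cycles_eq by blast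
  then show ?thesis
  proof eventually_elim
    case (elim u)
    then have "zeta q n d u = inverse (det_on (flags q n d)
        (\<lambda>x y. of_bool (x = y) - u * of_bool ((x, y) \<in> geodesic_step (flags q n d))))"
      unfolding zeta_def by (intro tendsto_Lim finite_subsets_at_top_neq_bot) blast
    moreover have "zeta_convergent q n d u"
      unfolding zeta_convergent_def using elim by (meson inverse_nonzero_iff_nonzero)
    ultimately show ?case by simp
  qed
qed

text \<open>The degrees \<open>2 * d\<close> and \<open>2 * (q - (d - 1))\<close> in
  \<open>\<alpha>\<close> and \<open>\<beta>\<close> count faces and cofaces. The powers stay
  uncombined here; their exponents are collected once the dimension is fixed.\<close>

theorem zeta_eventually:
  assumes d: "1 \<le> d" and dq: "d \<le> q"
  defines "\<alpha> \<equiv> \<lambda>u :: complex. 1 + (of_nat (2 * d) - 1) * u"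
    and "\<beta> \<equiv> \<lambda>u :: complex. 1 + (of_nat (2 * (q - (d - 1))) - 1) * u"
  shows "\<forall>\<^sub>F u in nhds 0. 1 - u \<noteq> 0 \<and> \<beta> u \<noteq> 0 \<and> zeta_convergent q n d u \<and>
    inverse (zeta q n d u) = (1 - u) ^ (2 * d * card (cubes q n d)) * (\<beta> u / (1 - u)) ^ card (cubes q n (d - 1)) *
      (1 / (\<beta> u * (1 - u))) ^ card (cubes q n d) *
      det_on (directions q d \<times> frequencies) (\<lambda>x y. of_bool (x = y) * (\<alpha> u * \<beta> u)
        - u * (of_bool (snd x = snd y) * symbol (snd x) (fst x) (fst y)))"
proof -
  have "\<forall>\<^sub>F u in nhds 0. 1 - u \<noteq> (0 :: complex)"
    by (rule eventually_nhds_nonzero) (auto intro!: continuous_intros)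
  moreover have "\<forall>\<^sub>F u in nhds 0. \<alpha> u \<noteq> 0"
    unfolding \<alpha>_def by (rule eventually_nhds_nonzero) (auto intro!: continuous_intros)
  moreover have "\<forall>\<^sub>F u in nhds 0. \<beta> u \<noteq> 0"
    unfolding \<beta>_def by (rule eventually_nhds_nonzero) (auto intro!: continuous_intros)
  ultimately show ?thesis using zeta_eventually_det[of d]
  proof eventually_elim
    case (elim u)
    let ?S = "cubes q n d" and ?R = "cubes q n (d - 1)" and ?X = "directions q d \<times> positions"
    let ?c = "\<alpha> u * \<beta> u"
    have "det_on ?S (\<lambda>s s'. of_bool (s = s') * ?c
        - u * (\<Sum>t\<in>?R. of_bool ((t, s) \<in> flags q n d) * of_bool ((t, s') \<in> flags q n d))) =
      det_on ?X (\<lambda>x y. of_bool (cube_at x = cube_at y) * ?c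
        - u * (\<Sum>t\<in>?R. of_bool ((t, cube_at x) \<in> flags q n d) * of_bool ((t, cube_at y) \<in> flags q n d)))"
      by (rule det_on_bij[symmetric, OF _ cube_at_bij]) simp
    also have "\<dots> = det_on ?X (\<lambda>x y. of_bool (x = y) * ?c - u * common_faces d x y)"
    proof (rule det_on_cong)
      fix x y assume xy: "x \<in> ?X" "y \<in> ?X"
      then have mem: "cube_at x \<in> ?S" "cube_at y \<in> ?S"
        using cube_at_bij[of d] by (auto simp: bij_betw_def)
      have "cube_at x = cube_at y \<longleftrightarrow> x = y"
        using xy cube_at_bij[of d] by (auto simp: bij_betw_def inj_on_def)
      moreover have "(\<Sum>t\<in>?R. of_bool ((t, cube_at x) \<in> flags q n d) * of_bool ((t, cube_at y) \<in> flags q n d)) =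
          (\<Sum>t\<in>?R. of_bool (t \<subseteq> cube_at x) * of_bool (t \<subseteq> cube_at y) :: complex)"
        using mem by (intro sum.cong) (auto simp: flags_def)
      ultimately show "of_bool (cube_at x = cube_at y) * ?c - u * (\<Sum>t\<in>?R. of_bool ((t, cube_at x) \<in> flags q n d) *
          of_bool ((t, cube_at y) \<in> flags q n d)) = of_bool (x = y) * ?c - u * common_faces d x y"
        unfolding common_faces_def
        by (simp only: sum.reindex_bij_betw[OF cube_at_bij[of "d - 1"], of "\<lambda>t. of_bool (t \<subseteq> cube_at x) * of_bool (t \<subseteq> cube_at y)"])
    qed simp
    also have "\<dots> = det_on (directions q d \<times> frequencies) (\<lambda>x y. of_bool (x = y) * ?c
        - u * (of_bool (snd x = snd y) * symbol (snd x) (fst x) (fst y)))"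
      by (rule det_common_faces[OF d]) (use elim in simp)
    finally have det: "det_on ?S (\<lambda>s s'. of_bool (s = s') * ?c
        - u * (\<Sum>t\<in>?R. of_bool ((t, s) \<in> flags q n d) * of_bool ((t, s') \<in> flags q n d))) = \<dots>" .
    have "det_on (flags q n d) (\<lambda>x y. of_bool (x = y) - u * of_bool ((x, y) \<in> geodesic_step (flags q n d))) =
        (1 - u) ^ card (flags q n d) * (\<beta> u / (1 - u)) ^ card ?R * (1 / (\<beta> u * (1 - u))) ^ card ?S *
        det_on ?S (\<lambda>s s'. of_bool (s = s') * ?c
        - u * (\<Sum>t\<in>?R. of_bool ((t, s) \<in> flags q n d) * of_bool ((t, s') \<in> flags q n d)))"
      unfolding \<alpha>_def \<beta>_def
    proof (rule det_geodesic_step)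
      show "flags q n d \<subseteq> ?R \<times> ?S" by (auto simp: flags_def)
      show "card {t \<in> ?R. (t, s) \<in> flags q n d} = 2 * d" if "s \<in> ?S" for s
        using card_faces[OF d that] that by (simp add: flags_def conj_ac cong: conj_cong)
      show "card {s \<in> ?S. (t, s) \<in> flags q n d} = 2 * (q - (d - 1))" if "t \<in> ?R" for t
        using card_cofaces[OF d that] that by (simp add: flags_def conj_ac cong: conj_cong)
    qed (use elim in \<open>simp_all add: \<beta>_def\<close>)
    then show ?case using elim card_flags[OF d] by (simp only: det) simp
  qed
qed

lemma one_plus_root_at_mult_cnj:
  "(1 + root_at k i) * (1 + cnj (root_at k i)) = 2 + 2 * cos_freq n k i"
  unfolding root_at_def unity_root_power cos_freq_def by (rule one_plus_root_mult_cnj)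

text \<open>When all directions are present, the only one that can be opened after collapsing
  \<open>i\<close> is \<open>i\<close> itself, so each block is a single number.\<close>

lemma symbol_top: "symbol k {1..q} {1..q} = (\<Sum>i=1..q. 2 + 2 * cos_freq n k i)"
  unfolding symbol_def
proof (rule sum.cong[OF refl])
  fix i assume i: "i \<in> {1..q}"
  then have "{1..q} - ({1..q} - {i}) = {i}" "insert i ({1..q} - {i}) = {1..q}" by auto
  then show "(1 + root_at k i) * (\<Sum>j\<in>{1..q} - ({1..q} - {i}). (1 + cnj (root_at k j)) *
      of_bool (insert j ({1..q} - {i}) = {1..q})) = 2 + 2 * cos_freq n k i"
    by (simp add: one_plus_root_at_mult_cnj)
qed

text \<open>With \<open>j\<close> the missing direction, collapsing \<open>i\<close> leaves two
  choices: reopening \<open>i\<close> returns to the same set, opening \<open>j\<close> makes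
  \<open>i\<close> the missing one. The second choice gives a rank one matrix without its diagonal.
  Completing it adds the weight of \<open>j\<close> on the diagonal, which is why that weight is
  subtracted twice.\<close>

lemma symbol_codim_one:
  assumes j: "j \<in> {1..q}" "j' \<in> {1..q}"
  shows "symbol k ({1..q} - {j}) ({1..q} - {j'}) =
    of_bool (j = j') * ((\<Sum>i=1..q. 2 + 2 * cos_freq n k i) - 2 * (2 + 2 * cos_freq n k j)) +
    (1 + cnj (root_at k j)) * (1 + root_at k j')"
proof -
  let ?z = "root_at k" and ?w = "\<lambda>i. 2 + 2 * cos_freq n k i"
  have "symbol k ({1..q} - {j}) ({1..q} - {j'}) =
      (\<Sum>i\<in>{1..q} - {j}. of_bool (j = j') * ?w i + (1 + cnj (?z j)) * ((1 + ?z i) * of_bool (i = j')))"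
    unfolding symbol_def
  proof (rule sum.cong[OF refl])
    fix i assume i: "i \<in> {1..q} - {j}"
    then have sets: "{1..q} - ({1..q} - {j} - {i}) = {i, j}" "insert i ({1..q} - {j} - {i}) = {1..q} - {j}"
      "insert j ({1..q} - {j} - {i}) = {1..q} - {i}"
      using j by auto
    have eq: "{1..q} - {a} = {1..q} - {j'} \<longleftrightarrow> a = j'" if "a \<in> {1..q}" for a
      using that j by blast
    have pair: "sum f {i, j} = f i + f j" for f :: "nat \<Rightarrow> complex" using i by auto
    have "(\<Sum>l\<in>{1..q} - ({1..q} - {j} - {i}). (1 + cnj (?z l)) * of_bool (insert l ({1..q} - {j} - {i}) = {1..q} - {j'})) =
        (1 + cnj (?z i)) * of_bool (j = j') + (1 + cnj (?z j)) * of_bool (i = j')"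
      unfolding sets(1) pair sets(2,3) using eq[of i] eq[of j] i j by simp
    then show "(1 + ?z i) * (\<Sum>l\<in>{1..q} - ({1..q} - {j} - {i}). (1 + cnj (?z l)) *
        of_bool (insert l ({1..q} - {j} - {i}) = {1..q} - {j'})) =
        of_bool (j = j') * ?w i + (1 + cnj (?z j)) * ((1 + ?z i) * of_bool (i = j'))"
      unfolding one_plus_root_at_mult_cnj[symmetric] by (simp add: algebra_simps)
  qed
  also have "\<dots> = of_bool (j = j') * (\<Sum>i\<in>{1..q} - {j}. ?w i) +
      (1 + cnj (?z j)) * (\<Sum>i\<in>{1..q} - {j}. (1 + ?z i) * of_bool (i = j'))"
    by (subst sum.distrib) (simp only: sum_distrib_left)
  also have "(\<Sum>i\<in>{1..q} - {j}. ?w i) = (\<Sum>i=1..q. ?w i) - ?w j"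
    using j by (subst sum_diff1) auto
  also have "(\<Sum>i\<in>{1..q} - {j}. (1 + ?z i) * of_bool (i = j')) = (1 + ?z j') * of_bool (j \<noteq> j')"
  proof (cases "j = j'")
    case False
    then show ?thesis using j by (subst sum_of_bool_delta) auto
  qed (auto intro!: sum.neutral)
  also have "of_bool (j = j') * ((\<Sum>i=1..q. ?w i) - ?w j) + (1 + cnj (?z j)) * ((1 + ?z j') * of_bool (j \<noteq> j')) =
      of_bool (j = j') * ((\<Sum>i=1..q. ?w i) - 2 * ?w j) + (1 + cnj (?z j)) * (1 + ?z j')"
    using one_plus_root_at_mult_cnj[of k j] by (cases "j = j'") (simp_all add: algebra_simps)
  finally show ?thesis .
qed

end

section \<open>Exponents, and the two closed formulas\<close>

lemma prefactor_power_int: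
  fixes x y :: complex
  assumes "x \<noteq> 0" "y \<noteq> 0"
  shows "x ^ A * (y / x) ^ B * (1 / (y * x)) ^ C = x powi (int A - int B - int C) * y powi (int B - int C)"
  using assms by (simp add: power_int_diff power_divide power_mult_distrib)

lemma twice_choose_two: "2 * int (q choose 2) = int q * (int q - 1)"
proof (induction q)
  case (Suc q)
  have "Suc q choose 2 = (q choose 2) + q" by (simp add: numeral_2_eq_2)
  then have "2 * int (Suc q choose 2) = 2 * int (q choose 2) + 2 * int q" by simp
  then show ?case unfolding Suc by (simp add: algebra_simps)
qed simp

text \<open>Per lattice point and for \<open>d = q - 1\<close>, this is the number of flags minus
  the numbers of lower and of upper cells: \<open>2 * (q - 1) * q\<close>, \<open>q choose 2\<close>
  and \<open>q\<close>. Likewise \<open>gamma\<close> is the number of lower minus the number of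
  upper cells.\<close>

lemma kappa_eq: "kappa q = 2 * int q * (int q - 1) - int (q choose 2) - int q"
proof -
  have "int q * (3 * int q - 5) = 2 * (2 * int q * (int q - 1) - int (q choose 2) - int q)"
    using twice_choose_two[of q] by (simp add: algebra_simps)
  then show ?thesis by (simp add: kappa_def)
qed

lemma gamma_eq: "gamma q = int (q choose 2) - int q"
proof -
  have "int q * (int q - 3) = 2 * (int (q choose 2) - int q)"
    using twice_choose_two[of q] by (simp add: algebra_simps)
  then show ?thesis by (simp add: gamma_def)
qed

context cubical_lattice
begin

lemma zeta_top_eventually:
  assumes q: "1 \<le> q"
  shows "\<forall>\<^sub>F u in nhds 0. zeta_convergent q n q u \<and> inverse (zeta q n q u) =
    (1 - u\<^sup>2) ^ ((q - 1) * (\<Prod>i=1..q. n i)) *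
    (\<Prod>k\<in>frequencies. 1 - 2 * u * (\<Sum>i=1..q. cos_freq n k i) + (2 * of_nat q - 1) * u\<^sup>2)"
  using zeta_eventually[OF q order_refl]
proof eventually_elim
  case (elim u)
  define N where "N = (\<Prod>i=1..q. n i)"
  have \<beta>: "1 + (of_nat (2 * (q - (q - 1))) - 1) * u = 1 + u" using q by simp
  have \<alpha>: "1 + (of_nat (2 * q) - 1) * u = 1 + (2 * of_nat q - 1) * u" by simp
  have nz: "1 - u \<noteq> 0" "1 + u \<noteq> 0" using elim unfolding \<beta> by blast+
  have "q choose (q - 1) = q" using q by (subst binomial_symmetric) simp_all
  then have card: "card (cubes q n q) = N" "card (cubes q n (q - 1)) = q * N"
    by (simp_all add: card_cubes N_def)
  let ?W = "\<lambda>k. \<Sum>i=1..q. 2 + 2 * cos_freq n k i"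
  let ?c = "(1 + (2 * of_nat q - 1) * u) * (1 + u)"
  have dirs: "directions q q = {{1..q}}"
    using card_subset_eq[of "{1..q}"] by (auto simp: directions_def)
  have "det_on (directions q q \<times> frequencies) (\<lambda>x y. of_bool (x = y) * ?c
        - u * (of_bool (snd x = snd y) * symbol (snd x) (fst x) (fst y))) =
      det_on ({{1..q}} \<times> frequencies) (\<lambda>x y. of_bool (x = y) * (?c - u * ?W (snd x)))"
    unfolding dirs by (rule det_on_cong) (auto simp: symbol_top simp del: One_nat_def)
  also have "\<dots> = (\<Prod>x\<in>{{1..q}} \<times> frequencies. ?c - u * ?W (snd x))"
    by (rule det_on_diag) simp
  also have "\<dots> = (\<Prod>k\<in>frequencies. ?c - u * ?W k)"
    by (rule prod.reindex_bij_witness[of _ "\<lambda>k. ({1..q}, k)" snd]) auto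
  also have "\<dots> = (\<Prod>k\<in>frequencies. 1 - 2 * u * (\<Sum>i=1..q. cos_freq n k i) + (2 * of_nat q - 1) * u\<^sup>2)"
    \<comment> \<open>The linear term \<open>2 * q * u\<close> of \<open>?c\<close> cancels against
      the constant part \<open>2 * q\<close> of \<open>?W k\<close>; only the cosines remain in
      degree one.\<close>
    by (intro prod.cong refl) (simp add: sum.distrib sum_distrib_left[symmetric] power2_eq_square algebra_simps)
  finally have det: "det_on (directions q q \<times> frequencies) (\<lambda>x y. of_bool (x = y) * ?c
        - u * (of_bool (snd x = snd y) * symbol (snd x) (fst x) (fst y))) = \<dots>" .
  have "(1 - u) ^ (2 * q * N) * ((1 + u) / (1 - u)) ^ (q * N) * (1 / ((1 + u) * (1 - u))) ^ N =
      (1 - u) powi int ((q - 1) * N) * (1 + u) powi int ((q - 1) * N)"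
    unfolding prefactor_power_int[OF nz] using q by (simp add: of_nat_diff algebra_simps)
  also have "\<dots> = (1 - u\<^sup>2) ^ ((q - 1) * N)"
    unfolding power_int_of_nat power_mult_distrib[symmetric]
    by (simp add: power2_eq_square algebra_simps)
  finally show ?case
    using elim unfolding \<alpha> \<beta> card det N_def by simp
qed

lemma zeta_codim_one_eventually:
  assumes q: "2 \<le> q"
  shows "\<forall>\<^sub>F u in nhds 0. zeta_convergent q n (q - 1) u \<and> inverse (zeta q n (q - 1) u) =
    (1 - u) powi (kappa q * int (\<Prod>i=1..q. n i)) *
    (1 + 3 * u) powi (gamma q * int (\<Prod>i=1..q. n i)) *
    (\<Prod>k\<in>frequencies. F_up q n u k)"
proof -
  let ?w = "\<lambda>k i. 2 + 2 * cos_freq n k i"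
  let ?B = "\<lambda>u k. 1 - 2 * u * (\<Sum>i=1..q. cos_freq n k i) + 3 * (2 * of_nat q - 3) * u\<^sup>2"
  \<comment> \<open>The rank one formula divides by these diagonal entries. There are finitely many,
    and each equals 1 at \<open>u = 0\<close>.\<close>
  have "\<forall>\<^sub>F u in nhds 0. \<forall>x\<in>{1..q} \<times> frequencies. ?B u (snd x) + 2 * u * ?w (snd x) (fst x) \<noteq> 0"
    by (intro eventually_ball_finite ballI eventually_nhds_nonzero) (auto intro!: continuous_intros)
  moreover have "\<forall>\<^sub>F u in nhds 0. 1 - u \<noteq> 0 \<and> 1 + (of_nat (2 * (q - (q - 1 - 1))) - 1) * u \<noteq> 0 \<and>
    zeta_convergent q n (q - 1) u \<and>
    inverse (zeta q n (q - 1) u) = (1 - u) ^ (2 * (q - 1) * card (cubes q n (q - 1))) *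
      ((1 + (of_nat (2 * (q - (q - 1 - 1))) - 1) * u) / (1 - u)) ^ card (cubes q n (q - 1 - 1)) *
      (1 / ((1 + (of_nat (2 * (q - (q - 1 - 1))) - 1) * u) * (1 - u))) ^ card (cubes q n (q - 1)) *
      det_on (directions q (q - 1) \<times> frequencies) (\<lambda>x y. of_bool (x = y) *
          ((1 + (of_nat (2 * (q - 1)) - 1) * u) * (1 + (of_nat (2 * (q - (q - 1 - 1))) - 1) * u))
        - u * (of_bool (snd x = snd y) * symbol (snd x) (fst x) (fst y)))"
    by (rule zeta_eventually) (use q in auto)
  ultimately show ?thesis
  proof eventually_elim
    case (elim u)
    define N where "N = (\<Prod>i=1..q. n i)"
    have "q - (q - 1 - 1) = 2" using q by simp
    then have \<beta>: "1 + (of_nat (2 * (q - (q - 1 - 1))) - 1) * u = 1 + 3 * u" by simp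
    have \<alpha>: "1 + (of_nat (2 * (q - 1)) - 1) * u = 1 + (2 * of_nat q - 3) * u"
      using q by (simp add: of_nat_diff)
    have nz: "1 - u \<noteq> 0" "1 + 3 * u \<noteq> 0" using elim unfolding \<beta> by blast+
    have "q choose (q - 1) = q" "q choose (q - 1 - 1) = q choose 2"
      using q binomial_symmetric[of 1 q] binomial_symmetric[of 2 q] by (simp_all add: numeral_2_eq_2)
    then have card: "card (cubes q n (q - 1)) = q * N" "card (cubes q n (q - 1 - 1)) = (q choose 2) * N"
      by (simp_all only: card_cubes N_def)
    let ?c = "(1 + (2 * of_nat q - 3) * u) * (1 + 3 * u)"
    let ?D = "\<lambda>j k. ?B u k + 2 * u * ?w k j"
    \<comment> \<open>The product \<open>?c\<close> expands to
      \<open>1 + 2 * q * u + 3 * (2 * q - 3) * u\<^sup>2\<close>, and its linear term cancels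
      against the constant part of the sum of weights. This is the origin of the quadratic in
      \<open>F_up\<close>.\<close>
    have c: "?c - u * ((\<Sum>i=1..q. ?w k i) - 2 * ?w k j) = ?D j k" for j k
      by (simp add: sum.distrib sum_distrib_left[symmetric] power2_eq_square algebra_simps)
    have D: "?D j k \<noteq> 0" if "j \<in> {1..q}" "k \<in> frequencies" for j k
      using elim that by force
    \<comment> \<open>Direction sets of size \<open>q - 1\<close> are renamed by their missing
      direction, so that the blocks are indexed by \<open>{1..q}\<close> as in the rank one
      formula.\<close>
    have "bij_betw (\<lambda>j. {1..q} - {j}) {1..q} (directions q (q - 1))"
      unfolding bij_betw_def
    proof
      show "inj_on (\<lambda>j. {1..q} - {j}) {1..q}" by (auto simp: inj_on_def)
      show "(\<lambda>j. {1..q} - {j}) ` {1..q} = directions q (q - 1)"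
      proof (intro equalityI subsetI)
        fix s assume s: "s \<in> directions q (q - 1)"
        then have "card ({1..q} - s) = 1"
          using q by (simp add: directions_def card_Diff_subset finite_subset[of s "{1..q}"])
        then obtain j where "{1..q} - s = {j}" by (auto simp: card_1_singleton_iff)
        then have "s = {1..q} - {j}" "j \<in> {1..q}" using s by (auto simp: directions_def)
        then show "s \<in> (\<lambda>j. {1..q} - {j}) ` {1..q}" by blast
      qed (auto simp: directions_def)
    qed
    then have bij: "bij_betw (map_prod (\<lambda>j. {1..q} - {j}) id) ({1..q} \<times> frequencies) (directions q (q - 1) \<times> frequencies)"
      by (intro bij_betw_map_prod) simp_all
    let ?h = "map_prod (\<lambda>j. {1..q} - {j}) id"
    let ?M = "\<lambda>x y. of_bool (x = y) * ?c - u * (of_bool (snd x = snd y) * symbol (snd x) (fst x) (fst y))"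
    have "det_on (directions q (q - 1) \<times> frequencies) ?M =
        det_on ({1..q} \<times> frequencies) (\<lambda>x y. ?M (?h x) (?h y))"
      by (rule det_on_bij[symmetric, OF _ bij]) simp
    also have "\<dots> =
      det_on ({1..q} \<times> frequencies) (\<lambda>x y. of_bool (x = y) * ?D (fst x) (snd x) - of_bool (snd x = snd y) *
        ((u * (1 + cnj (root_at (snd x) (fst x)))) * (1 + root_at (snd x) (fst y))))"
    proof (rule det_on_cong)
      fix x y assume "x \<in> {1..q} \<times> frequencies" "y \<in> {1..q} \<times> frequencies"
      then obtain j k i l where xy: "x = (j, k)" "y = (i, l)" "j \<in> {1..q}" "i \<in> {1..q}" by auto
      have "{1..q} - {j} = {1..q} - {i} \<longleftrightarrow> j = i" using xy(3,4) by blast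
      then show "?M (?h x) (?h y) =
        of_bool (x = y) * ?D (fst x) (snd x) - of_bool (snd x = snd y) *
          ((u * (1 + cnj (root_at (snd x) (fst x)))) * (1 + root_at (snd x) (fst y)))"
        unfolding c[symmetric] xy(1,2) map_prod_simp fst_conv snd_conv id_apply prod.inject
          symbol_codim_one[OF xy(3,4)]
        by (cases "j = i"; cases "k = l") (simp_all add: algebra_simps)
    qed simp
    also have "\<dots> = (\<Prod>k\<in>frequencies. (\<Prod>j=1..q. ?D j k) *
        (1 - (\<Sum>j=1..q. (u * (1 + cnj (root_at k j))) * (1 + root_at k j) / ?D j k)))"
      by (rule det_on_diag_minus_rank_one) (use D in simp_all)
    also have "\<dots> = (\<Prod>k\<in>frequencies. F_up q n u k)"
    proof (rule prod.cong[OF refl])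
      fix k assume k: "k \<in> frequencies"
      have weight: "u * (1 + cnj (root_at k j)) * (1 + root_at k j) = u * ?w k j" for j
        unfolding one_plus_root_at_mult_cnj[symmetric] by (simp only: mult_ac)
      show "(\<Prod>j=1..q. ?D j k) * (1 - (\<Sum>j=1..q. (u * (1 + cnj (root_at k j))) * (1 + root_at k j) / ?D j k)) =
          F_up q n u k"
        unfolding F_up_def weight by (rule rank_one_factor_elem_sym) (rule D[OF _ k])
    qed
    finally have det: "det_on (directions q (q - 1) \<times> frequencies) (\<lambda>x y. of_bool (x = y) * ?c
        - u * (of_bool (snd x = snd y) * symbol (snd x) (fst x) (fst y))) = \<dots>" .
    have "(1 - u) ^ (2 * (q - 1) * (q * N)) * ((1 + 3 * u) / (1 - u)) ^ ((q choose 2) * N) *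
        (1 / ((1 + 3 * u) * (1 - u))) ^ (q * N) =
        (1 - u) powi (kappa q * int N) * (1 + 3 * u) powi (gamma q * int N)"
    proof -
      have "int (q - 1) = int q - 1" using q by simp
      then have "int (2 * (q - 1) * (q * N)) - int ((q choose 2) * N) - int (q * N) = kappa q * int N"
        unfolding kappa_eq by (simp only: of_nat_mult of_nat_numeral) (simp add: algebra_simps)
      moreover have "int ((q choose 2) * N) - int (q * N) = gamma q * int N"
        unfolding gamma_eq by (simp add: algebra_simps)
      ultimately show ?thesis unfolding prefactor_power_int[OF nz] by (simp only:)
    qed
    then show ?case
      using elim unfolding \<alpha> \<beta> card det N_def by (simp only:)
  qed
qed

end

theorem theorem1p2:
  fixes q :: nat and n :: "nat \<Rightarrow> nat"
  assumes "q \<ge> 1" and "\<And>i. i \<in> {1..q} \<Longrightarrow> n i \<ge> 2"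
  shows "(\<exists>r>0. \<forall>u::complex. norm u < r \<longrightarrow>
            zeta_convergent q n q u \<and>
            inverse (zeta q n q u) =
              (1 - u\<^sup>2) ^ ((q - 1) * (\<Prod>i=1..q. n i)) *
              (\<Prod>k\<in>PiE {1..q} (\<lambda>i. {1..n i}).
                 1 - 2 * u * (\<Sum>i=1..q. cos_freq n k i) + (2 * of_nat q - 1) * u\<^sup>2)) \<and>
         (q \<ge> 2 \<longrightarrow>
          (\<exists>r>0. \<forall>u::complex. norm u < r \<longrightarrow>
            zeta_convergent q n (q - 1) u \<and>
            inverse (zeta q n (q - 1) u) =
              (1 - u) powi (kappa q * int (\<Prod>i=1..q. n i)) *
              (1 + 3 * u) powi (gamma q * int (\<Prod>i=1..q. n i)) *
              (\<Prod>k\<in>PiE {1..q} (\<lambda>i. {1..n i}). F_up q n u k)))"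
proof -
  interpret cubical_lattice q n using assms(2) by unfold_locales
  show ?thesis
    by (intro conjI impI zeta_top_eventually[OF assms(1), unfolded eventually_nhds_metric dist_norm diff_zero frequencies_def]
        zeta_codim_one_eventually[unfolded eventually_nhds_metric dist_norm diff_zero frequencies_def])
qed

end
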